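(* Let $A_\Gamma=A_{\Gamma_1}*_{A_{\Gamma_0}}A_{\Gamma_2}$ be an Artin group expressed as a visual splitting, such that: (1) the power alternative holds for the factors $A_{\Gamma_1}$ and $A_{\Gamma_2}$; (2) $A_\Gamma$ has the parabolic intersection property and the normaliser structure property. Then the power alternative holds for $A_\Gamma$.
   Context: A group $G$ satisfies the power alternative if for every $g,h\in G$ there exists an integer $n\ge 1$ such that either $g^n$ and $h^n$ commute or $\langle g^n,h^n\rangle\cong F_2$. A presentation graph is a finite simplicial graph $\Gamma$ with a label $m_{st}\in\{2,3,\dots\}$ on each edge $\{s,t\}$. The Artin group is $A_\Gamma=\langle \mathrm{Vert}(\Gamma)\mid \underbrace{sts\cdots}_{m_{st}}=\underbrace{tst\cdots}_{m_{st}}\text{ for every edge }\{s,t\}\rangle$. For $S\subseteq\mathrm{Vert}(\Gamma)$, the subgroup $A_S=\langle S\rangle$ is a standard parabolic subgroup; it is naturally isomorphic to the Artin group of the full subgraph of $\Gamma$ spanned by $S$. A parabolic subgroup is a conjugate of a standard parabolic subgroup. Visual splitting: if $\Gamma_0\le\Gamma_1,\Gamma_2<\Gamma$ are non-empty induced subgraphs ($\Gamma_1,\Gamma_2$ proper) with $\Gamma_1\cup\Gamma_2=\Gamma$ and $\Gamma_1\cap\Gamma_2=\Gamma_0$, then $A_\Gamma\cong A_{\Gamma_1}*_{A_{\Gamma_0}}A_{\Gamma_2}$; this amalgam is called a visual splitting. Parabolic intersection property: for all parabolic subgroups $P,Q\le A_\Gamma$, the intersection $P\cap Q$ is a parabolic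 subgroup of $A_\Gamma$. Normaliser structure property: for every $S\subseteq\mathrm{Vert}(\Gamma)$, the normaliser of $A_S$ in $A_\Gamma$ is $N_{A_\Gamma}(A_S)=A_S\cdot \mathrm{QZ}_{A_\Gamma}(A_S)$, where $\mathrm{QZ}_{A_\Gamma}(A_S)=\{g\in A_\Gamma: gSg^{-1}=S\}$. *)

theory Defs
  imports "HOL-Algebra.Elementary_Groups" "HOL-Algebra.Group_Action"
begin

section \<open>Groups given by generators and relations\<close>

text \<open>The letter \<open>(x, True)\<close> stands for the generator \<open>x\<close> and \<open>(x, False)\<close> for its formal inverse.\<close>

type_synonym 'v gword = "('v \<times> bool) list"

definition gwords :: "'v set \<Rightarrow> 'v gword set" where
  "gwords X = lists (X \<times> UNIV)"

inductive pres_eq :: "'v set \<Rightarrow> ('v gword \<times> 'v gword) set \<Rightarrow> 'v gword \<Rightarrow> 'v gword \<Rightarrow> bool"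
  for X R where
  refl: "w \<in> gwords X \<Longrightarrow> pres_eq X R w w"
| sym: "pres_eq X R v w \<Longrightarrow> pres_eq X R w v"
| trans: "pres_eq X R u v \<Longrightarrow> pres_eq X R v w \<Longrightarrow> pres_eq X R u w"
| cancel: "u \<in> gwords X \<Longrightarrow> v \<in> gwords X \<Longrightarrow> x \<in> X \<Longrightarrow>
    pres_eq X R (u @ [(x, b), (x, \<not> b)] @ v) (u @ v)"
| relation: "u \<in> gwords X \<Longrightarrow> v \<in> gwords X \<Longrightarrow> (r, r') \<in> R \<Longrightarrow> r \<in> gwords X \<Longrightarrow> r' \<in> gwords X \<Longrightarrow>
    pres_eq X R (u @ r @ v) (u @ r' @ v)"

definition pres_rel :: "'v set \<Rightarrow> ('v gword \<times> 'v gword) set \<Rightarrow> ('v gword \<times> 'v gword) set" where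
  "pres_rel X R = {(v, w). pres_eq X R v w}"

definition presented_group :: "'v set \<Rightarrow> ('v gword \<times> 'v gword) set \<Rightarrow> 'v gword set monoid" where
  "presented_group X R =
    \<lparr>carrier = gwords X // pres_rel X R,
     mult = (\<lambda>A B. \<Union>v\<in>A. \<Union>w\<in>B. pres_rel X R `` {v @ w}),
     one = pres_rel X R `` {[]}\<rparr>"

abbreviation free_group :: "'v set \<Rightarrow> 'v gword set monoid" where
  "free_group X \<equiv> presented_group X {}"

definition power_alternative :: "('a, 'b) monoid_scheme \<Rightarrow> bool" where
  "power_alternative G \<longleftrightarrow>
    (\<forall>g\<in>carrier G. \<forall>h\<in>carrier G. \<exists>n::nat. n \<ge> 1 \<and>
      (g [^]\<^bsub>G\<^esub> n \<otimes>\<^bsub>G\<^esub> h [^]\<^bsub>G\<^esub> n = h [^]\<^bsub>G\<^esub> n \<otimes>\<^bsub>G\<^esub> g [^]\<^bsub>G\<^esub> n \<or>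
       subgroup_generated G {g [^]\<^bsub>G\<^esub> n, h [^]\<^bsub>G\<^esub> n} \<cong> free_group (UNIV :: bool set)))"


section \<open>Presentation graphs and Artin groups\<close>

record 'v pgraph =
  Vert :: "'v set"
  Edge :: "'v set set"
  label :: "'v set \<Rightarrow> nat"

definition presentation_graph :: "'v pgraph \<Rightarrow> bool" where
  "presentation_graph \<Gamma> \<longleftrightarrow>
    finite (Vert \<Gamma>) \<and>
    Edge \<Gamma> \<subseteq> {{s, t} | s t. s \<in> Vert \<Gamma> \<and> t \<in> Vert \<Gamma> \<and> s \<noteq> t} \<and>
    (\<forall>e\<in>Edge \<Gamma>. label \<Gamma> e \<ge> 2)"

fun alternating :: "nat \<Rightarrow> 'v \<Rightarrow> 'v \<Rightarrow> 'v gword" where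
  "alternating 0 s t = []"
| "alternating (Suc n) s t = (s, True) # alternating n t s"

definition artin_relations :: "'v pgraph \<Rightarrow> ('v gword \<times> 'v gword) set" where
  "artin_relations \<Gamma> =
    {(alternating (label \<Gamma> {s, t}) s t, alternating (label \<Gamma> {s, t}) t s) | s t. {s, t} \<in> Edge \<Gamma>}"

definition artin_group :: "'v pgraph \<Rightarrow> 'v gword set monoid" where
  "artin_group \<Gamma> = presented_group (Vert \<Gamma>) (artin_relations \<Gamma>)"

definition artin_gen :: "'v pgraph \<Rightarrow> 'v \<Rightarrow> 'v gword set" where
  "artin_gen \<Gamma> s = pres_rel (Vert \<Gamma>) (artin_relations \<Gamma>) `` {[(s, True)]}"

definition standard_parabolic :: "'v pgraph \<Rightarrow> 'v set \<Rightarrow> 'v gword set set" where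
  "standard_parabolic \<Gamma> S = generate (artin_group \<Gamma>) (artin_gen \<Gamma> ` S)"

definition conjugate_set :: "('a, 'b) monoid_scheme \<Rightarrow> 'a \<Rightarrow> 'a set \<Rightarrow> 'a set" where
  "conjugate_set G g H = g <#\<^bsub>G\<^esub> H #>\<^bsub>G\<^esub> inv\<^bsub>G\<^esub> g"

definition parabolic :: "'v pgraph \<Rightarrow> 'v gword set set \<Rightarrow> bool" where
  "parabolic \<Gamma> P \<longleftrightarrow>
    (\<exists>S g. S \<subseteq> Vert \<Gamma> \<and> g \<in> carrier (artin_group \<Gamma>) \<and>
      P = conjugate_set (artin_group \<Gamma>) g (standard_parabolic \<Gamma> S))"

definition parabolic_intersection_property :: "'v pgraph \<Rightarrow> bool" where
  "parabolic_intersection_property \<Gamma> \<longleftrightarrow>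
    (\<forall>P Q. parabolic \<Gamma> P \<longrightarrow> parabolic \<Gamma> Q \<longrightarrow> parabolic \<Gamma> (P \<inter> Q))"

text \<open>The quasi-centraliser \<open>QZ(A\<^sub>S)\<close>: its elements permute the set of generators \<open>S\<close> by conjugation.\<close>

definition quasi_centralizer :: "'v pgraph \<Rightarrow> 'v set \<Rightarrow> 'v gword set set" where
  "quasi_centralizer \<Gamma> S =
    {g \<in> carrier (artin_group \<Gamma>).
      conjugate_set (artin_group \<Gamma>) g (artin_gen \<Gamma> ` S) = artin_gen \<Gamma> ` S}"

definition normaliser_structure_property :: "'v pgraph \<Rightarrow> bool" where
  "normaliser_structure_property \<Gamma> \<longleftrightarrow>
    (\<forall>S\<subseteq>Vert \<Gamma>. normalizer (artin_group \<Gamma>) (standard_parabolic \<Gamma> S) =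
      standard_parabolic \<Gamma> S <#>\<^bsub>artin_group \<Gamma>\<^esub> quasi_centralizer \<Gamma> S)"


section \<open>Visual splittings\<close>

definition induced_subgraph :: "'v pgraph \<Rightarrow> 'v pgraph \<Rightarrow> bool" where
  "induced_subgraph \<Delta> \<Gamma> \<longleftrightarrow>
    Vert \<Delta> \<subseteq> Vert \<Gamma> \<and>
    Edge \<Delta> = {e \<in> Edge \<Gamma>. e \<subseteq> Vert \<Delta>} \<and>
    (\<forall>e\<in>Edge \<Delta>. label \<Delta> e = label \<Gamma> e)"

text \<open>The combinatorial data of a visual splitting. The decomposition of \<open>artin_group \<Gamma>\<close> as the
  amalgam of \<open>artin_group \<Gamma>1\<close> and \<open>artin_group \<Gamma>2\<close> over \<open>artin_group \<Gamma>0\<close> is a consequence and is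
  not part of the definition.\<close>

definition visual_splitting :: "'v pgraph \<Rightarrow> 'v pgraph \<Rightarrow> 'v pgraph \<Rightarrow> 'v pgraph \<Rightarrow> bool" where
  "visual_splitting \<Gamma> \<Gamma>0 \<Gamma>1 \<Gamma>2 \<longleftrightarrow>
    induced_subgraph \<Gamma>1 \<Gamma> \<and> induced_subgraph \<Gamma>2 \<Gamma> \<and>
    induced_subgraph \<Gamma>0 \<Gamma>1 \<and> induced_subgraph \<Gamma>0 \<Gamma>2 \<and>
    Vert \<Gamma>0 \<noteq> {} \<and> Vert \<Gamma>1 \<noteq> {} \<and> Vert \<Gamma>2 \<noteq> {} \<and>
    Vert \<Gamma>1 \<noteq> Vert \<Gamma> \<and> Vert \<Gamma>2 \<noteq> Vert \<Gamma> \<and>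
    Vert \<Gamma>1 \<union> Vert \<Gamma>2 = Vert \<Gamma> \<and> Edge \<Gamma>1 \<union> Edge \<Gamma>2 = Edge \<Gamma> \<and>
    Vert \<Gamma>1 \<inter> Vert \<Gamma>2 = Vert \<Gamma>0 \<and> Edge \<Gamma>1 \<inter> Edge \<Gamma>2 = Edge \<Gamma>0"


section \<open>Presented groups are groups\<close>

lemma gwords_append [simp]: "u @ v \<in> gwords X \<longleftrightarrow> u \<in> gwords X \<and> v \<in> gwords X"
  by (auto simp: gwords_def)

lemma gwords_Nil [simp]: "[] \<in> gwords X"
  by (auto simp: gwords_def)

lemma gwords_Cons [simp]: "(x, b) # w \<in> gwords X \<longleftrightarrow> x \<in> X \<and> w \<in> gwords X"
  by (auto simp: gwords_def)

lemma pres_eq_gwords: "pres_eq X R v w \<Longrightarrow> v \<in> gwords X \<and> w \<in> gwords X"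
  by (induction rule: pres_eq.induct) auto

lemma equiv_pres_rel: "equiv (gwords X) (pres_rel X R)"
  by (auto simp: equiv_def refl_on_def sym_def trans_def pres_rel_def
      dest: pres_eq_gwords intro: pres_eq.refl pres_eq.sym pres_eq.trans)

lemma pres_eq_context:
  assumes "pres_eq X R v w" "a \<in> gwords X" "b \<in> gwords X"
  shows "pres_eq X R (a @ v @ b) (a @ w @ b)"
  using assms
proof (induction rule: pres_eq.induct)
  case (cancel u v x c)
  then show ?case using pres_eq.cancel[of "a @ u" X "v @ b" x R c] by simp
next
  case (relation u v r r')
  then show ?case using pres_eq.relation[of "a @ u" X "v @ b" r r' R] by simp
qed (auto intro: pres_eq.refl pres_eq.sym pres_eq.trans)

lemma pres_eq_append:
  assumes "pres_eq X R v v'" "pres_eq X R w w'"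
  shows "pres_eq X R (v @ w) (v' @ w')"
  using pres_eq_context[OF assms(1), of "[]" w] pres_eq_context[OF assms(2), of v' "[]"]
    pres_eq_gwords[OF assms(1)] pres_eq_gwords[OF assms(2)]
  by (auto intro: pres_eq.trans)

lemma pres_class_eq_iff:
  assumes "v \<in> gwords X" "w \<in> gwords X"
  shows "pres_rel X R `` {v} = pres_rel X R `` {w} \<longleftrightarrow> pres_eq X R v w"
  using eq_equiv_class_iff[OF equiv_pres_rel assms, of R] by (simp add: pres_rel_def)

lemma pres_mult:
  assumes "v \<in> gwords X" "w \<in> gwords X"
  shows "pres_rel X R `` {v} \<otimes>\<^bsub>presented_group X R\<^esub> pres_rel X R `` {w} = pres_rel X R `` {v @ w}"
proof -
  have "congruent2 (pres_rel X R) (pres_rel X R) (\<lambda>v w. pres_rel X R `` {v @ w})"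
  proof (rule congruent2I')
    fix v v' w w' assume "(v, v') \<in> pres_rel X R" "(w, w') \<in> pres_rel X R"
    then have "(v @ w, v' @ w') \<in> pres_rel X R"
      by (auto simp: pres_rel_def intro: pres_eq_append)
    then show "pres_rel X R `` {v @ w} = pres_rel X R `` {v' @ w'}"
      by (rule equiv_class_eq[OF equiv_pres_rel])
  qed
  from UN_equiv_class2[OF equiv_pres_rel equiv_pres_rel this assms]
  show ?thesis by (simp add: presented_group_def)
qed

definition gword_inv :: "'v gword \<Rightarrow> 'v gword" where
  "gword_inv w = rev (map (\<lambda>(x, b). (x, \<not> b)) w)"

lemma gword_inv_in [simp]: "gword_inv w \<in> gwords X \<longleftrightarrow> w \<in> gwords X"
  by (induction w) (auto simp: gword_inv_def)

lemma pres_eq_gword_inv: "w \<in> gwords X \<Longrightarrow> pres_eq X R (gword_inv w @ w) []"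
proof (induction w)
  case Nil
  then show ?case by (simp add: gword_inv_def pres_eq.refl)
next
  case (Cons a w)
  obtain x b where a: "a = (x, b)" by force
  have "pres_eq X R (gword_inv w @ [(x, \<not> b), (x, \<not> \<not> b)] @ w) (gword_inv w @ w)"
    using Cons.prems a by (intro pres_eq.cancel) auto
  with Cons a show ?case by (auto simp: gword_inv_def intro: pres_eq.trans)
qed

lemma group_presented_group: "group (presented_group X R)"
proof (rule groupI)
  let ?G = "presented_group X R"
  have carr: "A \<in> carrier ?G \<longleftrightarrow> (\<exists>w\<in>gwords X. A = pres_rel X R `` {w})" for A
    by (auto simp: presented_group_def quotient_def)
  have one: "\<one>\<^bsub>?G\<^esub> = pres_rel X R `` {[]}"
    by (simp add: presented_group_def)
  show "\<one>\<^bsub>?G\<^esub> \<in> carrier ?G"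
    unfolding carr one by (intro bexI[of _ "[]"]) auto
  fix A assume A: "A \<in> carrier ?G"
  then obtain a where a: "a \<in> gwords X" "A = pres_rel X R `` {a}" by (auto simp: carr)
  show "\<one>\<^bsub>?G\<^esub> \<otimes>\<^bsub>?G\<^esub> A = A" using a by (simp add: one pres_mult)
  have "pres_rel X R `` {gword_inv a} \<otimes>\<^bsub>?G\<^esub> A = \<one>\<^bsub>?G\<^esub>"
    using a by (simp add: one pres_mult pres_class_eq_iff pres_eq_gword_inv)
  moreover have "pres_rel X R `` {gword_inv a} \<in> carrier ?G"
    unfolding carr using a by (intro bexI[of _ "gword_inv a"]) auto
  ultimately show "\<exists>B\<in>carrier ?G. B \<otimes>\<^bsub>?G\<^esub> A = \<one>\<^bsub>?G\<^esub>" by blast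
  fix B assume "B \<in> carrier ?G"
  then obtain b where b: "b \<in> gwords X" "B = pres_rel X R `` {b}" by (auto simp: carr)
  show "A \<otimes>\<^bsub>?G\<^esub> B \<in> carrier ?G"
    unfolding carr using a b by (intro bexI[of _ "a @ b"]) (auto simp: pres_mult)
  fix C assume "C \<in> carrier ?G"
  then obtain c where c: "c \<in> gwords X" "C = pres_rel X R `` {c}" by (auto simp: carr)
  show "A \<otimes>\<^bsub>?G\<^esub> B \<otimes>\<^bsub>?G\<^esub> C = A \<otimes>\<^bsub>?G\<^esub> (B \<otimes>\<^bsub>?G\<^esub> C)"
    using a b c by (simp add: pres_mult)
qed

lemma group_artin_group: "group (artin_group \<Gamma>)"
  unfolding artin_group_def by (rule group_presented_group)

end

theory Submission
  imports Defs Complex_Main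
begin

text \<open>The group acts on the Bass--Serre tree of the splitting; vertex stabilisers are parabolic and
  satisfy the power alternative. For two elements, either powers fix a common vertex, or a
  ping-pong argument shows that powers generate a free group, or powers of both shift (or fix) a
  common ray. In the last case the pointwise stabilisers of the tails of the ray form a chain of
  parabolic subgroups, which stabilises at some \<open>P\<close> normalised by both elements. By the normaliser
  structure, powers of them have the form \<open>a z\<^sup>i\<close> and \<open>b z\<^sup>j\<close> with \<open>a, b \<in> P\<close> and \<open>z\<close> centralising
  \<open>P\<close>, so that the alternative for \<open>a, b\<close> in a vertex stabiliser carries over.

  Two facts about standard parabolic subgroups are needed: the Artin group of an induced subgraph
  embeds (van der Lek), and \<open>A\<^sub>S\<close> is not conjugate to a proper subgroup of itself, which makes
  chains of parabolic subgroups stabilise. Both follow from an action of the Artin group on pairs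
  of a minimal coset representative in the Coxeter group and an element of a target group.\<close>

section \<open>Words, free groups and the power alternative for pairs\<close>

text \<open>A visual splitting is purely combinatorial data, so no amalgam and no tree is given. The
  two factors act on lists of coset representatives, these actions agree on the common parabolic
  subgroup, and every Artin relation comes from an edge, hence lies in one factor; so the letters
  act compatibly with all relations. The tree enters only as an integer distance with the four-point
  condition, and ends enter as large Gromov products.

  The pairs of a minimal representative and a group element refine the Coxeter group acting on the
  cosets of \<open>W_T\<close>: a letter \<open>s\<close> either moves the coset of
  \<open>y\<close>, or \<open>s y = y t\<close> with \<open>t\<close> in \<open>T\<close>, and then
  the value of \<open>t\<close> multiplies the second entry. Values in the Artin group of a subgraph
  give the embedding, values in the ambient Artin group the statement on conjugates.

  Twisting by \<open>z\<close> preserves free pairs because a free group of rank two has trivial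
  centre. One obstacle is uniformity: the power of an elliptic element that fixes a segment depends
  on the segment; the descending chain condition lets one segment control a whole ray.\<close>

lemma foldr_closed:
  assumes "w \<in> gwords X" "z \<in> Z" "\<And>x b z. x \<in> X \<Longrightarrow> z \<in> Z \<Longrightarrow> F (x, b) z \<in> Z"
  shows "foldr F w z \<in> Z"
  using assms(1,2) by (induction w) (auto simp: assms(3))

text \<open>Words of a presentation are told apart by letting the letters act on a set
  \<open>Z\<close>: only cancellation and the relations have to be checked. The actions are
  \<open>push\<close> on reduced words, \<open>step\<close> on coset pairs and
  \<open>letter_act\<close> on vertices of the tree.\<close>

lemma pres_eq_foldr:
  assumes "pres_eq X R v w" and "z \<in> Z"
    and closed: "\<And>x b z. x \<in> X \<Longrightarrow> z \<in> Z \<Longrightarrow> F (x, b) z \<in> Z"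
    and canc: "\<And>x b z. x \<in> X \<Longrightarrow> z \<in> Z \<Longrightarrow> F (x, b) (F (x, \<not> b) z) = z"
    and rel: "\<And>r r' z. (r, r') \<in> R \<Longrightarrow> r \<in> gwords X \<Longrightarrow> r' \<in> gwords X \<Longrightarrow> z \<in> Z \<Longrightarrow>
      foldr F r z = foldr F r' z"
  shows "foldr F v z = foldr F w z"
  using assms(1,2)
proof (induction arbitrary: z rule: pres_eq.induct)
  case (cancel u v x b)
  have "foldr F v z \<in> Z" using foldr_closed[of v X z Z F] cancel closed by blast
  then show ?case using canc cancel by simp
next
  case (relation u v r r')
  have "foldr F v z \<in> Z" using foldr_closed[of v X z Z F] relation closed by blast
  then show ?case using rel relation by simp
qed auto

fun wev :: "('a, 'b) monoid_scheme \<Rightarrow> ('v \<Rightarrow> 'a) \<Rightarrow> 'v gword \<Rightarrow> 'a" where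
  "wev G f [] = \<one>\<^bsub>G\<^esub>"
| "wev G f ((x, b) # w) = (if b then f x else inv\<^bsub>G\<^esub> (f x)) \<otimes>\<^bsub>G\<^esub> wev G f w"

context group begin

lemma wev_closed [simp]: "f \<in> X \<rightarrow> carrier G \<Longrightarrow> w \<in> gwords X \<Longrightarrow> wev G f w \<in> carrier G"
  by (induction w) (auto simp: Pi_iff)

lemma wev_append:
  "f \<in> X \<rightarrow> carrier G \<Longrightarrow> v \<in> gwords X \<Longrightarrow> w \<in> gwords X \<Longrightarrow>
    wev G f (v @ w) = wev G f v \<otimes> wev G f w"
proof (induction v)
  case (Cons a v)
  obtain x b where a: "a = (x, b)" by force
  have "(if b then f x else inv (f x)) \<in> carrier G" using Cons.prems a by auto
  moreover have "wev G f v \<in> carrier G" "wev G f w \<in> carrier G" using Cons.prems a by auto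
  ultimately show ?case using Cons a by (auto simp: m_assoc)
qed auto

lemma wev_inv:
  assumes "f \<in> X \<rightarrow> carrier G" "w \<in> gwords X"
  shows "wev G f (gword_inv w) = inv (wev G f w)"
  using assms(2)
proof (induction w)
  case (Cons a w)
  obtain x b where a: "a = (x, b)" by force
  have fx: "f x \<in> carrier G" using Cons.prems assms a by auto
  have w: "w \<in> gwords X" "x \<in> X" using Cons.prems a by auto
  have "wev G f (gword_inv (a # w)) = wev G f (gword_inv w @ [(x, \<not> b)])"
    by (simp add: gword_inv_def a)
  also have "\<dots> = wev G f (gword_inv w) \<otimes> wev G f [(x, \<not> b)]"
    using w assms(1) by (intro wev_append[of f X]) auto
  finally show ?case using Cons w fx a assms(1) by (auto simp: inv_mult_group)
qed (simp add: gword_inv_def)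

lemma generate_eq_wev:
  assumes "f \<in> X \<rightarrow> carrier G"
  shows "generate G (f ` X) = wev G f ` gwords X"
proof
  show "generate G (f ` X) \<subseteq> wev G f ` gwords X"
  proof
    fix g assume "g \<in> generate G (f ` X)"
    then show "g \<in> wev G f ` gwords X"
    proof (induction rule: generate.induct)
      case one
      then show ?case by (intro image_eqI[of _ _ "[]"]) auto
    next
      case (incl h)
      then obtain x where "x \<in> X" "h = f x" by auto
      then show ?case using assms by (intro image_eqI[of _ _ "[(x, True)]"]) (auto simp: Pi_iff)
    next
      case (inv h)
      then obtain x where "x \<in> X" "h = f x" by auto
      then show ?case using assms by (intro image_eqI[of _ _ "[(x, False)]"]) (auto simp: Pi_iff)
    next
      case (eng h1 h2)
      then obtain v w where "v \<in> gwords X" "w \<in> gwords X" "h1 = wev G f v" "h2 = wev G f w" by auto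
      then show ?case using assms
        by (intro image_eqI[of _ _ "v @ w"]) (auto simp: wev_append[of f X])
    qed
  qed
  have "wev G f w \<in> generate G (f ` X)" if "w \<in> gwords X" for w
    using that
  proof (induction w)
    case (Cons a w)
    obtain x b where a: "a = (x, b)" by force
    show ?case using Cons a by (auto intro: generate.intros)
  qed (auto intro: generate.intros)
  then show "wev G f ` gwords X \<subseteq> generate G (f ` X)" by auto
qed

lemma wev_pres_eq:
  assumes "pres_eq X R v w" "f \<in> X \<rightarrow> carrier G"
    and "\<And>r r'. (r, r') \<in> R \<Longrightarrow> r \<in> gwords X \<Longrightarrow> r' \<in> gwords X \<Longrightarrow> wev G f r = wev G f r'"
  shows "wev G f v = wev G f w"
  using assms(1)
proof (induction rule: pres_eq.induct)
  case (cancel u v x b)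
  have fx: "f x \<in> carrier G" using cancel assms(2) by auto
  have "wev G f [(x, b), (x, \<not> b)] = \<one>" using fx by auto
  then show ?case using cancel assms(2)
    by (simp only: wev_append[of f X] gwords_append gwords_Cons gwords_Nil simp_thms) (simp add: wev_append[of f X])
next
  case (relation u v r r')
  then show ?case using assms by (simp add: wev_append[of f X])
qed auto

lemma subgroup_generated_carrier:
  assumes "f \<in> X \<rightarrow> carrier G"
  shows "carrier (subgroup_generated G (f ` X)) = wev G f ` gwords X"
proof -
  have "carrier G \<inter> f ` X = f ` X" using assms by auto
  then show ?thesis by (simp add: carrier_subgroup_generated generate_eq_wev[OF assms])
qed

end

text \<open>Two words have equal value iff \<open>v @ gword_inv w\<close> has value one. So equal
  kernels make the choice of a representing word in \<open>h\<close> harmless, and the same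
  equivalence read backwards gives injectivity.\<close>

lemma subgroup_generated_iso_if_same_relations:
  assumes "group G" "group H" and f: "f \<in> X \<rightarrow> carrier G" and f': "f' \<in> X \<rightarrow> carrier H"
    and ker: "\<And>w. w \<in> gwords X \<Longrightarrow> wev G f w = \<one>\<^bsub>G\<^esub> \<longleftrightarrow> wev H f' w = \<one>\<^bsub>H\<^esub>"
  shows "subgroup_generated G (f ` X) \<cong> subgroup_generated H (f' ` X)"
proof -
  interpret G: group G by fact
  interpret H: group H by fact
  have eq: "wev G f v = wev G f w \<longleftrightarrow> wev H f' v = wev H f' w" if "v \<in> gwords X" "w \<in> gwords X" for v w
  proof -
    have "wev G f v = wev G f w \<longleftrightarrow> wev G f (v @ gword_inv w) = \<one>\<^bsub>G\<^esub>"
      using that f by (simp add: G.wev_append[of f X] G.wev_inv[of f X])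
        (metis G.inv_equality G.inv_inv G.r_inv G.wev_closed G.inv_closed)
    also have "\<dots> \<longleftrightarrow> wev H f' (v @ gword_inv w) = \<one>\<^bsub>H\<^esub>" using ker that by simp
    also have "\<dots> \<longleftrightarrow> wev H f' v = wev H f' w"
      using that f' by (simp add: H.wev_append[of f' X] H.wev_inv[of f' X])
        (metis H.inv_equality H.inv_inv H.r_inv H.wev_closed H.inv_closed)
    finally show ?thesis .
  qed
  define h where "h z = wev H f' (SOME w. w \<in> gwords X \<and> wev G f w = z)" for z
  have h: "h (wev G f w) = wev H f' w" if "w \<in> gwords X" for w
  proof -
    let ?v = "SOME v. v \<in> gwords X \<and> wev G f v = wev G f w"
    have "?v \<in> gwords X \<and> wev G f ?v = wev G f w" by (rule someI[of _ w]) (use that in auto)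
    then show ?thesis unfolding h_def using eq[of ?v w] that by blast
  qed
  have "h \<in> iso (subgroup_generated G (f ` X)) (subgroup_generated H (f' ` X))"
  proof (rule isoI)
    show "h \<in> hom (subgroup_generated G (f ` X)) (subgroup_generated H (f' ` X))"
    proof (rule homI)
      fix x assume "x \<in> carrier (subgroup_generated G (f ` X))"
      then show "h x \<in> carrier (subgroup_generated H (f' ` X))"
        by (auto simp: G.subgroup_generated_carrier[OF f] H.subgroup_generated_carrier[OF f'] h)
    next
      fix x y assume "x \<in> carrier (subgroup_generated G (f ` X))" "y \<in> carrier (subgroup_generated G (f ` X))"
      then obtain v w where vw: "v \<in> gwords X" "w \<in> gwords X" "x = wev G f v" "y = wev G f w"
        by (auto simp: G.subgroup_generated_carrier[OF f])
      then have "h (x \<otimes>\<^bsub>G\<^esub> y) = wev H f' (v @ w)"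
        using h[of "v @ w"] f by (simp add: G.wev_append[of f X])
      then show "h (x \<otimes>\<^bsub>subgroup_generated G (f ` X)\<^esub> y)
          = h x \<otimes>\<^bsub>subgroup_generated H (f' ` X)\<^esub> h y"
        using vw f' h by (simp add: H.wev_append[of f' X])
    qed
    show "bij_betw h (carrier (subgroup_generated G (f ` X))) (carrier (subgroup_generated H (f' ` X)))"
      unfolding bij_betw_def inj_on_def G.subgroup_generated_carrier[OF f] H.subgroup_generated_carrier[OF f']
      using eq h by (auto simp: image_iff)
  qed
  then show ?thesis by (auto simp: is_iso_def)
qed

lemma wev_presented_group:
  assumes "w \<in> gwords X"
  shows "wev (presented_group X R) (\<lambda>x. pres_rel X R `` {[(x, True)]}) w = pres_rel X R `` {w}"
  using assms
proof (induction w)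
  case Nil
  then show ?case by (simp add: presented_group_def)
next
  case (Cons a w)
  obtain x b where a: "a = (x, b)" by force
  interpret P: group "presented_group X R" by (rule group_presented_group)
  let ?c = "\<lambda>w. pres_rel X R `` {w}"
  have x: "x \<in> X" "w \<in> gwords X" using Cons a by auto
  have carr: "?c v \<in> carrier (presented_group X R)" if "v \<in> gwords X" for v
    using that by (auto simp: presented_group_def intro: quotientI)
  have "?c [(x, False)] \<otimes>\<^bsub>presented_group X R\<^esub> ?c [(x, True)] = \<one>\<^bsub>presented_group X R\<^esub>"
    using x pres_eq.cancel[of "[]" X "[]" x R False] pres_eq_gwords
    by (simp add: pres_mult) (simp add: presented_group_def pres_class_eq_iff)
  then have "inv\<^bsub>presented_group X R\<^esub> ?c [(x, True)] = ?c [(x, False)]"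
    using carr x by (intro P.inv_equality) auto
  then show ?case using Cons a x by (cases b) (simp_all add: pres_mult)
qed

lemma carrier_presented_group:
  "carrier (presented_group X R) = (\<lambda>w. pres_rel X R `` {w}) ` gwords X"
  by (auto simp: presented_group_def quotient_def)

lemma one_presented_group: "\<one>\<^bsub>presented_group X R\<^esub> = pres_rel X R `` {[]}"
  by (simp add: presented_group_def)

lemma pres_class_eq_one:
  "w \<in> gwords X \<Longrightarrow> pres_rel X R `` {w} = \<one>\<^bsub>presented_group X R\<^esub> \<longleftrightarrow> pres_eq X R w []"
  by (simp add: one_presented_group pres_class_eq_iff)

lemma pres_class_in_carrier [simp]:
  "w \<in> gwords X \<Longrightarrow> pres_rel X R `` {w} \<in> carrier (presented_group X R)"
  by (auto simp: carrier_presented_group)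

section \<open>Reduced words and the free group of rank two\<close>

fun reduced :: "'v gword \<Rightarrow> bool" where
  "reduced ((x, b) # (y, c) # w) \<longleftrightarrow> \<not> (x = y \<and> b \<noteq> c) \<and> reduced ((y, c) # w)"
| "reduced _ \<longleftrightarrow> True"

lemma reduced_tl: "reduced (a # w) \<Longrightarrow> reduced w"
  by (cases a; cases w) auto

lemma reduced_Cons: "reduced ((x, b) # w) \<longleftrightarrow> reduced w \<and> (w \<noteq> [] \<longrightarrow> hd w \<noteq> (x, \<not> b))"
  by (cases w) auto

lemma reduced_append:
  "reduced (v @ w) \<longleftrightarrow> reduced v \<and> reduced w \<and>
    (v \<noteq> [] \<and> w \<noteq> [] \<longrightarrow> \<not> (fst (last v) = fst (hd w) \<and> snd (last v) \<noteq> snd (hd w)))"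
proof (induction v)
  case (Cons a v)
  obtain x b where a: "a = (x, b)" by force
  show ?case
  proof (cases "v = []")
    case True
    then show ?thesis using a by (cases w; cases "hd w") auto
  next
    case False
    then show ?thesis using Cons a by (auto simp: reduced_Cons)
  qed
qed simp

lemma reduced_gword_inv: "reduced w \<Longrightarrow> reduced (gword_inv w)"
proof (induction w)
  case (Cons a w)
  obtain x b where a: "a = (x, b)" by force
  have *: "gword_inv (a # w) = gword_inv w @ [(x, \<not> b)]" by (simp add: gword_inv_def a)
  have r: "reduced (gword_inv w)" using Cons reduced_tl by blast
  show ?case
  proof (cases w)
    case Nil
    then show ?thesis by (simp add: gword_inv_def a)
  next
    case (Cons c v)
    then have "last (gword_inv w) = (fst c, \<not> snd c)"
      by (cases c) (simp add: gword_inv_def)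
    then show ?thesis unfolding * using r Cons.prems Cons a
      by (cases c) (auto simp: reduced_append gword_inv_def)
  qed
qed (simp add: gword_inv_def)

lemma pres_eq_reduced:
  assumes "w \<in> gwords X"
  obtains r where "reduced r" "r \<in> gwords X" "pres_eq X R w r"
proof -
  have "\<exists>r. reduced r \<and> r \<in> gwords X \<and> pres_eq X R w r"
    using assms
  proof (induction w)
    case Nil
    then show ?case by (intro exI[of _ "[]"]) (auto intro: pres_eq.refl)
  next
    case (Cons a w)
    obtain x b where a: "a = (x, b)" by force
    from Cons a obtain r where r: "reduced r" "r \<in> gwords X" "pres_eq X R w r" by auto
    have x: "x \<in> X" using Cons a by auto
    have 1: "pres_eq X R (a # w) (a # r)"
      using pres_eq_context[OF r(3), of "[a]" "[]"] a x by simp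
    show ?case
    proof (cases "r \<noteq> [] \<and> hd r = (x, \<not> b)")
      case True
      then obtain v where v: "r = (x, \<not> b) # v" by (cases r) auto
      have "pres_eq X R ([] @ [(x, b), (x, \<not> b)] @ v) ([] @ v)"
        using r x v by (intro pres_eq.cancel) auto
      then have "pres_eq X R (a # w) v" using 1 a v by (auto intro: pres_eq.trans)
      then show ?thesis using r v reduced_tl[of _ v] by (intro exI[of _ v]) auto
    next
      case False
      then show ?thesis using 1 r a x by (intro exI[of _ "a # r"]) (auto simp: reduced_Cons)
    qed
  qed
  then show ?thesis using that by blast
qed

fun push :: "'v \<times> bool \<Rightarrow> 'v gword \<Rightarrow> 'v gword" where
  "push (x, b) w = (if w \<noteq> [] \<and> hd w = (x, \<not> b) then tl w else (x, b) # w)"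

text \<open>Letters act on the reduced words by cancelling or prepending, and this action respects
  free equality. A reduced word carries the empty word to itself, so a reduced word with trivial
  class must be empty.\<close>

lemma reduced_pres_eq_Nil:
  assumes "pres_eq X {} w []" "reduced w"
  shows "w = []"
proof -
  have "foldr push w [] = foldr push [] []"
  proof (rule pres_eq_foldr[OF assms(1), where Z = "Collect reduced"])
    fix x b and z :: "'a gword" assume z: "z \<in> Collect reduced"
    show "push (x, b) z \<in> Collect reduced"
      using z by (cases z) (auto simp: reduced_Cons intro: reduced_tl)
    show "push (x, b) (push (x, \<not> b) z) = z"
      using z by (cases z) (auto simp: reduced_Cons)
  qed auto
  moreover have "foldr push w [] = w" using assms(2)
    by (induction w) (auto simp: reduced_Cons)
  ultimately show ?thesis by simp
qed

text \<open>\<open>bool\<close> indexes the two generators, so a word in \<open>x\<close> and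
  \<open>y\<close> is literally a word of \<open>free_group (UNIV :: bool set)\<close>.\<close>

abbreviation (input) pr :: "'a \<Rightarrow> 'a \<Rightarrow> bool \<Rightarrow> 'a" where
  "pr x y \<equiv> \<lambda>b. if b then x else y"

lemma range_pr: "range (pr x y) = {x, y}" by auto

lemma gwords_UNIV [simp]: "w \<in> gwords UNIV" by (auto simp: gwords_def)

definition free_pair :: "('a, 'b) monoid_scheme \<Rightarrow> 'a \<Rightarrow> 'a \<Rightarrow> bool" where
  "free_pair G x y \<longleftrightarrow> subgroup_generated G {x, y} \<cong> free_group (UNIV :: bool set)"

lemma free_pair_transfer:
  assumes "group G" "group H" "x \<in> carrier G" "y \<in> carrier G" "x' \<in> carrier H" "y' \<in> carrier H"
    and "\<And>w. wev G (pr x y) w = \<one>\<^bsub>G\<^esub> \<longleftrightarrow> wev H (pr x' y') w = \<one>\<^bsub>H\<^esub>"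
    and "free_pair G x y"
  shows "free_pair H x' y'"
proof -
  have "subgroup_generated H (range (pr x' y')) \<cong> subgroup_generated G (range (pr x y))"
    using assms by (intro subgroup_generated_iso_if_same_relations) auto
  then show ?thesis using assms(8) unfolding free_pair_def range_pr
    by (rule iso_trans)
qed

lemma (in group) free_pairI:
  assumes "x \<in> carrier G" "y \<in> carrier G"
    and "\<And>w. reduced w \<Longrightarrow> w \<noteq> [] \<Longrightarrow> wev G (pr x y) w \<noteq> \<one>"
  shows "free_pair G x y"
proof -
  let ?F = "free_group (UNIV :: bool set)" and ?f = "\<lambda>x. pres_rel (UNIV :: bool set) {} `` {[(x, True)]}"
  interpret F: group ?F by (rule group_presented_group)
  have f: "?f \<in> UNIV \<rightarrow> carrier ?F" by auto
  have "subgroup_generated G (range (pr x y)) \<cong> subgroup_generated ?F (range ?f)"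
  proof (rule subgroup_generated_iso_if_same_relations)
    fix w :: "bool gword"
    obtain r where r: "reduced r" "pres_eq UNIV {} w r" using pres_eq_reduced[of w UNIV] by auto
    have "wev ?F ?f w = \<one>\<^bsub>?F\<^esub> \<longleftrightarrow> pres_eq UNIV {} w []"
      by (simp add: wev_presented_group pres_class_eq_one)
    also have "\<dots> \<longleftrightarrow> r = []" using r reduced_pres_eq_Nil[of UNIV r]
      by (metis pres_eq.sym pres_eq.trans)
    also have "\<dots> \<longleftrightarrow> wev G (pr x y) r = \<one>" using assms(3)[OF r(1)] by auto
    also have "wev G (pr x y) r = wev G (pr x y) w"
      using wev_pres_eq[OF r(2), of "pr x y"] assms by auto
    finally show "wev G (pr x y) w = \<one> \<longleftrightarrow> wev ?F ?f w = \<one>\<^bsub>?F\<^esub>" by simp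
  qed (use assms f group_presented_group is_group in auto)
  moreover have "subgroup_generated ?F (range ?f) = ?F"
  proof -
    have "carrier (subgroup_generated ?F (range ?f)) = carrier ?F"
      by (simp add: F.subgroup_generated_carrier[OF f] wev_presented_group carrier_presented_group)
    then show ?thesis by (simp add: subgroup_generated_def)
  qed
  ultimately show ?thesis unfolding free_pair_def range_pr by simp
qed

text \<open>For a nonempty reduced word \<open>w\<close>, the commutator with a suitably signed
  generator is again reduced as it is written, hence not trivial.\<close>

lemma free_group_center:
  assumes z: "z \<in> carrier (free_group (UNIV :: bool set))"
    and comm: "\<And>y. y \<in> carrier (free_group (UNIV :: bool set)) \<Longrightarrow>
      z \<otimes>\<^bsub>free_group UNIV\<^esub> y = y \<otimes>\<^bsub>free_group UNIV\<^esub> z"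
  shows "z = \<one>\<^bsub>free_group (UNIV :: bool set)\<^esub>"
proof -
  let ?F = "free_group (UNIV :: bool set)" and ?c = "\<lambda>w. pres_rel (UNIV :: bool set) {} `` {w}"
  interpret F: group ?F by (rule group_presented_group)
  obtain w0 where w0: "z = ?c w0" using z by (auto simp: carrier_presented_group)
  obtain w where w: "reduced w" "pres_eq UNIV {} w0 w" using pres_eq_reduced[of w0 UNIV] by auto
  have zw: "z = ?c w" using w w0 by (simp add: pres_class_eq_iff)
  show ?thesis
  proof (cases "w = []")
    case True
    then show ?thesis using zw by (simp add: one_presented_group)
  next
    case False
    then obtain p b u where hd: "w = (p, b) # u" by (cases w) auto
    obtain q c v where last: "w = v @ [(q, c)]" using False
      by (metis append_butlast_last_id surj_pair)
    \<comment> \<open>The generator differs from the last one of \<open>w\<close>, so nothing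
      cancels on either side of the first \<open>?t\<close>. The sign is that of the first letter of
      \<open>w\<close>: should \<open>\<not> q = p\<close> hold, the letters
      \<open>(p, \<not> b)\<close> and \<open>(\<not> q, \<not> b)\<close> at the end have equal
      signs.\<close>
    let ?t = "[(\<not> q, b)]"
    let ?k = "w @ ?t @ gword_inv w @ gword_inv ?t"
    have gi: "gword_inv w = (q, \<not> c) # gword_inv v" using last by (simp add: gword_inv_def)
    have gl: "gword_inv w = gword_inv u @ [(p, \<not> b)]" using hd by (simp add: gword_inv_def)
    have ginv: "?c (gword_inv u) = inv\<^bsub>?F\<^esub> (?c u)" for u
      using F.wev_inv[of "\<lambda>x. pres_rel (UNIV :: bool set) {} `` {[(x, True)]}" UNIV u]
      by (simp add: wev_presented_group)
    have "?c ?k = ?c w \<otimes>\<^bsub>?F\<^esub> ?c ?t \<otimes>\<^bsub>?F\<^esub> inv\<^bsub>?F\<^esub> (?c w) \<otimes>\<^bsub>?F\<^esub> inv\<^bsub>?F\<^esub> (?c ?t)"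
      by (simp add: ginv[symmetric] pres_mult)
    also have "?c w \<otimes>\<^bsub>?F\<^esub> ?c ?t = ?c ?t \<otimes>\<^bsub>?F\<^esub> ?c w" using comm[of "?c ?t"] zw by simp
    finally have "?c ?k = \<one>\<^bsub>?F\<^esub>" by (simp add: F.m_assoc)
    then have "pres_eq UNIV {} ?k []" by (simp add: pres_class_eq_one)
    moreover have "reduced ?k"
    proof -
      have "reduced (gword_inv w)" using w reduced_gword_inv by blast
      moreover have "gword_inv ?t = [(\<not> q, \<not> b)]" by (simp add: gword_inv_def)
      moreover have "last (gword_inv w) = (p, \<not> b)" "hd (gword_inv w) = (q, \<not> c)"
        using gi gl last_snoc list.sel(1) by metis+
      moreover have "last w = (q, c)" using last by simp
      moreover have "gword_inv w \<noteq> []" using gi by simp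
      ultimately show ?thesis using w False by (auto simp: reduced_append reduced_Cons)
    qed
    ultimately have "?k = []" by (rule reduced_pres_eq_Nil)
    then show ?thesis by simp
  qed
qed

fun expo :: "'v \<Rightarrow> 'v gword \<Rightarrow> int" where
  "expo p [] = 0"
| "expo p ((x, b) # w) = (if x = p then (if b then 1 else - 1) else 0) + expo p w"

lemma expo_append: "expo p (v @ w) = expo p v + expo p w"
  by (induction p v rule: expo.induct) auto

lemma expo_pres_eq: "pres_eq X {} v w \<Longrightarrow> expo p v = expo p w"
  by (induction rule: pres_eq.induct) (auto simp: expo_append)

lemma free_pair_hom_int:
  fixes p :: bool
  shows "\<exists>\<epsilon>. \<forall>w. \<epsilon> (pres_rel (UNIV :: bool set) {} `` {w}) = expo p w"
proof (intro exI allI)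
  fix w :: "bool gword"
  let ?v = "SOME v. v \<in> pres_rel (UNIV :: bool set) {} `` {w}"
  have "?v \<in> pres_rel (UNIV :: bool set) {} `` {w}"
    by (rule someI[of _ w]) (auto simp: pres_rel_def intro: pres_eq.refl)
  then show "(\<lambda>A. expo p (SOME v. v \<in> A)) (pres_rel (UNIV :: bool set) {} `` {w}) = expo p w"
    using expo_pres_eq[of UNIV w ?v p] by (auto simp: pres_rel_def)
qed

text \<open>The isomorphism behind \<open>free_pair\<close> may send \<open>x\<close>,
  \<open>y\<close> to any basis. Pulled back along it, the two exponent sums are homomorphisms
  \<open>\<theta> p\<close> to the integers, and on a word they are linear in its exponent sums.
  Surjectivity makes the matrix of \<open>\<theta>\<close> invertible, so a relation has both
  exponent sums zero.\<close>

lemma (in group) free_pair_expo: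
  assumes "x \<in> carrier G" "y \<in> carrier G" "free_pair G x y"
    and w: "wev G (pr x y) w = \<one>"
  shows "expo True w = 0 \<and> expo False w = 0"
proof -
  let ?F = "free_group (UNIV :: bool set)" and ?c = "\<lambda>w. pres_rel (UNIV :: bool set) {} `` {w}"
  interpret F: group ?F by (rule group_presented_group)
  obtain f where f: "f \<in> iso (subgroup_generated G {x, y}) ?F"
    using assms(3) by (auto simp: free_pair_def is_iso_def)
  obtain \<epsilon> where \<epsilon>: "\<And>p w. \<epsilon> p (?c w) = expo p w"
    using free_pair_hom_int by metis
  have pr: "pr x y \<in> UNIV \<rightarrow> carrier G" using assms by auto
  let ?H = "subgroup_generated G {x, y}"
  interpret H: group ?H by (rule group_subgroup_generated)
  have carr: "carrier ?H = range (wev G (pr x y))"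
    using subgroup_generated_carrier[OF pr] unfolding range_pr by (simp add: gwords_def)
  have hom: "f (a \<otimes> b) = f a \<otimes>\<^bsub>?F\<^esub> f b" if "a \<in> carrier ?H" "b \<in> carrier ?H" for a b
    using f that by (auto simp: iso_def hom_def)
  have add: "\<epsilon> p (A \<otimes>\<^bsub>?F\<^esub> B) = \<epsilon> p A + \<epsilon> p B" if "A \<in> carrier ?F" "B \<in> carrier ?F" for p A B
    using that by (auto simp: carrier_presented_group pres_mult \<epsilon> expo_append)
  define \<theta> where "\<theta> p a = \<epsilon> p (f a)" for p a
  have fc: "f a \<in> carrier ?F" if "a \<in> carrier ?H" for a
    using f that by (auto simp: iso_def hom_def)
  have \<theta>: "\<theta> p (a \<otimes> b) = \<theta> p a + \<theta> p b" if "a \<in> carrier ?H" "b \<in> carrier ?H" for p a b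
    using that by (simp add: \<theta>_def hom add fc)
  have one: "\<one> \<in> carrier ?H" using H.one_closed by simp
  have \<theta>1: "\<theta> p \<one> = 0" for p using \<theta>[OF one one, of p] by simp
  have xy: "pr x y i \<in> carrier ?H" for i
    using assms by (auto simp: carrier_subgroup_generated intro: generate.incl)
  have xyi: "inv (pr x y i) \<in> carrier ?H" for i
    using H.inv_closed[OF xy[of i]] xy[of i] by (simp)
  have \<theta>i: "\<theta> p (inv (pr x y i)) = - \<theta> p (pr x y i)" for p i
    using \<theta>[OF xyi[of i] xy[of i], of p] \<theta>1[of p] assms(1,2) by (cases i) simp_all
  have lin: "\<theta> p (wev G (pr x y) v) = expo True v * \<theta> p x + expo False v * \<theta> p y" for p v
  proof (induction v)
    case (Cons a v)
    obtain i b where a: "a = (i, b)" by force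
    have "wev G (pr x y) v \<in> carrier ?H" using carr by auto
    then have "\<theta> p (wev G (pr x y) (a # v)) =
        (if b then 1 else - 1) * \<theta> p (pr x y i) + \<theta> p (wev G (pr x y) v)"
      using \<theta> xy[of i] xyi[of i] \<theta>i[of p i] by (cases b) (simp_all add: a del: if_split)
    then show ?case using Cons a by (cases i; cases b) (simp_all add: algebra_simps)
  qed (simp add: \<theta>1)
  have "\<exists>v. f (wev G (pr x y) v) = ?c [(i, True)]" for i
  proof -
    have "?c [(i, True)] \<in> f ` carrier ?H" using f by (auto simp: iso_def bij_betw_def)
    then show ?thesis using carr by auto
  qed
  then obtain v where v: "\<And>i. f (wev G (pr x y) (v i)) = ?c [(i, True)]" by metis
  have e: "\<theta> p (wev G (pr x y) (v i)) = (if i = p then 1 else 0)" for i p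
    by (simp add: \<theta>_def v \<epsilon>)
  \<comment> \<open>The words \<open>v\<close> that map to the standard generators give four
    equations which say that the matrix of \<open>\<theta>\<close> has an inverse; together with
    \<open>z1\<close> and \<open>z2\<close> they force the exponent sums of \<open>w\<close> to
    vanish.\<close>
  have e1: "expo True (v True) * \<theta> True x + expo False (v True) * \<theta> True y = 1"
    and e2: "expo True (v True) * \<theta> False x + expo False (v True) * \<theta> False y = 0"
    and e3: "expo True (v False) * \<theta> True x + expo False (v False) * \<theta> True y = 0"
    and e4: "expo True (v False) * \<theta> False x + expo False (v False) * \<theta> False y = 1"
    using e[of True True] e[of False True] e[of True False] e[of False False]
    by (simp_all add: lin)
  have z: "expo True w * \<theta> p x + expo False w * \<theta> p y = 0" for p
    using lin[of p w] w \<theta>1[of p] by simp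
  note z1 = z[of True] and z2 = z[of False]
  have "expo True w = 0" using e1 e2 e3 e4 z1 z2 by algebra
  moreover have "expo False w = 0" using e1 e2 e3 e4 z1 z2 by algebra
  ultimately show ?thesis by simp
qed

section \<open>Twisting a free pair by commuting elements\<close>

context group begin

lemma commute_inv:
  assumes "x \<in> carrier G" "z \<in> carrier G" "z \<otimes> x = x \<otimes> z"
  shows "z \<otimes> inv x = inv x \<otimes> z"
  using assms by (metis inv_closed inv_solve_left inv_solve_right m_assoc m_closed)

lemma commute_mult:
  assumes "x \<in> carrier G" "y \<in> carrier G" "z \<in> carrier G" "z \<otimes> x = x \<otimes> z" "z \<otimes> y = y \<otimes> z"
  shows "z \<otimes> (x \<otimes> y) = x \<otimes> y \<otimes> z"
  using assms by (metis m_assoc)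

lemma commute_wev:
  assumes "f \<in> X \<rightarrow> carrier G" "z \<in> carrier G" "\<And>x. x \<in> X \<Longrightarrow> z \<otimes> f x = f x \<otimes> z" "w \<in> gwords X"
  shows "z \<otimes> wev G f w = wev G f w \<otimes> z"
  using assms(4)
proof (induction w)
  case (Cons a w)
  obtain x b where a: "a = (x, b)" by force
  have x: "x \<in> X" "w \<in> gwords X" "f x \<in> carrier G" using Cons.prems a assms(1) by auto
  have "z \<otimes> (if b then f x else inv f x) = (if b then f x else inv f x) \<otimes> z"
    using commute_inv[of "f x" z] assms x by auto
  then show ?case using Cons.IH x assms(1,2) a by (auto intro!: commute_mult)
qed (simp add: assms)

lemma commute_pow_nat:
  assumes "x \<in> carrier G" "z \<in> carrier G" "z \<otimes> x = x \<otimes> z"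
  shows "z \<otimes> x [^] (n::nat) = x [^] n \<otimes> z"
  using assms by (induction n) (auto intro!: commute_mult)

lemma commute_pow_int:
  assumes "x \<in> carrier G" "z \<in> carrier G" "z \<otimes> x = x \<otimes> z"
  shows "z \<otimes> x [^] (n::int) = x [^] n \<otimes> z"
  using assms commute_pow_nat[OF assms]
  by (cases n rule: int_cases2) (simp_all add: int_pow_int int_pow_neg commute_inv)

text \<open>Every \<open>z1\<close> and \<open>z2\<close> can be slid to the right end of the word,
  where only the exponent sums survive.\<close>

lemma wev_twist:
  assumes c: "x \<in> carrier G" "y \<in> carrier G" "z1 \<in> carrier G" "z2 \<in> carrier G"
    and z: "z1 \<otimes> x = x \<otimes> z1" "z1 \<otimes> y = y \<otimes> z1" "z2 \<otimes> x = x \<otimes> z2" "z2 \<otimes> y = y \<otimes> z2" "z1 \<otimes> z2 = z2 \<otimes> z1"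
  shows "wev G (pr (x \<otimes> z1) (y \<otimes> z2)) w =
    wev G (pr x y) w \<otimes> (z1 [^] expo True w \<otimes> z2 [^] expo False w)"
proof (induction w)
  case (Cons a w)
  obtain i b where a: "a = (i, b)" by force
  let ?u = "wev G (pr x y) w" and ?c = "z1 [^] expo True w \<otimes> z2 [^] expo False w"
  define \<zeta> where "\<zeta> = (if b then pr z1 z2 i else inv (pr z1 z2 i))"
  define l where "l = (if b then pr x y i else inv (pr x y i))"
  have xu: "pr x y \<in> UNIV \<rightarrow> carrier G" using c by auto
  have u: "?u \<in> carrier G" using wev_closed[OF xu] by simp
  have cc: "?c \<in> carrier G" using c by simp
  have l: "l \<in> carrier G" "\<zeta> \<in> carrier G" using c by (auto simp: l_def \<zeta>_def)
  have zu: "pr z1 z2 i \<otimes> ?u = ?u \<otimes> pr z1 z2 i"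
    using c z by - (rule commute_wev[OF xu], auto)
  have zl: "pr z1 z2 i \<otimes> pr x y i = pr x y i \<otimes> pr z1 z2 i" using z by auto
  have \<zeta>u: "\<zeta> \<otimes> ?u = ?u \<otimes> \<zeta>"
  proof (cases b)
    case False
    then show ?thesis using commute_inv[of "pr z1 z2 i" ?u] zu c u by (auto simp: \<zeta>_def)
  qed (use zu in \<open>simp add: \<zeta>_def\<close>)
  have letter: "(if b then pr (x \<otimes> z1) (y \<otimes> z2) i else inv (pr (x \<otimes> z1) (y \<otimes> z2) i)) = l \<otimes> \<zeta>"
  proof -
    have "pr (x \<otimes> z1) (y \<otimes> z2) i = pr x y i \<otimes> pr z1 z2 i" by auto
    moreover have "inv (pr x y i \<otimes> pr z1 z2 i) = inv (pr x y i) \<otimes> inv (pr z1 z2 i)"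
      unfolding zl[symmetric] using c by (auto simp: inv_mult_group)
    ultimately show ?thesis by (simp add: l_def \<zeta>_def)
  qed
  have cz: "\<zeta> \<otimes> ?c = z1 [^] expo True (a # w) \<otimes> z2 [^] expo False (a # w)"
  proof -
    have one: "z [^] (- 1 :: int) = inv z" if "z \<in> carrier G" for z
      using that by (simp add: int_pow_neg)
    have "\<zeta> = (if i then z1 [^] (if b then 1 else - 1 :: int) else z2 [^] (if b then 1 else - 1 :: int))"
      using c by (auto simp: \<zeta>_def one)
    moreover have "z2 [^] m \<otimes> z1 [^] n = z1 [^] n \<otimes> z2 [^] m" for m n :: int
      using c z commute_pow_int[of z1 "z2 [^] m" n] commute_pow_int[of z2 z1 m] by simp
    ultimately show ?thesis using c
      by (cases i) (simp_all add: a int_pow_mult m_assoc[symmetric])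
  qed
  have "wev G (pr (x \<otimes> z1) (y \<otimes> z2)) (a # w) = (l \<otimes> \<zeta>) \<otimes> (?u \<otimes> ?c)"
    using Cons letter by (simp add: a)
  also have "\<dots> = l \<otimes> (\<zeta> \<otimes> ?u) \<otimes> ?c" using l u cc by (simp add: m_assoc)
  also have "\<dots> = (l \<otimes> ?u) \<otimes> (\<zeta> \<otimes> ?c)" using l u cc \<zeta>u by (simp add: m_assoc)
  also have "l \<otimes> ?u = wev G (pr x y) (a # w)" by (simp add: a l_def)
  finally show ?case using cz by simp
qed (use c in simp)

lemma free_pair_center:
  assumes c: "x \<in> carrier G" "y \<in> carrier G" and "free_pair G x y"
    and z: "wev G (pr x y) w \<otimes> x = x \<otimes> wev G (pr x y) w" "wev G (pr x y) w \<otimes> y = y \<otimes> wev G (pr x y) w"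
  shows "wev G (pr x y) w = \<one>"
proof -
  let ?F = "free_group (UNIV :: bool set)" and ?H = "subgroup_generated G {x, y}" and ?u = "wev G (pr x y) w"
  interpret H: group ?H by (rule group_subgroup_generated)
  interpret F: group ?F by (rule group_presented_group)
  obtain f where f: "f \<in> iso ?H ?F"
    using assms(3) by (auto simp: free_pair_def is_iso_def)
  interpret f: group_hom ?H ?F f
    using f H.is_group F.is_group by (auto simp: group_hom_def group_hom_axioms_def iso_def)
  have xu: "pr x y \<in> UNIV \<rightarrow> carrier G" using c by auto
  have carr: "carrier ?H = range (wev G (pr x y))"
    using subgroup_generated_carrier[OF xu] unfolding range_pr by (simp add: gwords_def)
  have u: "?u \<in> carrier ?H" "?u \<in> carrier G" using carr wev_closed[OF xu] by auto
  have "f ?u = \<one>\<^bsub>?F\<^esub>"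
  proof (rule free_group_center)
    fix Y assume "Y \<in> carrier ?F"
    then have "Y \<in> f ` carrier ?H" using f by (simp add: iso_def bij_betw_def)
    then obtain v where v: "Y = f (wev G (pr x y) v)" unfolding carr by blast
    have "?u \<otimes> wev G (pr x y) v = wev G (pr x y) v \<otimes> ?u"
      using u z by - (rule commute_wev[OF xu], auto)
    then show "f ?u \<otimes>\<^bsub>?F\<^esub> Y = Y \<otimes>\<^bsub>?F\<^esub> f ?u"
      using v u carr f.hom_mult[of ?u "wev G (pr x y) v"] f.hom_mult[of "wev G (pr x y) v" ?u] by simp
  qed (use u in auto)
  then have "f ?u = f \<one>\<^bsub>?H\<^esub>" using f.hom_one by simp
  then show ?thesis using f u H.one_closed by (auto simp: iso_def bij_betw_def inj_on_def)
qed

text \<open>The twisted and the original pair satisfy the same relations. If a word is trivial in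
  \<open>x\<close>, \<open>y\<close>, its exponent sums vanish, and so does the twist. If it is
  trivial in the twisted pair, its value in \<open>x\<close>, \<open>y\<close> is the inverse of a
  product of powers of \<open>z1\<close>, \<open>z2\<close>, hence central in a free group of rank
  two, hence trivial.\<close>

lemma free_pair_twist:
  assumes c: "x \<in> carrier G" "y \<in> carrier G" "z1 \<in> carrier G" "z2 \<in> carrier G"
    and z: "z1 \<otimes> x = x \<otimes> z1" "z1 \<otimes> y = y \<otimes> z1" "z2 \<otimes> x = x \<otimes> z2" "z2 \<otimes> y = y \<otimes> z2" "z1 \<otimes> z2 = z2 \<otimes> z1"
    and fp: "free_pair G x y"
  shows "free_pair G (x \<otimes> z1) (y \<otimes> z2)"
proof (rule free_pair_transfer[OF is_group is_group _ _ _ _ _ fp])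
  fix w
  let ?u = "wev G (pr x y) w" and ?c = "z1 [^] expo True w \<otimes> z2 [^] expo False w"
  have xu: "pr x y \<in> UNIV \<rightarrow> carrier G" using c by auto
  have u: "?u \<in> carrier G" "?c \<in> carrier G" using wev_closed[OF xu] c by auto
  note tw = wev_twist[OF c z, of w]
  show "?u = \<one> \<longleftrightarrow> wev G (pr (x \<otimes> z1) (y \<otimes> z2)) w = \<one>"
  proof
    assume "?u = \<one>"
    then show "wev G (pr (x \<otimes> z1) (y \<otimes> z2)) w = \<one>"
      using free_pair_expo[OF c(1,2) fp, of w] by (simp add: tw)
  next
    assume "wev G (pr (x \<otimes> z1) (y \<otimes> z2)) w = \<one>"
    then have ui: "?u = inv ?c" using tw u by (metis inv_equality)
    have comm: "inv ?c \<otimes> v = v \<otimes> inv ?c"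
      if v: "v \<in> carrier G" "z1 \<otimes> v = v \<otimes> z1" "z2 \<otimes> v = v \<otimes> z2" for v
    proof -
      have "v \<otimes> ?c = ?c \<otimes> v"
        using commute_pow_int[of z1 v "expo True w"] commute_pow_int[of z2 v "expo False w"] v c
        by (intro commute_mult) auto
      then show ?thesis using commute_inv[of ?c v] u v by simp
    qed
    show "?u = \<one>"
      using c z ui comm[of x] comm[of y] by (intro free_pair_center[OF c(1,2) fp]) auto
  qed
qed (use c in auto)

end

section \<open>The power alternative for a single pair\<close>

definition pair_alternative :: "('a, 'b) monoid_scheme \<Rightarrow> 'a \<Rightarrow> 'a \<Rightarrow> bool" where
  "pair_alternative G g h \<longleftrightarrow> (\<exists>n::nat. n \<ge> 1 \<and>
    (g [^]\<^bsub>G\<^esub> n \<otimes>\<^bsub>G\<^esub> h [^]\<^bsub>G\<^esub> n = h [^]\<^bsub>G\<^esub> n \<otimes>\<^bsub>G\<^esub> g [^]\<^bsub>G\<^esub> n \<or>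
     free_pair G (g [^]\<^bsub>G\<^esub> n) (h [^]\<^bsub>G\<^esub> n)))"

lemma power_alternative_iff:
  "power_alternative G \<longleftrightarrow> (\<forall>g\<in>carrier G. \<forall>h\<in>carrier G. pair_alternative G g h)"
  by (simp add: power_alternative_def pair_alternative_def free_pair_def)

context group begin

lemma pair_alternative_swap:
  assumes "pair_alternative G g h"
  shows "pair_alternative G h g"
proof -
  obtain n :: nat where "n \<ge> 1" "g [^] n \<otimes> h [^] n = h [^] n \<otimes> g [^] n \<or> free_pair G (g [^] n) (h [^] n)"
    using assms by (auto simp: pair_alternative_def)
  then show ?thesis unfolding pair_alternative_def
    by (intro exI[of _ n]) (auto simp: free_pair_def insert_commute)
qed

lemma free_pair_inv:
  assumes c: "g \<in> carrier G" "h \<in> carrier G" and "free_pair G (inv g) h"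
  shows "free_pair G g h"
proof -
  have "subgroup_generated G {inv g, h} = subgroup_generated G {g, h}"
  proof -
    have sub: "generate G {inv x, h} \<subseteq> generate G {x, h}" if "x \<in> carrier G" for x
    proof (rule generate_subgroup_incl)
      show "subgroup (generate G {x, h}) G" using that c by (intro generate_is_subgroup) auto
      then show "{inv x, h} \<subseteq> generate G {x, h}"
        by (auto intro: generate.incl generate.inv)
    qed
    have "generate G {inv g, h} = generate G {g, h}" using sub[of g] sub[of "inv g"] c by auto
    then show ?thesis using c by (simp add: subgroup_generated_def Int_absorb1)
  qed
  then show ?thesis using assms(3) by (simp add: free_pair_def)
qed

lemma pair_alternative_inv:
  assumes c: "g \<in> carrier G" "h \<in> carrier G" and "pair_alternative G (inv g) h"
  shows "pair_alternative G g h"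
proof -
  obtain n :: nat where n: "n \<ge> 1" "inv g [^] n \<otimes> h [^] n = h [^] n \<otimes> inv g [^] n \<or> free_pair G (inv g [^] n) (h [^] n)"
    using assms by (auto simp: pair_alternative_def)
  have i: "inv g [^] n = inv (g [^] n)" using c by (simp add: nat_pow_inv)
  from n(2) have "g [^] n \<otimes> h [^] n = h [^] n \<otimes> g [^] n \<or> free_pair G (g [^] n) (h [^] n)"
    unfolding i
  proof
    assume "inv (g [^] n) \<otimes> h [^] n = h [^] n \<otimes> inv (g [^] n)"
    then show ?thesis using commute_inv[of "inv (g [^] n)" "h [^] n"] c by simp
  next
    assume "free_pair G (inv (g [^] n)) (h [^] n)"
    then show ?thesis using free_pair_inv[of "g [^] n" "h [^] n"] c by simp
  qed
  then show ?thesis unfolding pair_alternative_def using n(1) by blast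
qed

lemma pair_alternative_pow:
  assumes c: "g \<in> carrier G" "h \<in> carrier G" and "k \<ge> 1" "pair_alternative G (g [^] (k::nat)) (h [^] k)"
  shows "pair_alternative G g h"
proof -
  obtain n :: nat where n: "n \<ge> 1" "(g [^] k) [^] n \<otimes> (h [^] k) [^] n = (h [^] k) [^] n \<otimes> (g [^] k) [^] n
      \<or> free_pair G ((g [^] k) [^] n) ((h [^] k) [^] n)"
    using assms by (auto simp: pair_alternative_def)
  then show ?thesis unfolding pair_alternative_def using c assms(3)
    by (intro exI[of _ "k * n"]) (simp add: nat_pow_pow)
qed

lemma free_pair_imp_alternative:
  assumes c: "g \<in> carrier G" "h \<in> carrier G" and "k \<ge> 1" "free_pair G (g [^] (k::nat)) (h [^] k)"
  shows "pair_alternative G g h"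
  using assms by (auto simp: pair_alternative_def)

lemma pair_alternative_twist:
  assumes c: "x \<in> carrier G" "y \<in> carrier G" "z1 \<in> carrier G" "z2 \<in> carrier G"
    and z: "z1 \<otimes> x = x \<otimes> z1" "z1 \<otimes> y = y \<otimes> z1" "z2 \<otimes> x = x \<otimes> z2" "z2 \<otimes> y = y \<otimes> z2" "z1 \<otimes> z2 = z2 \<otimes> z1"
    and pa: "pair_alternative G x y"
  shows "pair_alternative G (x \<otimes> z1) (y \<otimes> z2)"
proof -
  obtain n :: nat where n: "n \<ge> 1" "x [^] n \<otimes> y [^] n = y [^] n \<otimes> x [^] n \<or> free_pair G (x [^] n) (y [^] n)"
    using pa by (auto simp: pair_alternative_def)
  have pw: "(x \<otimes> z1) [^] n = x [^] n \<otimes> z1 [^] n" "(y \<otimes> z2) [^] n = y [^] n \<otimes> z2 [^] n"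
    using c z by (auto intro!: pow_mult_distrib)
  have cp: "a [^] n \<otimes> b [^] n = b [^] n \<otimes> a [^] n" if "a \<in> carrier G" "b \<in> carrier G" "a \<otimes> b = b \<otimes> a" for a b
    using that commute_pow_nat[of b "a [^] n" n] commute_pow_nat[of a b n] by simp
  note zz = cp[OF c(3) c(1) z(1)] cp[OF c(3) c(2) z(2)] cp[OF c(4) c(1) z(3)] cp[OF c(4) c(2) z(4)] cp[OF c(3) c(4) z(5)]
  from n(2) have "(x [^] n \<otimes> z1 [^] n) \<otimes> (y [^] n \<otimes> z2 [^] n) = (y [^] n \<otimes> z2 [^] n) \<otimes> (x [^] n \<otimes> z1 [^] n)
    \<or> free_pair G (x [^] n \<otimes> z1 [^] n) (y [^] n \<otimes> z2 [^] n)"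
  proof
    assume xy: "x [^] n \<otimes> y [^] n = y [^] n \<otimes> x [^] n"
    have "(x [^] n \<otimes> z1 [^] n) \<otimes> (y [^] n \<otimes> z2 [^] n) = (y [^] n \<otimes> z2 [^] n) \<otimes> (x [^] n \<otimes> z1 [^] n)"
      using c xy zz by (intro commute_mult) (auto intro!: commute_mult[symmetric])
    then show ?thesis ..
  next
    assume "free_pair G (x [^] n) (y [^] n)"
    then show ?thesis using c zz by (intro disjI2 free_pair_twist) auto
  qed
  then show ?thesis using n(1) pw unfolding pair_alternative_def by (intro exI[of _ n]) simp
qed

end

lemma wev_hom:
  assumes "group_hom G H \<phi>" "f \<in> X \<rightarrow> carrier G" "w \<in> gwords X"
  shows "\<phi> (wev G f w) = wev H (\<phi> \<circ> f) w"
  using assms(3)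
proof (induction w)
  case Nil
  interpret group_hom G H \<phi> by fact
  show ?case by simp
next
  case (Cons a w)
  interpret group_hom G H \<phi> by fact
  obtain x b where a: "a = (x, b)" by force
  have "f x \<in> carrier G" "wev G f w \<in> carrier G" using Cons.prems a assms(2) by auto
  then show ?case using Cons a by auto
qed

lemma pair_alternative_inj_hom:
  assumes "group_hom G H \<phi>" "inj_on \<phi> (carrier G)" "x \<in> carrier G" "y \<in> carrier G" "pair_alternative G x y"
  shows "pair_alternative H (\<phi> x) (\<phi> y)"
proof -
  interpret group_hom G H \<phi> by fact
  obtain n :: nat where n: "n \<ge> 1" "x [^]\<^bsub>G\<^esub> n \<otimes>\<^bsub>G\<^esub> y [^]\<^bsub>G\<^esub> n = y [^]\<^bsub>G\<^esub> n \<otimes>\<^bsub>G\<^esub> x [^]\<^bsub>G\<^esub> n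
      \<or> free_pair G (x [^]\<^bsub>G\<^esub> n) (y [^]\<^bsub>G\<^esub> n)"
    using assms by (auto simp: pair_alternative_def)
  let ?x = "x [^]\<^bsub>G\<^esub> n" and ?y = "y [^]\<^bsub>G\<^esub> n"
  have xy: "?x \<in> carrier G" "?y \<in> carrier G" using assms by auto
  have "free_pair H (\<phi> ?x) (\<phi> ?y)" if "free_pair G ?x ?y"
  proof (rule free_pair_transfer[OF G.is_group H.is_group xy _ _ _ that])
    fix w
    have f: "pr ?x ?y \<in> UNIV \<rightarrow> carrier G" using xy by auto
    have "\<phi> \<circ> pr ?x ?y = pr (\<phi> ?x) (\<phi> ?y)" by auto
    then have "wev H (pr (\<phi> ?x) (\<phi> ?y)) w = \<phi> (wev G (pr ?x ?y) w)"
      using wev_hom[OF assms(1) f, of w] by simp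
    then show "wev G (pr ?x ?y) w = \<one>\<^bsub>G\<^esub> \<longleftrightarrow> wev H (pr (\<phi> ?x) (\<phi> ?y)) w = \<one>\<^bsub>H\<^esub>"
      using inj_on_eq_iff[OF assms(2) G.wev_closed[OF f, of w] G.one_closed] by simp
  qed (use xy in auto)
  moreover have "\<phi> ?x \<otimes>\<^bsub>H\<^esub> \<phi> ?y = \<phi> ?y \<otimes>\<^bsub>H\<^esub> \<phi> ?x" if "?x \<otimes>\<^bsub>G\<^esub> ?y = ?y \<otimes>\<^bsub>G\<^esub> ?x"
    using hom_mult[OF xy] hom_mult[OF xy(2,1)] that by simp
  moreover have "\<phi> ?x = \<phi> x [^]\<^bsub>H\<^esub> n" "\<phi> ?y = \<phi> y [^]\<^bsub>H\<^esub> n" using assms hom_nat_pow by auto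
  ultimately show ?thesis unfolding pair_alternative_def using n by metis
qed

lemma (in group) group_hom_conj:
  assumes "k \<in> carrier G"
  shows "group_hom G G (\<lambda>x. k \<otimes> x \<otimes> inv k)" "inj_on (\<lambda>x. k \<otimes> x \<otimes> inv k) (carrier G)"
proof -
  have "k \<otimes> (x \<otimes> y) \<otimes> inv k = (k \<otimes> x \<otimes> inv k) \<otimes> (k \<otimes> y \<otimes> inv k)"
    if "x \<in> carrier G" "y \<in> carrier G" for x y
  proof -
    have "inv k \<otimes> (k \<otimes> (y \<otimes> inv k)) = y \<otimes> inv k" using assms that by (simp flip: m_assoc)
    then show ?thesis using assms that by (simp add: m_assoc)
  qed
  then show "group_hom G G (\<lambda>x. k \<otimes> x \<otimes> inv k)"
    using assms is_group by (auto simp: group_hom_def group_hom_axioms_def hom_def)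
  show "inj_on (\<lambda>x. k \<otimes> x \<otimes> inv k) (carrier G)" using assms by (auto simp: inj_on_def)
qed

section \<open>Ping-pong on a set\<close>

locale set_action = group G for G (structure) +
  fixes Z :: "'z set" and act :: "'a \<Rightarrow> 'z \<Rightarrow> 'z"
  assumes act_closed [simp]: "g \<in> carrier G \<Longrightarrow> z \<in> Z \<Longrightarrow> act g z \<in> Z"
    and act_one [simp]: "z \<in> Z \<Longrightarrow> act \<one> z = z"
    and act_mult: "g \<in> carrier G \<Longrightarrow> h \<in> carrier G \<Longrightarrow> z \<in> Z \<Longrightarrow> act (g \<otimes> h) z = act g (act h z)"
begin

lemma act_inv_act [simp]: "g \<in> carrier G \<Longrightarrow> z \<in> Z \<Longrightarrow> act (inv g) (act g z) = z"
  by (metis act_mult act_one inv_closed l_inv)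

text \<open>Only words that begin and end with the same generator \<open>p\<close> are treated
  directly: they carry a point of \<open>S p\<close> into \<open>S (\<not> p)\<close>. All other
  reduced words are conjugated into this shape.\<close>

lemma ping_pong:
  assumes c: "x \<in> carrier G" "y \<in> carrier G"
    and S: "S True \<inter> S False = {}" "\<And>p. S p \<noteq> {}" "\<And>p. S p \<subseteq> Z"
    and pp: "\<And>p (n::int) z. n \<noteq> 0 \<Longrightarrow> z \<in> S p \<Longrightarrow> act (pr x y p [^] n) z \<in> S (\<not> p)"
  shows "free_pair G x y"
proof (rule free_pairI[OF c])
  define f where "f = pr x y"
  have f: "f \<in> UNIV \<rightarrow> carrier G" using c by (auto simp: f_def)
  have fc: "f p \<in> carrier G" for p using c by (auto simp: f_def)
  have pp: "n \<noteq> 0 \<Longrightarrow> z \<in> S p \<Longrightarrow> act (f p [^] n) z \<in> S (\<not> p)" for p z and n :: int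
    using pp[of n z p] by (simp add: f_def)
  have SZ: "z \<in> Z" if "z \<in> S p" for z p using S(3) that by auto
  have wc: "wev G f w \<in> carrier G" for w using wev_closed[OF f] by simp
  \<comment> \<open>\<open>n\<close> is the exponent of the leading syllable collected so far.
    Letters of one syllable of a reduced word have equal signs, so \<open>n\<close> keeps the sign
    of \<open>b\<close> and never vanishes; the hypothesis \<open>pp\<close> applies once a new
    syllable starts.\<close>
  have main: "\<exists>n z'. (if b then n > 0 else n < (0::int)) \<and> z' \<in> S p \<and>
      act (wev G f w) z = act (f p [^] n) z'"
    if "reduced w" "w = (p, b) # u" "z \<in> S (fst (last w))" for w p b u z
    using that
  proof (induction u arbitrary: w p b)
    case Nil
    have "wev G f w = f p [^] (if b then 1 else - 1 :: int)"
      using Nil fc[of p] by (auto simp: int_pow_neg)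
    then show ?case using Nil by (intro exI[of _ "if b then 1 else - 1 :: int"] exI[of _ z]) auto
  next
    case (Cons a u)
    obtain q c where a: "a = (q, c)" by force
    have "reduced ((q, c) # u)" using Cons.prems a by simp
    moreover have "z \<in> S (fst (last ((q, c) # u)))" using Cons.prems a by simp
    ultimately obtain n z' where n: "if c then n > 0 else n < (0::int)" "z' \<in> S q"
        "act (wev G f ((q, c) # u)) z = act (f q [^] n) z'"
      using Cons.IH[of "(q, c) # u" q c] by auto
    have zZ: "z \<in> Z" using SZ Cons.prems by blast
    define e :: int where "e = (if b then 1 else - 1)"
    have lt: "(if b then f p else inv (f p)) = f p [^] e"
      using fc[of p] by (auto simp: e_def int_pow_neg)
    have "wev G f w = f p [^] e \<otimes> wev G f ((q, c) # u)"
      using Cons.prems a lt by simp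
    then have w: "act (wev G f w) z = act (f p [^] e) (act (f q [^] n) z')"
      using act_mult[OF int_pow_closed[OF fc] wc zZ, of p e "(q, c) # u"] n(3) by (simp only:)
    show ?case
    proof (cases "p = q")
      case True
      then have "b = c" using Cons.prems a by auto
      then have "if b then e + n > 0 else e + n < 0" using n(1) by (auto simp: e_def)
      moreover have "act (wev G f w) z = act (f p [^] (e + n)) z'"
        using w True act_mult[OF int_pow_closed[OF fc] int_pow_closed[OF fc] SZ[OF n(2)], of p e q n]
          int_pow_mult[OF fc[of q], of e n] by simp
      ultimately show ?thesis using n(2) True by blast
    next
      case False
      then have "act (f q [^] n) z' \<in> S p" using pp[of n z' q] n by (auto split: if_splits)
      then show ?thesis using w by (intro exI[of _ e] exI[of _ "act (f q [^] n) z'"]) (auto simp: e_def)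
    qed
  qed
  have same: "wev G f w \<noteq> \<one>" if rw: "reduced w" "w = (p, b) # u" "fst (last w) = p" for w p b u
  proof
    assume w: "wev G f w = \<one>"
    obtain z where z: "z \<in> S p" using S(2) by blast
    obtain n z' where n: "if b then n > 0 else n < (0::int)" "z' \<in> S p" "act (wev G f w) z = act (f p [^] n) z'"
      using main[OF rw(1,2), of z] z rw by auto
    have "z = act (f p [^] n) z'" using n w z SZ by simp
    moreover have "act (f p [^] n) z' \<in> S (\<not> p)" using n pp[of n z' p] by (auto split: if_splits)
    ultimately show False using S(1) z by (cases p) auto
  qed
  fix w :: "bool gword" assume w: "reduced w" "w \<noteq> []"
  obtain p b u where hd: "w = (p, b) # u" using w by (cases w) auto
  have "wev G f w \<noteq> \<one>"
  proof (cases "fst (last w) = p")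
    case True
    then show ?thesis using same w hd by blast
  next
    case False
    \<comment> \<open>This conjugate is reduced: \<open>w\<close> starts with the letter
      \<open>(p, b)\<close> itself and does not end in the generator \<open>p\<close>.\<close>
    let ?w = "(p, b) # w @ [(p, \<not> b)]"
    have "reduced ?w" using w hd False reduced_append[of "(p, b) # w" "[(p, \<not> b)]"] by simp
    then have "wev G f ?w \<noteq> \<one>" using same[of ?w p b] by auto
    moreover have "wev G f ?w = \<one>" if "wev G f w = \<one>"
      using that wev_append[OF f, of w "[(p, \<not> b)]"] fc[of p] by (cases b) simp_all
    ultimately show ?thesis by blast
  qed
  then show "wev G (pr x y) w \<noteq> \<one>" by (simp add: f_def)
qed

end

section \<open>The geometric representation of a Coxeter group\<close>

text \<open>Indexed by the innermost letter: \<open>s\<close> acts first whatever the length, and a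
  longer run adds letters on the left. \<open>alternating\<close> prescribes the outermost letter
  instead, which is why parities appear when the two are compared.\<close>

primrec altseq :: "('v \<Rightarrow> 'z \<Rightarrow> 'z) \<Rightarrow> 'v \<Rightarrow> 'v \<Rightarrow> nat \<Rightarrow> 'z \<Rightarrow> 'z" where
  "altseq F s t 0 z = z"
| "altseq F s t (Suc k) z = F (if even k then s else t) (altseq F s t k z)"

lemma altseq_eq_foldr:
  "altseq (\<lambda>s. F (s, True)) s t n z =
    foldr F (alternating n (if odd n then s else t) (if odd n then t else s)) z"
  by (induction n) (auto split: if_splits)

lemma altseq_foldr: "\<exists>u. set u \<subseteq> {s, t} \<and> length u = n \<and> altseq F s t n = foldr F u"
proof (induction n)
  case (Suc n)
  then obtain u where u: "set u \<subseteq> {s, t}" "length u = n" "altseq F s t n = foldr F u" by auto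
  then show ?case by (intro exI[of _ "(if even n then s else t) # u"]) auto
qed auto

lemma altseq_foldr_add: "\<exists>u. set u \<subseteq> {s, t} \<and> length u = j \<and> altseq F s t (j + i) = foldr F u \<circ> altseq F s t i"
proof (induction j)
  case (Suc n)
  then obtain u where u: "set u \<subseteq> {s, t}" "length u = n" "altseq F s t (n + i) = foldr F u \<circ> altseq F s t i" by blast
  then show ?case by (intro exI[of _ "(if even (n + i) then s else t) # u"]) (auto simp: fun_eq_iff)
qed auto

text \<open>This is the Chebyshev recurrence, solved by sines of multiples of
  \<open>\<theta>\<close>. Both sides carry the factor \<open>sin \<theta>\<close>, so no division
  is involved.\<close>

lemma two_cos_recurrence:
  fixes u :: "nat \<Rightarrow> real"
  assumes "\<And>k. u (Suc (Suc k)) = 2 * cos \<theta> * u (Suc k) - u k"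
  shows "u k * sin \<theta> = u 1 * sin (real k * \<theta>) - u 0 * sin ((real k - 1) * \<theta>)"
proof (induction k rule: induct_nat_012)
  case (ge2 n)
  have e: "sin ((x + 2) * \<theta>) = 2 * cos \<theta> * sin ((x + 1) * \<theta>) - sin (x * \<theta>)" for x
  proof -
    have "sin ((x + 1) * \<theta> + \<theta>) + sin ((x + 1) * \<theta> - \<theta>) = 2 * cos \<theta> * sin ((x + 1) * \<theta>)"
      unfolding sin_add sin_diff by simp
    moreover have "(x + 1) * \<theta> + \<theta> = (x + 2) * \<theta>" "(x + 1) * \<theta> - \<theta> = x * \<theta>" by (simp_all add: algebra_simps)
    ultimately show ?thesis by simp
  qed
  have "u (Suc (Suc n)) * sin \<theta> = 2 * cos \<theta> * (u (Suc n) * sin \<theta>) - u n * sin \<theta>"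
    by (simp add: assms algebra_simps)
  also have "\<dots> = u 1 * (2 * cos \<theta> * sin ((real n + 1) * \<theta>) - sin (real n * \<theta>))
      - u 0 * (2 * cos \<theta> * sin ((real n - 1 + 1) * \<theta>) - sin ((real n - 1) * \<theta>))"
    unfolding ge2 by (simp add: algebra_simps)
  also have "\<dots> = u 1 * sin ((real n + 2) * \<theta>) - u 0 * sin ((real n - 1 + 2) * \<theta>)"
    by (simp only: e)
  finally show ?case by (simp add: algebra_simps)
qed (auto simp: algebra_simps)

locale coxeter =
  fixes V :: "'v set" and m :: "'v \<Rightarrow> 'v \<Rightarrow> nat"
  assumes fin: "finite V" and m_sym: "m s t = m t s" and m_ne_1: "m s t \<noteq> 1"
begin

text \<open>The label \<open>0\<close> encodes a missing edge, that is \<open>m = \<infinity>\<close>.\<close>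

definition a :: "'v \<Rightarrow> 'v \<Rightarrow> real" where
  "a r s = (if r = s then 2 else if m r s = 0 then - 2 else - 2 * cos (pi / m r s))"

definition e :: "'v \<Rightarrow> 'v \<Rightarrow> real" where "e s r = (if r = s then 1 else 0)"

text \<open>The pairing of \<open>f\<close> with the simple root \<open>e s\<close>, normalised so
  that simple roots have norm 2. Accordingly \<open>\<sigma> s\<close> is the reflection that
  subtracts this multiple of \<open>e s\<close>, and \<open>B\<close> is the full bilinear
  form.\<close>

definition A :: "'v \<Rightarrow> ('v \<Rightarrow> real) \<Rightarrow> real" where "A s f = (\<Sum>r\<in>V. a r s * f r)"

definition \<sigma> :: "'v \<Rightarrow> ('v \<Rightarrow> real) \<Rightarrow> 'v \<Rightarrow> real" where
  "\<sigma> s f r = f r - (if r = s then A s f else 0)"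

definition W :: "(('v \<Rightarrow> real) \<Rightarrow> 'v \<Rightarrow> real) set" where "W = foldr \<sigma> ` lists V"

definition nonneg :: "('v \<Rightarrow> real) \<Rightarrow> bool" where "nonneg f \<longleftrightarrow> (\<forall>r. f r \<ge> 0)"

lemma a_sym: "a r s = a s r" by (simp add: a_def m_sym)

lemma a_diag [simp]: "a s s = 2" by (simp add: a_def)

lemma A_e [simp]: "t \<in> V \<Longrightarrow> A s (e t) = a t s"
  using fin by (simp add: A_def e_def if_distrib[of "\<lambda>x. _ * x"] cong: if_cong)

lemma A_lin: "A s (\<lambda>r. p * f r + q * g r) = p * A s f + q * A s g"
  by (simp add: A_def sum.distrib sum_distrib_left algebra_simps)

lemma \<sigma>_lin: "\<sigma> s (\<lambda>r. p * f r + q * g r) = (\<lambda>r. p * \<sigma> s f r + q * \<sigma> s g r)"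
  by (rule ext) (simp add: \<sigma>_def A_lin algebra_simps)

lemma foldr_\<sigma>_lin: "foldr \<sigma> w (\<lambda>r. p * f r + q * g r) = (\<lambda>r. p * foldr \<sigma> w f r + q * foldr \<sigma> w g r)"
  by (induction w) (simp_all add: \<sigma>_lin)

lemma W_lin: "y \<in> W \<Longrightarrow> y (\<lambda>r. p * f r + q * g r) = (\<lambda>r. p * y f r + q * y g r)"
  using foldr_\<sigma>_lin by (auto simp: W_def)

lemma W_minus: "y \<in> W \<Longrightarrow> y (\<lambda>r. - f r) = (\<lambda>r. - y f r)"
  using W_lin[of y "- 1" f 0 f] by simp

lemma \<sigma>_\<sigma> [simp]: "s \<in> V \<Longrightarrow> \<sigma> s (\<sigma> s f) = f"
proof -
  assume s: "s \<in> V"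
  have *: "\<sigma> s f = (\<lambda>r. 1 * f r + (- A s f) * e s r)" by (rule ext) (simp add: \<sigma>_def e_def)
  have "A s (\<sigma> s f) = - A s f" unfolding * A_lin using s by simp
  then show ?thesis by (intro ext) (simp add: \<sigma>_def)
qed

lemma \<sigma>_e: "s \<in> V \<Longrightarrow> \<sigma> s (e s) = (\<lambda>r. - e s r)"
  by (rule ext) (simp add: \<sigma>_def, simp add: e_def)

lemma id_in_W [simp]: "id \<in> W" by (auto simp: W_def intro!: image_eqI[of _ _ "[]"])

lemma W_comp: "x \<in> W \<Longrightarrow> y \<in> W \<Longrightarrow> x \<circ> y \<in> W"
proof -
  assume "x \<in> W" "y \<in> W"
  then obtain u v where "u \<in> lists V" "v \<in> lists V" "x = foldr \<sigma> u" "y = foldr \<sigma> v" by (auto simp: W_def)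
  then have "x \<circ> y = foldr \<sigma> (u @ v)" "u @ v \<in> lists V" by auto
  then show ?thesis unfolding W_def by blast
qed

lemma \<sigma>_in_W [simp]: "s \<in> V \<Longrightarrow> \<sigma> s \<in> W"
  unfolding W_def by (rule image_eqI[of _ _ "[s]"]) auto

lemma W_inverse: "y \<in> W \<Longrightarrow> \<exists>x\<in>W. x \<circ> y = id \<and> y \<circ> x = id"
proof -
  assume "y \<in> W"
  then obtain w where w: "w \<in> lists V" "y = foldr \<sigma> w" by (auto simp: W_def)
  have "foldr \<sigma> (rev w) (foldr \<sigma> w f) = f" "foldr \<sigma> w (foldr \<sigma> (rev w) f) = f" for f
    using w(1) by (induction w arbitrary: f) auto
  then show ?thesis unfolding w(2) using w(1)
    by (intro bexI[of _ "foldr \<sigma> (rev w)"] conjI ext) (auto simp: W_def)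
qed

lemma W_inj: "y \<in> W \<Longrightarrow> y f = y g \<Longrightarrow> f = g"
  using W_inverse by (metis comp_eq_dest_lhs id_apply)

definition B :: "('v \<Rightarrow> real) \<Rightarrow> ('v \<Rightarrow> real) \<Rightarrow> real" where "B f g = (\<Sum>r\<in>V. A r f * g r)"

lemma B_e [simp]: "s \<in> V \<Longrightarrow> B f (e s) = A s f"
  using fin by (simp add: B_def e_def if_distrib[of "\<lambda>x. _ * x"] cong: if_cong)

lemma B_\<sigma>: assumes s: "s \<in> V" shows "B (\<sigma> s f) (\<sigma> s g) = B f g"
proof -
  have *: "\<sigma> s f = (\<lambda>r. 1 * f r + (- A s f) * e s r)" by (rule ext) (simp add: \<sigma>_def e_def)
  have Ar: "A r (\<sigma> s f) = A r f - A s f * a s r" for r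
    unfolding * A_lin using s by simp
  have "B (\<sigma> s f) (\<sigma> s g) = (\<Sum>r\<in>V. (A r f - A s f * a s r) * (g r - (if r = s then A s g else 0)))"
    by (simp add: B_def Ar) (simp add: \<sigma>_def)
  also have "\<dots> = (\<Sum>r\<in>V. A r f * g r - A s f * (a r s * g r)
      - (if r = s then (A s f - A s f * a s s) * A s g else 0))"
    by (rule sum.cong) (auto simp: algebra_simps a_sym)
  also have "\<dots> = B f g - A s f * A s g - (A s f - A s f * a s s) * A s g"
    using fin s by (simp add: sum_subtractf B_def A_def sum_distrib_left[symmetric])
  also have "\<dots> = B f g" by (simp add: algebra_simps)
  finally show ?thesis .
qed

lemma B_W: "y \<in> W \<Longrightarrow> B (y f) (y g) = B f g"
proof -
  assume "y \<in> W"
  then obtain w where w: "w \<in> lists V" "y = foldr \<sigma> w" by (auto simp: W_def)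
  have "B (foldr \<sigma> w f) (foldr \<sigma> w g) = B f g"
    using w(1) by (induction w) (auto simp: B_\<sigma>)
  then show ?thesis using w by simp
qed

text \<open>An isometry \<open>y\<close> conjugates the reflection in a root into the reflection in
  the image of the root.\<close>

lemma reflection_conj:
  assumes "y \<in> W" "s \<in> V" "t \<in> V" "y (e t) = e s"
  shows "\<sigma> s (y f) = y (\<sigma> t f)"
proof -
  have "A t f = B f (e t)" using assms by simp
  also have "\<dots> = B (y f) (e s)" using B_W[OF assms(1), of f "e t"] assms by simp
  finally have At: "A t f = A s (y f)" using assms by simp
  have *: "\<sigma> t f = (\<lambda>r. 1 * f r + (- A t f) * e t r)" by (rule ext) (simp add: \<sigma>_def e_def)
  show ?thesis unfolding * W_lin[OF assms(1)] assms(4) using At by (intro ext) (simp add: \<sigma>_def e_def[of s])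
qed

lemma A_change:
  assumes "s \<in> V" "t \<in> V" "s \<noteq> t" "\<And>r. r \<notin> {s, t} \<Longrightarrow> g r = f r"
  shows "A s g = A s f + 2 * (g s - f s) + a t s * (g t - f t)"
proof -
  have "A s g - A s f = (\<Sum>r\<in>V. a r s * (g r - f r))"
    by (simp add: A_def sum_subtractf algebra_simps)
  also have "\<dots> = (\<Sum>r\<in>{s, t}. a r s * (g r - f r))"
    using assms fin by (intro sum.mono_neutral_right) auto
  finally show ?thesis using assms by simp
qed

lemma altseq_outside: "r \<notin> {s, t} \<Longrightarrow> altseq \<sigma> s t k f r = f r"
  by (induction k) (auto simp: \<sigma>_def)

text \<open>With \<open>\<xi>\<close> the fixed point of the affine action on the plane of \<open>s, t\<close>, the coordinate that is
  changed next and the one that was changed last are consecutive terms of one linear recurrence.\<close>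

lemma altseq_recurrence:
  assumes st: "s \<in> V" "t \<in> V" "s \<noteq> t"
    and L: "\<And>k. L k = (if even k then s else t)"
    and \<xi>: "2 * \<xi> s + a t s * \<xi> t = - (A s f - 2 * f s - a t s * f t)"
      "2 * \<xi> t + a s t * \<xi> s = - (A t f - 2 * f t - a s t * f s)"
  obtains u where "u 0 = f s - \<xi> s" "u 1 = f t - \<xi> t"
    "\<And>k. u (Suc (Suc k)) = - a s t * u (Suc k) - u k"
    "\<And>k. altseq \<sigma> s t k f (L k) = u k + \<xi> (L k)"
    "\<And>k. altseq \<sigma> s t k f (L (Suc k)) = u (Suc k) + \<xi> (L (Suc k))"
proof
  define F where "F k = altseq \<sigma> s t k f" for k
  define u where "u k = F k (L k) - \<xi> (L k)" for k
  have FS: "F (Suc k) = \<sigma> (L k) (F k)" for k by (simp add: F_def L)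
  have LSS: "L (Suc (Suc k)) = L k" for k by (simp add: L)
  have ne: "L (Suc k) \<noteq> L k" "L k \<in> V" for k using st by (auto simp: L)
  have step: "u (Suc k) = F k (L (Suc k)) - \<xi> (L (Suc k))" for k
    unfolding u_def FS using ne by (simp add: \<sigma>_def)
  show "u 0 = f s - \<xi> s" by (simp add: u_def F_def L)
  show "u 1 = f t - \<xi> t" using step[of 0] by (simp add: F_def L)
  show "altseq \<sigma> s t k f (L k) = u k + \<xi> (L k)" for k by (simp add: u_def F_def)
  show "altseq \<sigma> s t k f (L (Suc k)) = u (Suc k) + \<xi> (L (Suc k))" for k by (simp add: step F_def)
  show "u (Suc (Suc k)) = - a s t * u (Suc k) - u k" for k
  proof -
    have "F k r = f r" if "r \<notin> {s, t}" for r using that altseq_outside by (simp add: F_def)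
    then have "A s (F k) = A s f + 2 * (F k s - f s) + a t s * (F k t - f t)"
      "A t (F k) = A t f + 2 * (F k t - f t) + a s t * (F k s - f s)"
      using st by (intro A_change; auto)+
    moreover have "u (Suc (Suc k)) = F k (L k) - A (L k) (F k) - \<xi> (L k)"
      unfolding step FS LSS by (simp add: \<sigma>_def)
    moreover have "u (Suc k) = F k (L (Suc k)) - \<xi> (L (Suc k))" "u k = F k (L k) - \<xi> (L k)"
      by (rule step, rule u_def)
    moreover have "(L k = s \<and> L (Suc k) = t) \<or> (L k = t \<and> L (Suc k) = s)" by (simp add: L)
    moreover have "x - (Af + 2 * (x - fx) + c * (y - fy)) - xi = - c * (y - eta) - (x - xi)"
      if "2 * xi + c * eta = - (Af - 2 * fx - c * fy)" for x y Af fx fy c xi eta :: real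
      using that by (simp add: algebra_simps)
    ultimately show ?thesis using \<xi> a_sym[of s t] by (elim disjE conjE) simp_all
  qed
qed

lemma angle:
  assumes "m s t \<noteq> 0" "s \<noteq> t"
  shows "sin (pi / m s t) > 0" "- a s t = 2 * cos (pi / m s t)" "real (m s t) * (pi / m s t) = pi" "m s t \<ge> 2"
proof -
  show 2: "m s t \<ge> 2" using assms m_ne_1[of s t] by linarith
  then have "pi / m s t < pi" "pi / m s t > 0" by (auto simp: field_simps)
  then show "sin (pi / m s t) > 0" by (intro sin_gt_zero) auto
qed (use assms in \<open>auto simp: a_def\<close>)

text \<open>With angle \<open>pi / m\<close>, the sines in the solved recurrence give
  \<open>u m = - u 0\<close> and \<open>u (m + 1) = - u 1\<close>. So the alternating run of length
  \<open>m\<close> is the point reflection in \<open>\<xi>\<close>, followed for odd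
  \<open>m\<close> by the exchange of the two centred coordinates.\<close>

lemma altseq_at_m:
  assumes st: "s \<in> V" "t \<in> V" "s \<noteq> t" "m s t \<noteq> 0"
    and \<xi>: "2 * \<xi> s + a t s * \<xi> t = - (A s f - 2 * f s - a t s * f t)"
      "2 * \<xi> t + a s t * \<xi> s = - (A t f - 2 * f t - a s t * f s)"
  shows "altseq \<sigma> s t (m s t) f s = (if even (m s t) then \<xi> s - f s + \<xi> s else \<xi> t - f t + \<xi> s)"
    and "altseq \<sigma> s t (m s t) f t = (if even (m s t) then \<xi> t - f t + \<xi> t else \<xi> s - f s + \<xi> t)"
proof -
  define L where "L k = (if even k then s else t)" for k :: nat
  obtain u where u: "u 0 = f s - \<xi> s" "u 1 = f t - \<xi> t"
    "\<And>k. u (Suc (Suc k)) = - a s t * u (Suc k) - u k"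
    "\<And>k. altseq \<sigma> s t k f (L k) = u k + \<xi> (L k)"
    "\<And>k. altseq \<sigma> s t k f (L (Suc k)) = u (Suc k) + \<xi> (L (Suc k))"
    using altseq_recurrence[OF st(1-3) L_def \<xi>] by blast
  note an = angle[OF st(4,3)]
  let ?M = "m s t"
  let ?\<theta> = "pi / ?M"
  have rec: "u k * sin ?\<theta> = u 1 * sin (real k * ?\<theta>) - u 0 * sin ((real k - 1) * ?\<theta>)" for k
    using u(3) unfolding an(2) by (rule two_cos_recurrence)
  have "(real ?M - 1) * \<theta> = pi - \<theta> \<and> real (Suc ?M) * \<theta> = pi + \<theta> \<and> (real (Suc ?M) - 1) * \<theta> = pi"
    if "real ?M * \<theta> = pi" for \<theta>
    using that by (simp add: left_diff_distrib distrib_right)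
  note angles = this[OF an(3)]
  have "u ?M * sin ?\<theta> = - u 0 * sin ?\<theta>" "u (Suc ?M) * sin ?\<theta> = - u 1 * sin ?\<theta>"
    using rec[of ?M] rec[of "Suc ?M"] unfolding angles[THEN conjunct1] angles[THEN conjunct2, THEN conjunct1]
      angles[THEN conjunct2, THEN conjunct2] an(3) by simp_all
  then have um: "u ?M = - u 0" "u (Suc ?M) = - u 1" using an(1) by (metis less_irrefl mult_right_cancel)+
  show "altseq \<sigma> s t ?M f s = (if even ?M then \<xi> s - f s + \<xi> s else \<xi> t - f t + \<xi> s)"
    using u(4)[of ?M] u(5)[of ?M] um u(1,2) by (cases "even ?M") (simp_all add: L_def)
  show "altseq \<sigma> s t ?M f t = (if even ?M then \<xi> t - f t + \<xi> t else \<xi> s - f s + \<xi> t)"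
    using u(4)[of ?M] u(5)[of ?M] um u(1,2) by (cases "even ?M") (simp_all add: L_def)
qed

text \<open>The outcome of the run of length \<open>m\<close> is described by a formula that is
  symmetric in \<open>s\<close> and \<open>t\<close>; so the braid relation follows as soon as the
  centre \<open>\<xi>\<close> exists.\<close>

lemma braid_\<sigma>:
  assumes st: "s \<in> V" "t \<in> V" "s \<noteq> t" "m s t \<noteq> 0"
  shows "altseq \<sigma> s t (m s t) f = altseq \<sigma> t s (m s t) f"
proof -
  let ?c = "a s t" and ?p = "- (A s f - 2 * f s - a t s * f t)" and ?q = "- (A t f - 2 * f t - a s t * f s)"
  note an = angle[OF st(4,3)]
  have "4 - ?c\<^sup>2 = 4 * (sin (pi / m s t))\<^sup>2"
  proof -
    have c: "?c = - (2 * cos (pi / m s t))" using an(2) by simp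
    show ?thesis unfolding c sin_squared_eq by (simp add: power_mult_distrib)
  qed
  then have d: "4 - ?c\<^sup>2 \<noteq> 0" using an(1) by simp
  \<comment> \<open>Cramer's rule for the two equations of the fixed point. The determinant
    \<open>4 - a\<^sup>2\<close> is \<open>4 sin\<^sup>2 (pi / m)\<close>, nonzero because
    \<open>m\<close> is finite and at least 2.\<close>
  define \<xi> where "\<xi> r = (if r = s then (2 * ?p - ?c * ?q) / (4 - ?c\<^sup>2) else (2 * ?q - ?c * ?p) / (4 - ?c\<^sup>2))" for r
  have s1: "2 * \<xi> s + a t s * \<xi> t = ?p"
  proof -
    have "2 * \<xi> s + a t s * \<xi> t = (2 * (2 * ?p - ?c * ?q) + ?c * (2 * ?q - ?c * ?p)) / (4 - ?c\<^sup>2)"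
      using st by (simp add: \<xi>_def a_sym[of t s] add_divide_distrib)
    also have "2 * (2 * ?p - ?c * ?q) + ?c * (2 * ?q - ?c * ?p) = ?p * (4 - ?c\<^sup>2)"
      by (simp add: algebra_simps power2_eq_square)
    finally show ?thesis using d by simp
  qed
  have s2: "2 * \<xi> t + a s t * \<xi> s = ?q"
  proof -
    have "2 * \<xi> t + a s t * \<xi> s = (2 * (2 * ?q - ?c * ?p) + ?c * (2 * ?p - ?c * ?q)) / (4 - ?c\<^sup>2)"
      using st by (simp add: \<xi>_def add_divide_distrib)
    also have "2 * (2 * ?q - ?c * ?p) + ?c * (2 * ?p - ?c * ?q) = ?q * (4 - ?c\<^sup>2)"
      by (simp add: algebra_simps power2_eq_square)
    finally show ?thesis using d by simp
  qed
  note 1 = altseq_at_m[of s t \<xi> f, OF st s1 s2]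
  have ts: "t \<noteq> s" "m t s \<noteq> 0" using st m_sym by auto
  note 2 = altseq_at_m[of t s \<xi> f, OF st(2,1) ts s2 s1]
  show ?thesis
  proof
    fix r
    show "altseq \<sigma> s t (m s t) f r = altseq \<sigma> t s (m s t) f r"
      using 1 2 m_sym[of t s] altseq_outside[of r s t] altseq_outside[of r t s]
      by (cases "r = s"; cases "r = t") auto
  qed
qed

lemma dihedral_recurrence:
  assumes "m s t \<noteq> 0" "s \<noteq> t" "\<And>k. u (Suc (Suc k)) = - a s t * u (Suc k) - u k" "u 0 = 0" "u 1 = 1" "k \<le> m s t"
  shows "u k \<ge> 0"
proof -
  let ?\<theta> = "pi / m s t"
  note an = angle[OF assms(1,2)]
  have "u k * sin ?\<theta> = u 1 * sin (real k * ?\<theta>) - u 0 * sin ((real k - 1) * ?\<theta>)"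
    using assms(3) unfolding an(2) by (rule two_cos_recurrence)
  then have "u k * sin ?\<theta> = sin (real k * ?\<theta>)" using assms by simp
  moreover have "real k * ?\<theta> \<le> real (m s t) * ?\<theta>"
    using assms by (intro mult_right_mono) auto
  then have "sin (real k * ?\<theta>) \<ge> 0" using an(3) by (intro sin_ge_zero) auto
  ultimately show ?thesis using an(1) by (metis mult_less_0_iff not_less order_less_le)
qed

text \<open>Rank two case of the positivity of roots. The root lies in the plane of
  \<open>s\<close>, \<open>t\<close>, so the centre is \<open>0\<close> and its coordinates are two
  consecutive terms \<open>u k\<close> and \<open>u (k + 1)\<close>: ratios of sines for finite
  \<open>m\<close>, and \<open>u n = n\<close> for infinite \<open>m\<close>. As
  \<open>u (k + 1)\<close> occurs, \<open>k < m\<close> is required.\<close>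

lemma altseq_simple_root:
  assumes st: "s \<in> V" "t \<in> V" "s \<noteq> t" "m s t = 0 \<or> k < m s t"
  shows "\<exists>p q. p \<ge> 0 \<and> q \<ge> 0 \<and> altseq \<sigma> t s k (e s) = (\<lambda>r. p * e s r + q * e t r)"
proof -
  define L where "L k = (if even k then t else s)" for k :: nat
  have "2 * (0::real) + a s t * 0 = - (A t (e s) - 2 * e s t - a s t * e s s)"
    "2 * (0::real) + a t s * 0 = - (A s (e s) - 2 * e s s - a t s * e s t)"
    using st by (simp_all add: e_def[of s t] e_def[of s s])
  then obtain u where u: "u 0 = e s t - 0" "u 1 = e s s - 0"
    "\<And>k. u (Suc (Suc k)) = - a t s * u (Suc k) - u k"
    "\<And>k. altseq \<sigma> t s k (e s) (L k) = u k + 0"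
    "\<And>k. altseq \<sigma> t s k (e s) (L (Suc k)) = u (Suc k) + 0"
    using altseq_recurrence[OF st(2,1) st(3)[symmetric] L_def, of "\<lambda>_. 0" "e s"] by blast
  have u01: "u 0 = 0" "u 1 = 1" using u(1,2) st by (auto simp: e_def)
  have pos: "u k \<ge> 0" "u (Suc k) \<ge> 0"
  proof (goal_cases)
    case 1
    show ?case
    proof (cases "m s t = 0")
      case True
      have at: "a t s = - 2" using True st m_sym[of s t] by (simp add: a_def)
      have "u n = real n" for n
        by (induction n rule: induct_nat_012) (use u01 u(3) at in auto)
      then show ?thesis by simp
    qed (use dihedral_recurrence[of t s u k] st u u01 m_sym[of s t] in auto)
  next
    case 2
    show ?case
    proof (cases "m s t = 0")
      case True
      have at: "a t s = - 2" using True st m_sym[of s t] by (simp add: a_def)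
      have "u n = real n" for n
        by (induction n rule: induct_nat_012) (use u01 u(3) at in auto)
      then show ?thesis by simp
    qed (use dihedral_recurrence[of t s u "Suc k"] st u u01 m_sym[of s t] in auto)
  qed
  define g where "g = altseq \<sigma> t s k (e s)"
  have "g r = g s * e s r + g t * e t r" for r
    using altseq_outside[of r t s k "e s"] st by (auto simp: e_def g_def)
  moreover have "g s \<ge> 0" "g t \<ge> 0" using u(4,5)[of k] pos by (auto simp: L_def g_def split: if_splits)
  ultimately show ?thesis unfolding g_def by blast
qed

section \<open>Length and the signs of roots\<close>

definition len :: "(('v \<Rightarrow> real) \<Rightarrow> 'v \<Rightarrow> real) \<Rightarrow> nat" where
  "len y = (LEAST n. \<exists>w. set w \<subseteq> V \<and> length w = n \<and> y = foldr \<sigma> w)"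

lemma len_word: "y \<in> W \<Longrightarrow> \<exists>w. set w \<subseteq> V \<and> length w = len y \<and> y = foldr \<sigma> w"
  unfolding len_def by (rule LeastI_ex) (auto simp: W_def)

lemma len_le: "set w \<subseteq> V \<Longrightarrow> len (foldr \<sigma> w) \<le> length w"
  unfolding len_def by (rule Least_le) auto

lemma len_comp: "y \<in> W \<Longrightarrow> set u \<subseteq> V \<Longrightarrow> len (y \<circ> foldr \<sigma> u) \<le> len y + length u"
proof -
  assume y: "y \<in> W" and u: "set u \<subseteq> V"
  obtain w where w: "set w \<subseteq> V" "length w = len y" "y = foldr \<sigma> w" using len_word[OF y] by auto
  have "y \<circ> foldr \<sigma> u = foldr \<sigma> (w @ u)" using w by auto
  then show ?thesis using len_le[of "w @ u"] w u by simp
qed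

text \<open>Split off the longest alternating tail in \<open>s\<close> and \<open>t\<close> that
  realises the length. The remaining \<open>v\<close> is lengthened by neither of them, so by
  induction it sends both simple roots to positive vectors, and the tail sends \<open>e s\<close> to
  a nonnegative combination of the two.\<close>

lemma nonneg_if_len_le:
  assumes "y \<in> W" "s \<in> V" "len y \<le> len (y \<circ> \<sigma> s)"
  shows "nonneg (y (e s))"
  using assms
proof (induction "len y" arbitrary: y s rule: less_induct)
  case less
  show ?case
  proof (cases "len y = 0")
    case True
    then have "y = foldr \<sigma> []" using len_word[OF less.prems(1)] by auto
    then show ?thesis by (simp add: nonneg_def e_def)
  next
    case False
    obtain w where w: "set w \<subseteq> V" "length w = len y" "y = foldr \<sigma> w" using len_word[OF less.prems(1)] by auto
    then obtain w' t where wt: "w = w' @ [t]" using False by (cases w rule: rev_cases) auto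
    have t: "t \<in> V" using w wt by auto
    have yt: "y \<circ> \<sigma> t = foldr \<sigma> w'" using w wt t by (auto simp: fun_eq_iff)
    have lyt: "len (y \<circ> \<sigma> t) < len y" unfolding yt using len_le[of w'] w wt by auto
    then have st: "s \<noteq> t" using less.prems by auto
    define L where "L k = (if even k then t else s)" for k :: nat
    have LV: "L k \<in> V" for k using t less.prems by (simp add: L_def)
    \<comment> \<open>\<open>P k\<close> says that some reduced expression of \<open>y\<close> ends
      in an alternating tail of \<open>k\<close> letters whose last letter is \<open>t\<close>.
      \<open>P 1\<close> holds because \<open>t\<close> is the last letter of a shortest
      word.\<close>
    define P where "P k \<longleftrightarrow> (\<exists>v\<in>W. y = v \<circ> altseq \<sigma> t s k \<and> len v + k = len y)" for k
    have P1: "P 1"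
    proof -
      have "y = (y \<circ> \<sigma> t) \<circ> altseq \<sigma> t s 1" using t by (auto simp: fun_eq_iff)
      moreover have v: "y \<circ> \<sigma> t \<in> W" using less.prems t W_comp by auto
      moreover have "len y \<le> len (y \<circ> \<sigma> t) + 1"
        using len_comp[OF v, of "[t]"] t by (simp add: comp_def)
      ultimately show ?thesis unfolding P_def using lyt by (intro bexI[of _ "y \<circ> \<sigma> t"]) auto
    qed
    have Pb: "P k \<Longrightarrow> k \<le> len y" for k by (auto simp: P_def)
    obtain k where k: "P k" "\<And>j. P j \<Longrightarrow> j \<le> k"
      using P1 Pb Greatest_le_nat[of P _ "len y"] GreatestI_nat[of P 1 "len y"] by blast
    have k1: "k \<ge> 1" using k(2)[OF P1] .
    obtain v where v: "v \<in> W" "y = v \<circ> altseq \<sigma> t s k" "len v + k = len y" using k(1) by (auto simp: P_def)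
    have step: "altseq \<sigma> t s (Suc j) = \<sigma> (L j) \<circ> altseq \<sigma> t s j" for j by (auto simp: L_def)
    have bound: "len (x \<circ> altseq \<sigma> t s j) \<le> len x + j" if "x \<in> W" for x j
      using altseq_foldr[of t s j \<sigma>] len_comp[OF that] t less.prems by fastforce
    have next1: "len v \<le> len (v \<circ> \<sigma> (L k))"
    proof (rule ccontr)
      assume n: "\<not> ?thesis"
      let ?v = "v \<circ> \<sigma> (L k)"
      have vW: "?v \<in> W" using v LV W_comp by auto
      have "y = ?v \<circ> altseq \<sigma> t s (Suc k)" using v LV[of k] unfolding step by (auto simp: fun_eq_iff)
      moreover have "len ?v + Suc k = len y"
        using bound[OF vW, of "Suc k"] calculation n v(3) by simp
      ultimately have "P (Suc k)" using vW unfolding P_def by blast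
      then show False using k(2) by fastforce
    qed
    have next2: "len v \<le> len (v \<circ> \<sigma> (L (Suc k)))"
    proof (rule ccontr)
      assume n: "\<not> ?thesis"
      let ?v = "v \<circ> \<sigma> (L (Suc k))"
      have vW: "?v \<in> W" using v LV W_comp by auto
      obtain j where j: "k = Suc j" using k1 by (cases k) auto
      have "y = ?v \<circ> altseq \<sigma> t s j" using v unfolding j step by (auto simp: fun_eq_iff L_def)
      then show False using bound[OF vW, of j] n v(3) j by simp
    qed
    have LL: "{L k, L (Suc k)} = {s, t}" by (auto simp: L_def)
    have "nonneg (v (e (L k)))" "nonneg (v (e (L (Suc k))))"
      using less.hyps[of v] v k1 next1 next2 LV by auto
    then have vst: "nonneg (v (e s))" "nonneg (v (e t))" using LL by (metis doubleton_eq_iff)+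
    \<comment> \<open>If the tail had \<open>m\<close> letters, the braid relation would rewrite its
      end so that \<open>s\<close> comes last, and then \<open>y \<circ> \<sigma> s\<close> would be
      shorter than \<open>y\<close>.\<close>
    have km: "m s t = 0 \<or> k < m s t"
    proof (rule ccontr)
      assume n: "\<not> ?thesis"
      let ?M = "m s t"
      have M: "?M \<ge> 2" using angle(4)[of s t] n st by auto
      obtain u where u: "set u \<subseteq> {t, s}" "length u = k - ?M" "altseq \<sigma> t s (k - ?M + ?M) = foldr \<sigma> u \<circ> altseq \<sigma> t s ?M"
        using altseq_foldr_add by metis
      obtain u' where u': "set u' \<subseteq> {s, t}" "length u' = ?M - 1" "altseq \<sigma> s t (?M - 1 + 1) = foldr \<sigma> u' \<circ> altseq \<sigma> s t 1"
        using altseq_foldr_add by metis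
      have "y = v \<circ> foldr \<sigma> u \<circ> altseq \<sigma> t s ?M" using v u n by (simp add: comp_assoc)
      also have "altseq \<sigma> t s ?M = altseq \<sigma> s t ?M"
        using braid_\<sigma>[of s t] less.prems t st n by (auto simp: fun_eq_iff)
      also have "\<dots> = foldr \<sigma> u' \<circ> \<sigma> s" using u' M by (auto simp: fun_eq_iff)
      finally have "y \<circ> \<sigma> s = v \<circ> foldr \<sigma> (u @ u')"
        using less.prems by (auto simp: fun_eq_iff)
      then have "len (y \<circ> \<sigma> s) \<le> len v + (k - ?M + (?M - 1))"
        using len_comp[OF v(1), of "u @ u'"] u u' t less.prems by auto
      then show False using less.prems v(3) n M by auto
    qed
    obtain p q where pq: "p \<ge> 0" "q \<ge> 0" "altseq \<sigma> t s k (e s) = (\<lambda>r. p * e s r + q * e t r)"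
      using altseq_simple_root[OF less.prems(2) t st km] by auto
    have "y (e s) = (\<lambda>r. p * v (e s) r + q * v (e t) r)" using v pq W_lin[OF v(1)] by simp
    then show ?thesis using vst pq by (auto simp: nonneg_def)
  qed
qed

text \<open>If \<open>s\<close> shortens \<open>y\<close>, it does not shorten
  \<open>y \<circ> \<sigma> s\<close>, and that element sends \<open>e s\<close> to the negative of
  the root in question.\<close>

theorem root_sign:
  assumes "y \<in> W" "s \<in> V"
  shows "nonneg (y (e s)) \<or> nonneg (\<lambda>r. - y (e s) r)"
proof (cases "len y \<le> len (y \<circ> \<sigma> s)")
  case True
  then show ?thesis using nonneg_if_len_le assms by blast
next
  case False
  let ?y = "y \<circ> \<sigma> s"
  have "?y \<circ> \<sigma> s = y" using assms by (auto simp: fun_eq_iff)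
  moreover have "?y \<in> W" using assms W_comp by simp
  ultimately have "nonneg (?y (e s))" using nonneg_if_len_le[of ?y s] False assms(2) by simp
  moreover have "?y (e s) = (\<lambda>r. - y (e s) r)" using assms by (simp add: \<sigma>_e W_minus)
  ultimately show ?thesis by simp
qed

end

section \<open>Lifting the action on Coxeter cosets to pairs with a group value\<close>

locale coxeter_coset = coxeter V m + group K
  for V :: "'v set" and m :: "'v \<Rightarrow> 'v \<Rightarrow> nat" and K :: "('k, 'b) monoid_scheme" (structure) +
  fixes T :: "'v set" and k :: "'v \<Rightarrow> 'k"
  assumes TV: "T \<subseteq> V" and k_closed: "t \<in> T \<Longrightarrow> k t \<in> carrier K"
    and braid_k: "t \<in> T \<Longrightarrow> t' \<in> T \<Longrightarrow> t \<noteq> t' \<Longrightarrow> m t t' \<noteq> 0 \<Longrightarrow> g \<in> carrier K \<Longrightarrow>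
      altseq (\<lambda>t g. k t \<otimes> g) t t' (m t t') g = altseq (\<lambda>t g. k t \<otimes> g) t' t (m t t') g"
begin

text \<open>Elements of \<open>X\<close> are the minimal representatives of the cosets of the standard parabolic
  subgroup of type \<open>T\<close> in the Coxeter group.\<close>

definition X :: "(('v \<Rightarrow> real) \<Rightarrow> 'v \<Rightarrow> real) set" where
  "X = {y \<in> W. \<forall>t\<in>T. nonneg (y (e t))}"

text \<open>In the Coxeter group \<open>y (e t) = e s\<close> means \<open>s y = y t\<close>: the
  letter \<open>s\<close> fixes the coset of \<open>y\<close> and passes through \<open>y\<close> as
  the letter \<open>t\<close> of \<open>T\<close>.\<close>

definition hits :: "(('v \<Rightarrow> real) \<Rightarrow> 'v \<Rightarrow> real) \<Rightarrow> 'v \<Rightarrow> bool" where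
  "hits y s \<longleftrightarrow> (\<exists>t\<in>T. y (e t) = e s)"

definition hit :: "(('v \<Rightarrow> real) \<Rightarrow> 'v \<Rightarrow> real) \<Rightarrow> 'v \<Rightarrow> 'v" where
  "hit y s = (SOME t. t \<in> T \<and> y (e t) = e s)"

text \<open>If \<open>s\<close> moves the coset, the representative is multiplied; if
  \<open>s\<close> fixes it, the value of the letter \<open>hit y s\<close> is multiplied onto
  \<open>g\<close>. The sign of a letter shows only in the second case, as \<open>\<sigma> s\<close>
  is an involution.\<close>

fun step :: "'v \<times> bool \<Rightarrow> (('v \<Rightarrow> real) \<Rightarrow> 'v \<Rightarrow> real) \<times> 'k \<Rightarrow> (('v \<Rightarrow> real) \<Rightarrow> 'v \<Rightarrow> real) \<times> 'k" where
  "step (s, b) (y, g) =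
    (if hits y s then (y, (if b then k (hit y s) else inv (k (hit y s))) \<otimes> g) else (\<sigma> s \<circ> y, g))"

lemma e_inj: "e s = e t \<Longrightarrow> s = t"
  by (metis e_def zero_neq_one)

lemma hit_eq: "y \<in> W \<Longrightarrow> t \<in> T \<Longrightarrow> y (e t) = e s \<Longrightarrow> hit y s = t"
  unfolding hit_def by (rule some_equality, simp, metis W_inj e_inj)

lemma hitsD: "hits y s \<Longrightarrow> hit y s \<in> T \<and> y (e (hit y s)) = e s"
  unfolding hit_def hits_def by (rule someI_ex) auto

text \<open>All roots have the norm 2 of a simple root, so a nonnegative factor \<open>c\<close>
  satisfies \<open>c * c = 1\<close>.\<close>

lemma root_multiple:
  assumes "y \<in> W" "t \<in> V" "s \<in> V" "y (e t) = (\<lambda>r. c * e s r)" "c \<ge> 0"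
  shows "y (e t) = e s"
proof -
  let ?f = "\<lambda>r. c * e s r"
  have "A s ?f = c * 2" using A_lin[of s c "e s" 0 "e s"] assms by simp
  moreover have "B ?f ?f = c * A s ?f"
    using fin assms(3) by (simp add: B_def e_def if_distrib[of "\<lambda>x. _ * x"] cong: if_cong)
  moreover have "B ?f ?f = 2" using B_W[OF assms(1), of "e t" "e t"] assms by simp
  ultimately have "c * c = 1" by simp
  then have "c = 1" using assms(5) by (metis abs_of_nonneg real_sqrt_abs2 real_sqrt_one)
  then show ?thesis using assms by simp
qed

text \<open>A reflection in \<open>e s\<close> alters only the coordinate \<open>s\<close>. If it
  turns the positive root \<open>y (e t)\<close> negative, that root is supported at
  \<open>s\<close>, hence equals \<open>e s\<close>, and \<open>s\<close> would hit. A hit after the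
  move would mean \<open>y (e t) = - e s\<close>, against positivity.\<close>

lemma X_step:
  assumes y: "y \<in> X" and s: "s \<in> V" and nh: "\<not> hits y s"
  shows "\<sigma> s \<circ> y \<in> X" "\<not> hits (\<sigma> s \<circ> y) s"
proof -
  have yW: "y \<in> W" using y by (simp add: X_def)
  have syW: "\<sigma> s \<circ> y \<in> W" using yW s W_comp by simp
  have "nonneg ((\<sigma> s \<circ> y) (e t))" if t: "t \<in> T" for t
  proof (rule ccontr)
    assume "\<not> ?thesis"
    then have neg: "nonneg (\<lambda>r. - (\<sigma> s \<circ> y) (e t) r)" using root_sign[OF syW] TV t by auto
    have pos: "nonneg (y (e t))" using y t by (simp add: X_def)
    have z: "y (e t) r = 0" if "r \<noteq> s" for r
    proof -
      have "y (e t) r \<ge> 0" "- \<sigma> s (y (e t)) r \<ge> 0"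
        using pos neg unfolding nonneg_def by (auto simp: comp_def)
      then show ?thesis using that by (simp add: \<sigma>_def)
    qed
    have "y (e t) = (\<lambda>r. y (e t) s * e s r)"
    proof
      fix r show "y (e t) r = y (e t) s * e s r" using z[of r] by (cases "r = s") (simp_all add: e_def[of s])
    qed
    moreover have "y (e t) s \<ge> 0" using pos by (simp add: nonneg_def)
    ultimately have "y (e t) = e s" using root_multiple[of y t s "y (e t) s"] yW s t TV by blast
    then show False using nh t by (auto simp: hits_def)
  qed
  then show "\<sigma> s \<circ> y \<in> X" using syW by (simp add: X_def)
  show "\<not> hits (\<sigma> s \<circ> y) s"
  proof
    assume "hits (\<sigma> s \<circ> y) s"
    then obtain t where t: "t \<in> T" "\<sigma> s (y (e t)) = e s" by (auto simp: hits_def)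
    then have "y (e t) = \<sigma> s (e s)" using \<sigma>_\<sigma>[OF s, of "y (e t)"] by simp
    then have "y (e t) s = - 1" using s by (simp add: \<sigma>_e) (simp add: e_def[of s])
    moreover have "y (e t) s \<ge> 0" using y t by (simp add: X_def nonneg_def)
    ultimately show False by simp
  qed
qed

lemma step_closed: "s \<in> V \<Longrightarrow> z \<in> X \<times> carrier K \<Longrightarrow> step (s, b) z \<in> X \<times> carrier K"
  by (cases z) (auto simp: X_step k_closed hitsD)

lemma step_cancel: "s \<in> V \<Longrightarrow> z \<in> X \<times> carrier K \<Longrightarrow> step (s, b) (step (s, \<not> b) z) = z"
proof -
  assume s: "s \<in> V" and z: "z \<in> X \<times> carrier K"
  obtain y g where yg: "z = (y, g)" "y \<in> X" "g \<in> carrier K" using z by auto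
  show ?thesis
  proof (cases "hits y s")
    case True
    then have "k (hit y s) \<in> carrier K" using hitsD k_closed by blast
    then show ?thesis using True yg by (cases b) (simp_all flip: m_assoc)
  next
    case False
    then show ?thesis using X_step(2)[OF yg(2) s False] yg s by (auto simp: fun_eq_iff)
  qed
qed

definition plane :: "'v \<Rightarrow> 'v \<Rightarrow> ('v \<Rightarrow> real) \<Rightarrow> bool" where
  "plane s s' f \<longleftrightarrow> (\<forall>r. r \<noteq> s \<longrightarrow> r \<noteq> s' \<longrightarrow> f r = 0)"

lemma plane_commute: "plane s s' f \<longleftrightarrow> plane s' s f" by (auto simp: plane_def)

lemma plane_altseq: "plane s s' (altseq \<sigma> s s' n f) \<longleftrightarrow> plane s s' f"
  by (auto simp: plane_def altseq_outside)

lemma plane_e: "plane s s' (e s)" "plane s s' (e s')" by (auto simp: plane_def e_def)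

text \<open>Two positive roots \<open>f\<close>, \<open>f'\<close> of the plane span it, so
  \<open>e s\<close> is a combination of them. Its coefficients are those of a root in the simple
  roots \<open>e t\<close>, \<open>e t'\<close>, so they have one sign, and this sign is positive. A
  nonnegative combination of nonnegative vectors vanishes at \<open>s'\<close> only termwise, which
  leaves \<open>f\<close> or \<open>f'\<close> proportional to \<open>e s\<close>.\<close>

lemma plane_two_roots:
  assumes ss: "s \<in> V" "s' \<in> V" "s \<noteq> s'" and y: "y \<in> X" and t: "t \<in> T" "t' \<in> T" "t \<noteq> t'"
    and pl: "plane s s' (y (e t))" "plane s s' (y (e t'))"
  shows "y (e t) = e s \<or> y (e t') = e s"
proof -
  define f f' where "f = y (e t)" and "f' = y (e t')"
  have yW: "y \<in> W" using y by (simp add: X_def)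
  have tV: "t \<in> V" "t' \<in> V" using t TV by auto
  obtain x where x: "x \<in> W" "x \<circ> y = id" using W_inverse[OF yW] by auto
  have xf: "x f = e t" "x f' = e t'" using x by (auto simp: f_def f'_def fun_eq_iff)
  have pos: "f r \<ge> 0" "f' r \<ge> 0" for r using y t by (auto simp: X_def nonneg_def f_def f'_def)
  have out: "f r = 0" "f' r = 0" if "r \<noteq> s" "r \<noteq> s'" for r
    using pl that by (auto simp: plane_def f_def f'_def)
  have indep: "p = 0 \<and> q = 0" if "\<And>r. p * f r + q * f' r = 0" for p q
  proof -
    have "(\<lambda>r. p * f r + q * f' r) = (\<lambda>r. 0 * f r + 0 * f r)" using that by auto
    then have "x (\<lambda>r. p * f r + q * f' r) = x (\<lambda>r. 0 * f r + 0 * f r)" by simp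
    then have "(\<lambda>r. p * e t r + q * e t' r) = (\<lambda>r. 0)" unfolding W_lin[OF x(1)] xf by simp
    then have "p * e t t + q * e t' t = 0" "p * e t t' + q * e t' t' = 0" by meson+
    then show ?thesis using t by (simp add: e_def)
  qed
  \<comment> \<open>The determinant of the two roots in the coordinates \<open>s\<close>,
    \<open>s'\<close>; \<open>comb\<close> is Cramer's rule for expressing \<open>e s\<close>
    through them.\<close>
  define D where "D = f s * f' s' - f' s * f s'"
  have comb: "f' s' * f r + (- f s') * f' r = D * e s r" for r
    using out[of r] ss by (cases "r = s"; cases "r = s'") (auto simp: D_def e_def[of s] algebra_simps)
  have D0: "D \<noteq> 0"
  proof
    assume D: "D = 0"
    then have "f' s' = 0 \<and> - f s' = 0" using comb by (intro indep) simp
    then have "f' s * f r + (- f s) * f' r = 0" for r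
      using out[of r] by (cases "r = s"; cases "r = s'") (auto simp: algebra_simps)
    then have "f' s = 0 \<and> - f s = 0" by (rule indep)
    then have "1 * f r + 0 * f' r = 0" for r
      using \<open>f' s' = 0 \<and> - f s' = 0\<close> out[of r] by (cases "r = s"; cases "r = s'") auto
    then show False using indep[of 1 0] by simp
  qed
  define \<alpha> \<beta> where "\<alpha> = f' s' / D" and "\<beta> = - f s' / D"
  have es: "e s = (\<lambda>r. \<alpha> * f r + \<beta> * f' r)"
  proof
    fix r
    have "\<alpha> * f r + \<beta> * f' r = (f' s' * f r + (- f s') * f' r) / D"
      by (simp add: \<alpha>_def \<beta>_def diff_divide_distrib)
    then show "e s r = \<alpha> * f r + \<beta> * f' r" unfolding comb using D0 by simp
  qed
  have "x (e s) = (\<lambda>r. \<alpha> * e t r + \<beta> * e t' r)" unfolding es W_lin[OF x(1)] xf ..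
  then have "x (e s) t = \<alpha>" "x (e s) t' = \<beta>" using t by (simp_all add: e_def)
  moreover have "nonneg (x (e s)) \<or> nonneg (\<lambda>r. - x (e s) r)" using root_sign[OF x(1) ss(1)] .
  ultimately have "(\<alpha> \<ge> 0 \<and> \<beta> \<ge> 0) \<or> (\<alpha> \<le> 0 \<and> \<beta> \<le> 0)"
    unfolding nonneg_def by (metis neg_0_le_iff_le)
  moreover have "\<not> (\<alpha> \<le> 0 \<and> \<beta> \<le> 0)"
  proof
    assume "\<alpha> \<le> 0 \<and> \<beta> \<le> 0"
    then have "\<alpha> * f s + \<beta> * f' s \<le> 0" using pos[of s] by (simp add: add_nonpos_nonpos mult_nonpos_nonneg)
    then show False using fun_cong[OF es, of s] by (simp add: e_def[of s])
  qed
  ultimately have ab: "\<alpha> \<ge> 0" "\<beta> \<ge> 0" by auto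
  have "\<alpha> * f s' + \<beta> * f' s' = 0" using fun_cong[OF es, of s'] ss by (simp add: e_def[of s])
  then have "\<alpha> * f s' = 0" using ab pos[of s'] by (simp add: add_nonneg_eq_0_iff)
  then have "f' s' = 0 \<or> f s' = 0" using D0 by (auto simp: \<alpha>_def)
  then show ?thesis
  proof
    assume z: "f' s' = 0"
    have "f' = (\<lambda>r. f' s * e s r)"
    proof
      fix r show "f' r = f' s * e s r" using z out[of r] by (cases "r = s"; cases "r = s'") (auto simp: e_def[of s])
    qed
    then show ?thesis using root_multiple[OF yW tV(2) ss(1), of "f' s"] pos by (auto simp: f'_def)
  next
    assume z: "f s' = 0"
    have "f = (\<lambda>r. f s * e s r)"
    proof
      fix r show "f r = f s * e s r" using z out[of r] by (cases "r = s"; cases "r = s'") (auto simp: e_def[of s])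
    qed
    then show ?thesis using root_multiple[OF yW tV(1) ss(1), of "f s"] pos by (auto simp: f_def)
  qed
qed

abbreviation up :: "'v \<Rightarrow> (('v \<Rightarrow> real) \<Rightarrow> 'v \<Rightarrow> real) \<times> 'k \<Rightarrow> (('v \<Rightarrow> real) \<Rightarrow> 'v \<Rightarrow> real) \<times> 'k" where
  "up \<equiv> \<lambda>s. step (s, True)"

text \<open>A hit in the course of the run would put some \<open>y (e t)\<close> into the plane,
  because the run preserves the plane. So no value is recorded and only the representative
  moves.\<close>

lemma altseq_step_none:
  assumes ss: "s \<in> V" "s' \<in> V" and y: "y \<in> X"
    and none: "\<And>t. t \<in> T \<Longrightarrow> \<not> plane s s' (y (e t))"
  shows "altseq up s s' n (y, g) = (altseq \<sigma> s s' n \<circ> y, g)"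
proof (induction n)
  case (Suc n)
  let ?l = "if even n then s else s'"
  have "\<not> hits (altseq \<sigma> s s' n \<circ> y) ?l"
  proof
    assume "hits (altseq \<sigma> s s' n \<circ> y) ?l"
    then obtain t where t: "t \<in> T" "altseq \<sigma> s s' n (y (e t)) = e ?l" by (auto simp: hits_def)
    then have "plane s s' (altseq \<sigma> s s' n (y (e t)))" using plane_e by auto
    then show False using none t plane_altseq by blast
  qed
  moreover have "altseq \<sigma> s s' (Suc n) \<circ> y = \<sigma> ?l \<circ> (altseq \<sigma> s s' n \<circ> y)" by (auto simp: fun_eq_iff)
  moreover have "altseq up s s' (Suc n) (y, g) = up ?l (altseq up s s' n (y, g))" by simp
  ultimately show ?case by (simp only: Suc.IH step.simps if_False)
qed (auto simp: fun_eq_iff)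

text \<open>Along the run the image of the root \<open>y (e t)\<close> starts positive and ends
  negative, so exactly one letter hits. It records \<open>k t\<close> and leaves the representative
  alone, which amounts to the factor \<open>\<sigma> t\<close> on the right. The result favours
  neither of the two letters.\<close>

lemma altseq_step_one:
  assumes ss: "s \<in> V" "s' \<in> V" "s \<noteq> s'" "m s s' \<noteq> 0" and y: "y \<in> X" and t: "t \<in> T"
    and pl: "plane s s' (y (e t))"
    and uniq: "\<And>t'. t' \<in> T \<Longrightarrow> plane s s' (y (e t')) \<Longrightarrow> t' = t"
  shows "altseq up s s' (m s s') (y, g) = (altseq \<sigma> s s' (m s s') \<circ> y \<circ> \<sigma> t, k t \<otimes> g)"
proof -
  let ?M = "m s s'"
  define L where "L n = (if even n then s else s')" for n :: nat
  define f where "f = y (e t)"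
  define \<beta> where "\<beta> n = altseq \<sigma> s s' n f" for n
  define Y where "Y n = altseq \<sigma> s s' n \<circ> y" for n
  have LV: "L n \<in> V" for n using ss by (simp add: L_def)
  have LS: "L (Suc n) \<noteq> L n" for n using ss by (auto simp: L_def)
  have yW: "y \<in> W" using y by (simp add: X_def)
  have tV: "t \<in> V" using t TV by auto
  have YS: "Y (Suc n) = \<sigma> (L n) \<circ> Y n" for n by (auto simp: Y_def L_def)
  have \<beta>S: "\<beta> (Suc n) = \<sigma> (L n) (\<beta> n)" for n by (auto simp: \<beta>_def L_def)
  have Y\<beta>: "Y n (e t) = \<beta> n" for n by (simp add: Y_def \<beta>_def f_def)
  have Y0: "Y 0 = y" by (auto simp: Y_def fun_eq_iff)
  have YW: "Y n \<in> W" for n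
    by (induction n) (simp_all only: Y0 yW YS W_comp \<sigma>_in_W LV)
  have up: "altseq up s s' (Suc n) z = up (L n) (altseq up s s' n z)" for n z by (simp add: L_def)
  have A0: "A r (\<lambda>_. 0) = 0" for r by (simp add: A_def)
  \<comment> \<open>The root lies in the plane of \<open>s\<close>, \<open>s'\<close>, so the linear
    action has its centre at \<open>0\<close>.\<close>
  have \<xi>: "2 * (0::real) + a s' s * 0 = - (A s f - 2 * f s - a s' s * f s')"
    "2 * (0::real) + a s s' * 0 = - (A s' f - 2 * f s' - a s s' * f s)"
    using A_change[of s s' f "\<lambda>_. 0"] A_change[of s' s f "\<lambda>_. 0"] pl ss by (simp_all add: A0 plane_def f_def)
  obtain u where u0: "u 0 = f s - 0" "u 1 = f s' - 0"
    "\<And>k. u (Suc (Suc k)) = - a s s' * u (Suc k) - u k"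
    "\<And>k. altseq \<sigma> s s' k f (L k) = u k + 0"
    "\<And>k. altseq \<sigma> s s' k f (L (Suc k)) = u (Suc k) + 0"
    by (rule altseq_recurrence[OF ss(1-3) L_def \<xi>]) blast
  have u: "\<And>k. u (Suc (Suc k)) = - a s s' * u (Suc k) - u k"
    "\<And>k. \<beta> k (L k) = u k" "\<And>k. \<beta> k (L (Suc k)) = u (Suc k)"
    using u0 by (simp_all add: \<beta>_def)
  note an = angle[OF ss(4,3)]
  have fnn: "nonneg f" using y t by (simp add: X_def f_def)
  \<comment> \<open>With centre \<open>0\<close> the full run negates the coordinates, up to their
    exchange. A root nonnegative before and after would be zero.\<close>
  have notM: "\<not> nonneg (\<beta> ?M)"
  proof
    assume nn: "nonneg (\<beta> ?M)"
    have "f s = 0" "f s' = 0"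
      using altseq_at_m[OF ss \<xi>] nn fnn unfolding nonneg_def \<beta>_def
      by (smt (verit, best))+
    then have "f = (\<lambda>r. 0 * e t r + 0 * e t r)" using pl by (auto simp: plane_def f_def fun_eq_iff)
    moreover have "y (\<lambda>r. 0 * e t r + 0 * e t r) = (\<lambda>r. 0 * f r + 0 * f r)" using W_lin[OF yW, of 0 "e t" 0 "e t"] by simp
    ultimately have "y (e t) = y (\<lambda>r. 0 * e t r + 0 * e t r)" by (simp add: f_def)
    then have "e t = (\<lambda>r. 0)" using W_inj[OF yW] by fastforce
    then show False by (metis e_def zero_neq_one)
  qed
  \<comment> \<open>\<open>j\<close> numbers the letter that first turns the root negative; before
    that letter the root is the simple root \<open>e (L j)\<close>, so this is the hit.\<close>
  define j where "j = (LEAST n. \<not> nonneg (\<beta> (Suc n)))"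
  have ex: "\<not> nonneg (\<beta> (Suc (?M - 1)))" using notM an(4) by simp
  have j: "\<not> nonneg (\<beta> (Suc j))" "j < ?M"
    unfolding j_def using LeastI[of "\<lambda>n. \<not> nonneg (\<beta> (Suc n))", OF ex]
      Least_le[of "\<lambda>n. \<not> nonneg (\<beta> (Suc n))", OF ex] an(4) by auto
  have jmin: "nonneg (\<beta> (Suc n))" if "n < j" for n
    using not_less_Least[of n "\<lambda>n. \<not> nonneg (\<beta> (Suc n))"] that by (auto simp: j_def)
  have hitY: "t' = t" if "t' \<in> T" "Y n (e t') = e (L n)" for t' n
  proof -
    have "plane s s' (Y n (e t'))" using that plane_e by (auto simp: L_def)
    then show ?thesis using uniq that(1) by (simp add: Y_def plane_altseq)
  qed
  have pre: "altseq up s s' n (y, g) = (Y n, g) \<and> Y n \<in> X" if "n \<le> j" for n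
    using that
  proof (induction n)
    case 0
    then show ?case using y by (auto simp: Y_def comp_def)
  next
    case (Suc n)
    have nh: "\<not> hits (Y n) (L n)"
    proof
      assume "hits (Y n) (L n)"
      then have "Y n (e t) = e (L n)" using hitY by (auto simp: hits_def)
      then have "\<beta> (Suc n) = (\<lambda>r. - e (L n) r)" using Y\<beta> \<beta>S LV \<sigma>_e by simp
      then show False using jmin[of n] Suc.prems by (auto simp: nonneg_def e_def split: if_splits)
    qed
    have IH: "altseq up s s' n (y, g) = (Y n, g)" "Y n \<in> X" using Suc by auto
    show ?case unfolding up IH(1) YS using X_step(1)[OF IH(2) LV nh] nh by (simp only: step.simps if_False)
  qed
  have "hits (Y j) (L j)"
  proof (rule ccontr)
    assume "\<not> hits (Y j) (L j)"
    then have "Y (Suc j) \<in> X" unfolding YS using X_step(1) pre[of j] LV by blast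
    then have "nonneg (Y (Suc j) (e t))" using t by (simp add: X_def)
    then show False using j(1) Y\<beta> by simp
  qed
  then have h: "hits (Y j) (L j)" "Y j (e t) = e (L j)" using hitY by (auto simp: hits_def)
  have hj: "hit (Y j) (L j) = t" using hit_eq[OF YW t h(2)] .
  \<comment> \<open>At the hit, \<open>L j\<close> passes through the representative as
    \<open>t\<close>; hence skipping the letter is the same as applying it and correcting by
    \<open>\<sigma> t\<close> on the right.\<close>
  have Yj: "Y j = Y (Suc j) \<circ> \<sigma> t"
  proof
    fix f
    have "\<sigma> (L j) (Y j f) = Y j (\<sigma> t f)" by (rule reflection_conj[OF YW LV tV h(2)])
    then have "\<sigma> (L j) (Y j (\<sigma> t f)) = Y j f" using LV by (metis \<sigma>_\<sigma>)
    then show "Y j f = (Y (Suc j) \<circ> \<sigma> t) f" by (simp add: YS)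
  qed
  have post: "altseq up s s' n (y, g) = (Y n \<circ> \<sigma> t, k t \<otimes> g)" if "Suc j \<le> n" "n \<le> ?M" for n
    using that
  proof (induction n rule: dec_induct)
    case base
    have "altseq up s s' j (y, g) = (Y j, g)" using pre[of j] by simp
    then show ?case unfolding up Yj[symmetric] using h(1) hj by (simp only: step.simps if_True)
  next
    case (step n)
    have "\<not> hits (Y n \<circ> \<sigma> t) (L n)"
    proof
      assume "hits (Y n \<circ> \<sigma> t) (L n)"
      then obtain t' where t': "t' \<in> T" "Y n (\<sigma> t (e t')) = e (L n)" by (auto simp: hits_def)
      have \<sigma>t: "\<sigma> t (e t') = (\<lambda>r. 1 * e t' r + (- A t (e t')) * e t r)" by (rule ext) (simp add: \<sigma>_def e_def[of t])
      have y\<sigma>: "y (\<sigma> t (e t')) = (\<lambda>r. 1 * y (e t') r + (- A t (e t')) * y (e t) r)"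
        unfolding \<sigma>t by (rule W_lin[OF yW])
      have "plane s s' (Y n (\<sigma> t (e t')))" using t' plane_e by (auto simp: L_def)
      then have "plane s s' (y (\<sigma> t (e t')))" by (simp add: Y_def plane_altseq)
      then have "plane s s' (y (e t'))" using pl unfolding y\<sigma> by (auto simp: plane_def)
      then have "t' = t" using uniq t' by blast
      then have "(\<lambda>r. - \<beta> n r) = e (L n)" using t' tV Y\<beta> W_minus[OF YW] by (simp add: \<sigma>_e)
      then have "- \<beta> n (L (Suc n)) = e (L n) (L (Suc n))" by (rule fun_cong)
      then have un: "u (Suc n) = 0" using LS by (simp add: u e_def[of "L n"])
      \<comment> \<open>The recurrence restarted at the hit, with values \<open>1, 0\<close>. A
        second hit at \<open>n\<close> would make the term number \<open>n - j + 1\<close> vanish,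
        hence also the sine of \<open>(n - j) * pi / m\<close>, although
        \<open>0 < n - j < m\<close>.\<close>
      define w where "w i = u (j + i)" for i
      have "\<beta> j = e (L j)" using h(2) Y\<beta> by simp
      then have w01: "w 0 = 1" "w 1 = 0" using u(2)[of j] u(3)[of j] LS[of j] by (simp_all add: w_def e_def)
      let ?\<theta> = "pi / ?M"
      have "w (Suc (n - j)) * sin ?\<theta> = w 1 * sin (real (Suc (n - j)) * ?\<theta>) - w 0 * sin ((real (Suc (n - j)) - 1) * ?\<theta>)"
        using u(1) unfolding an(2) by (intro two_cos_recurrence) (simp add: w_def)
      moreover have "w (Suc (n - j)) = 0" using un step by (simp add: w_def)
      ultimately have "sin (real (n - j) * ?\<theta>) = 0" using w01 by simp
      moreover have "sin (real (n - j) * ?\<theta>) > 0"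
      proof (rule sin_gt_zero)
        have nj: "n - j > 0" "n - j < ?M" using step by auto
        show "0 < real (n - j) * ?\<theta>" using nj an(4) by (intro mult_pos_pos) auto
        have "real (n - j) * ?\<theta> < real ?M * ?\<theta>"
          using nj by (intro mult_strict_right_mono) auto
        then show "real (n - j) * ?\<theta> < pi" using an(3) by simp
      qed
      ultimately show False by simp
    qed
    then show ?case unfolding up step.IH[OF Suc_leD[OF step.prems]] YS comp_assoc
      by (simp only: step.simps if_False comp_assoc)
  qed
  show ?thesis using post[of ?M] j(2) by (simp add: Y_def)
qed

text \<open>The cosine is injective on \<open>[0, pi]\<close>, so a finite label can be recovered
  from the matrix entry. This carries the braid relation of \<open>s\<close>, \<open>s'\<close> over
  to the letters they hit.\<close>

lemma braid_label:
  assumes "m s s' \<noteq> 0" "s \<noteq> s'" "t \<noteq> t'" "a t t' = a s s'"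
  shows "m t t' = m s s'"
proof -
  note an = angle[OF assms(1,2)]
  have c1: "cos (pi / m s s') \<noteq> 1"
  proof
    assume c: "cos (pi / m s s') = 1"
    have "(sin (pi / m s s'))\<^sup>2 = 0" unfolding sin_squared_eq c by simp
    then show False using an(1) by simp
  qed
  have m0: "m t t' \<noteq> 0"
  proof
    assume "m t t' = 0"
    then show False using assms c1 by (simp add: a_def)
  qed
  note an' = angle[OF m0 assms(3)]
  have "cos (pi / m t t') = cos (pi / m s s')" using an(2) an'(2) assms(4) by simp
  moreover have "0 \<le> pi / m t t'" "pi / m t t' \<le> pi" "0 \<le> pi / m s s'" "pi / m s s' \<le> pi"
    using an(4) an'(4) by (auto simp: field_simps)
  ultimately have "pi / m t t' = pi / m s s'" using cos_inj_pi by blast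
  then show ?thesis using m0 assms(1) by (simp add: field_simps)
qed

text \<open>The cases count the roots \<open>y (e t)\<close> with \<open>t\<close> in
  \<open>T\<close> that lie in the plane of \<open>s\<close>, \<open>s'\<close>. With two of them
  both letters hit throughout, and the relation is the one between the values in \<open>K\<close>.
  With one, a single value is recorded. With none, only the braid relation of the reflections is
  used.\<close>

lemma braid_step:
  assumes ss: "s \<in> V" "s' \<in> V" "s \<noteq> s'" "m s s' \<noteq> 0" and y: "y \<in> X" and g: "g \<in> carrier K"
  shows "altseq up s s' (m s s') (y, g) = altseq up s' s (m s s') (y, g)"
proof (cases "\<exists>t t'. t \<in> T \<and> t' \<in> T \<and> t \<noteq> t' \<and> plane s s' (y (e t)) \<and> plane s s' (y (e t'))")
  case True
  then obtain t0 t0' where t0: "t0 \<in> T" "t0' \<in> T" "t0 \<noteq> t0'" "plane s s' (y (e t0))" "plane s s' (y (e t0'))" by blast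
  have yW: "y \<in> W" using y by (simp add: X_def)
  have "y (e t0) = e s \<or> y (e t0') = e s" using plane_two_roots[OF ss(1-3) y t0] .
  moreover have "y (e t0) = e s' \<or> y (e t0') = e s'"
    using plane_two_roots[OF ss(2,1) ss(3)[symmetric] y t0(1-3)] t0 plane_commute by blast
  moreover have "e s \<noteq> e s'" using e_inj ss by blast
  ultimately obtain t t' where t: "t \<in> T" "t' \<in> T" "t \<noteq> t'" "y (e t) = e s" "y (e t') = e s'"
    using t0 by metis
  have "a t t' = B (e t) (e t')" using t TV by (simp add: subset_iff)
  also have "\<dots> = B (e s) (e s')" using B_W[OF yW, of "e t" "e t'"] t by simp
  finally have "a t t' = a s s'" using ss by simp
  then have mm: "m t t' = m s s'" using braid_label ss t by blast
  have run: "altseq up r r' n (y, g) = (y, altseq (\<lambda>t g. k t \<otimes> g) q q' n g)"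
    if "q \<in> T" "q' \<in> T" "y (e q) = e r" "y (e q') = e r'" for r r' q q' n
  proof (induction n)
    case (Suc n)
    have "hits y r" "hits y r'" "hit y r = q" "hit y r' = q'"
      using that hit_eq[OF yW] by (auto simp: hits_def)
    then show ?case using Suc by auto
  qed auto
  show ?thesis
    unfolding run[OF t(1,2,4,5)] run[OF t(2,1,5,4)] using braid_k[OF t(1-3) _ g] mm ss(4) by simp
next
  case False
  show ?thesis
  proof (cases "\<exists>t\<in>T. plane s s' (y (e t))")
    case True
    then obtain t where t: "t \<in> T" "plane s s' (y (e t))" by blast
    have uniq: "\<And>t'. t' \<in> T \<Longrightarrow> plane s s' (y (e t')) \<Longrightarrow> t' = t" using False t by blast
    have 1: "altseq up s s' (m s s') (y, g) = (altseq \<sigma> s s' (m s s') \<circ> y \<circ> \<sigma> t, k t \<otimes> g)"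
      by (rule altseq_step_one[OF ss y t uniq])
    have 2: "altseq up s' s (m s' s) (y, g) = (altseq \<sigma> s' s (m s' s) \<circ> y \<circ> \<sigma> t, k t \<otimes> g)"
      using ss t uniq m_sym plane_commute y by (intro altseq_step_one) metis+
    have "altseq \<sigma> s s' (m s s') = altseq \<sigma> s' s (m s s')" using braid_\<sigma>[OF ss] by blast
    then show ?thesis using 1 2 m_sym[of s s'] by simp
  next
    case False
    then have "altseq up s s' (m s s') (y, g) = (altseq \<sigma> s s' (m s s') \<circ> y, g)"
      "altseq up s' s (m s s') (y, g) = (altseq \<sigma> s' s (m s s') \<circ> y, g)"
      using altseq_step_none ss y plane_commute by blast+
    moreover have "altseq \<sigma> s s' (m s s') = altseq \<sigma> s' s (m s s')" using braid_\<sigma>[OF ss] by blast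
    ultimately show ?thesis by simp
  qed
qed

lemma foldr_step_pres_eq:
  assumes "pres_eq V R v w" "z \<in> X \<times> carrier K"
    and R: "\<And>r r'. (r, r') \<in> R \<Longrightarrow> \<exists>s t. s \<in> V \<and> t \<in> V \<and> s \<noteq> t \<and> m s t \<noteq> 0 \<and>
      r = alternating (m s t) s t \<and> r' = alternating (m s t) t s"
  shows "foldr step v z = foldr step w z"
proof (rule pres_eq_foldr[OF assms(1,2)])
  fix r r' z assume r: "(r, r') \<in> R" and z: "z \<in> X \<times> carrier K"
  obtain s t where st: "s \<in> V" "t \<in> V" "s \<noteq> t" "m s t \<noteq> 0"
      "r = alternating (m s t) s t" "r' = alternating (m s t) t s" using R[OF r] by blast
  have "altseq up s t (m s t) z = altseq up t s (m s t) z" using braid_step[OF st(1-4)] z by auto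
  then show "foldr step r z = foldr step r' z"
    unfolding altseq_eq_foldr[of step] st(5,6) by (cases "odd (m s t)") simp_all
qed (use step_closed step_cancel in auto)

text \<open>Over the base coset every letter of \<open>T\<close> hits itself. So the second entry
  reads off the value in \<open>K\<close> of a word in \<open>T\<close>, and by the previous
  invariance this depends only on its class in the large group.\<close>

lemma foldr_step_word:
  assumes "w \<in> gwords T" "g \<in> carrier K"
  shows "foldr step w (id, g) = (id, wev K k w \<otimes> g)"
  using assms(1)
proof (induction w)
  case (Cons c w)
  obtain s b where c: "c = (s, b)" by force
  have s: "s \<in> T" "w \<in> gwords T" using Cons.prems c by auto
  have "hits id s" "hit id s = s" using s hit_eq[of id s s] by (auto simp: hits_def)
  moreover have "wev K k w \<in> carrier K" using s k_closed by (intro wev_closed[of k T]) auto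
  ultimately show ?case using s assms(2) k_closed[of s]
    by (simp only: c foldr.simps comp_apply Cons.IH[OF s(2)] step.simps if_True wev.simps)
      (simp add: m_assoc id_def)
qed (use assms in auto)

text \<open>Values are multiplied on the left, so the action commutes with right multiplication on
  the second entry.\<close>

lemma foldr_step_right:
  assumes "w \<in> gwords V" "(y, g) \<in> X \<times> carrier K" "h \<in> carrier K"
  shows "foldr step w (y, g \<otimes> h) = (fst (foldr step w (y, g)), snd (foldr step w (y, g)) \<otimes> h)"
  using assms(1)
proof (induction w)
  case (Cons c w)
  obtain s b where c: "c = (s, b)" by force
  have s: "s \<in> V" "w \<in> gwords V" using Cons.prems c by auto
  obtain y' g' where yg: "foldr step w (y, g) = (y', g')" by force
  have "(y', g') \<in> X \<times> carrier K"
    unfolding yg[symmetric] using foldr_closed[OF s(2) assms(2), of step] step_closed by blast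
  then have "g' \<in> carrier K" "hits y' s \<Longrightarrow> k (hit y' s) \<in> carrier K" using hitsD k_closed by auto
  then show ?case using Cons.IH s c yg assms(3) by (auto simp: m_assoc)
qed simp

lemma id_in_X: "id \<in> X" by (auto simp: X_def nonneg_def e_def)

lemma \<sigma>_comp_neq: "y \<in> W \<Longrightarrow> s \<in> V \<Longrightarrow> \<sigma> s \<circ> y \<noteq> y"
proof
  assume y: "y \<in> W" and s: "s \<in> V" and eq: "\<sigma> s \<circ> y = y"
  obtain x where x: "y \<circ> x = id" using W_inverse[OF y] by auto
  have "\<sigma> s (e s) = e s" using fun_cong[OF eq, of "x (e s)"] fun_cong[OF x, of "e s"] by simp
  then have "- e s s = e s s" using s \<sigma>_e by metis
  then show False by (simp add: e_def)
qed

end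

section \<open>Groups acting on trees\<close>

text \<open>The vertex set of a tree, seen through its distance: the four-point condition is
  0-hyperbolicity and \<open>interpolation\<close> provides geodesics. \<open>d_parity\<close>
  expresses bipartiteness and makes \<open>gp\<close> even; \<open>d_even\<close> says that the two
  classes are preserved, so there are no inversions and a displacement has a midpoint.\<close>

locale tree_action = set_action +
  fixes d :: "'c \<Rightarrow> 'c \<Rightarrow> int"
  assumes d_zero: "x \<in> Z \<Longrightarrow> y \<in> Z \<Longrightarrow> d x y = 0 \<longleftrightarrow> x = y"
    and d_sym: "d x y = d y x"
    and four_point: "x \<in> Z \<Longrightarrow> y \<in> Z \<Longrightarrow> z \<in> Z \<Longrightarrow> w \<in> Z \<Longrightarrow>
      d x y + d z w \<le> max (d x z + d y w) (d x w + d y z)"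
    and interpolation: "x \<in> Z \<Longrightarrow> y \<in> Z \<Longrightarrow> 0 \<le> k \<Longrightarrow> k \<le> d x y \<Longrightarrow>
      \<exists>z\<in>Z. d x z = k \<and> d z y = d x y - k"
    and d_parity: "x \<in> Z \<Longrightarrow> y \<in> Z \<Longrightarrow> z \<in> Z \<Longrightarrow> even (d x y + d y z + d x z)"
    and d_act: "g \<in> carrier G \<Longrightarrow> x \<in> Z \<Longrightarrow> y \<in> Z \<Longrightarrow> d (act g x) (act g y) = d x y"
    and d_even: "g \<in> carrier G \<Longrightarrow> x \<in> Z \<Longrightarrow> even (d x (act g x))"
begin

lemma d_self [simp]: "x \<in> Z \<Longrightarrow> d x x = 0" by (simp add: d_zero)

lemma triangle: "x \<in> Z \<Longrightarrow> y \<in> Z \<Longrightarrow> z \<in> Z \<Longrightarrow> d x z \<le> d x y + d y z"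
  using four_point[of x z y y] d_sym[of z y] by auto

lemma d_nonneg: "x \<in> Z \<Longrightarrow> y \<in> Z \<Longrightarrow> 0 \<le> d x y"
  using triangle[of x y x] d_sym[of y x] by auto

text \<open>Twice the Gromov product of \<open>x\<close> and \<open>y\<close> at \<open>w\<close>.\<close>

definition gp :: "'c \<Rightarrow> 'c \<Rightarrow> 'c \<Rightarrow> int" where "gp x y w = d x w + d y w - d x y"

lemma gp_sym: "gp x y w = gp y x w" by (simp add: gp_def d_sym)

lemma gp_ultra: "x \<in> Z \<Longrightarrow> y \<in> Z \<Longrightarrow> z \<in> Z \<Longrightarrow> w \<in> Z \<Longrightarrow> gp x y w \<ge> k \<Longrightarrow> gp y z w \<ge> k \<Longrightarrow> gp x z w \<ge> k"
  using four_point[of x z y w] d_sym[of z y] d_sym[of z w] by (auto simp: gp_def)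

lemma gp_even: "x \<in> Z \<Longrightarrow> y \<in> Z \<Longrightarrow> w \<in> Z \<Longrightarrow> even (gp x y w)"
  using d_parity[of x y w] unfolding gp_def by presburger

lemma gp_le: "x \<in> Z \<Longrightarrow> y \<in> Z \<Longrightarrow> w \<in> Z \<Longrightarrow> gp x y w \<le> 2 * d w y \<and> gp x y w \<le> 2 * d w x"
  using triangle[of x y w] triangle[of y x w] d_sym[of y x] d_sym[of w y] d_sym[of w x] by (simp add: gp_def)

lemma gp_between: "d x p = k \<Longrightarrow> d p y = d x y - k \<Longrightarrow> gp p y x = 2 * k"
  using d_sym[of p x] d_sym[of y x] by (simp add: gp_def)

text \<open>Geodesics from \<open>x\<close> to \<open>y\<close> and to \<open>z\<close> agree along
  a length of half the value of \<open>gp y z x\<close>; the points at distance \<open>k\<close> on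
  them coincide within this common part.\<close>

lemma point_unique:
  assumes Z: "x \<in> Z" "y \<in> Z" "z \<in> Z" "p \<in> Z" "q \<in> Z"
    and "d x p = k" "d p y = d x y - k" "d x q = k" "d q z = d x z - k" "gp y z x \<ge> 2 * k"
  shows "p = q"
proof -
  have "gp p y x = 2 * k" "gp z q x = 2 * k" using gp_between assms gp_sym by metis+
  then have "gp p q x \<ge> 2 * k" using gp_ultra[of p y z x "2 * k"] gp_ultra[of p z q x "2 * k"] assms by simp
  then have "d p q \<le> 0" using assms d_sym[of p x] d_sym[of q x] by (simp add: gp_def)
  then show ?thesis using d_nonneg[of p q] d_zero Z by force
qed

lemma fix_between:
  assumes "g \<in> carrier G" "x \<in> Z" "z \<in> Z" "p \<in> Z" "act g x = x" "act g z = z" "d x p = k" "d p z = d x z - k"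
  shows "act g p = p"
proof (rule point_unique[of x z z _ _ k])
  show "d x (act g p) = k" using d_act[of g x p] assms by simp
  show "d (act g p) z = d x z - k" using d_act[of g p z] assms by simp
  show "2 * k \<le> gp z z x" using assms d_nonneg[of p z] d_sym[of x z] by (simp add: gp_def)
qed (use assms in auto)

lemma act_int_pow_add:
  fixes i j :: int
  assumes "h \<in> carrier G" "z \<in> Z"
  shows "act (h [^] (i + j)) z = act (h [^] i) (act (h [^] j) z)"
  using assms by (simp add: int_pow_mult act_mult)

lemma act_int_pow_neg: "h \<in> carrier G \<Longrightarrow> z \<in> Z \<Longrightarrow> act (h [^] (i::int)) (act (h [^] (- i)) z) = z"
  using act_int_pow_add[of h z i "- i"] by simp

lemma d_int_pow:
  fixes i j :: int
  assumes "h \<in> carrier G" "z \<in> Z" "y \<in> Z"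
  shows "d (act (h [^] i) z) (act (h [^] j) y) = d z (act (h [^] (j - i)) y)"
proof -
  have "act (h [^] j) y = act (h [^] i) (act (h [^] (j - i)) y)"
    using act_int_pow_add[of h y i "j - i"] assms by simp
  then show ?thesis using assms by (simp add: d_act)
qed

text \<open>A point belongs to the branch of \<open>s\<close> if its path from \<open>x\<close>
  agrees with the path to \<open>s\<close> up to the point \<open>p s\<close> at distance
  \<open>K\<close>. No nontrivial power of \<open>a\<close> fixes \<open>p s\<close>, so each
  \<open>p s\<close> reaches each \<open>p s'\<close> by at most one exponent. Multiples of a large
  \<open>M\<close> avoid all of these finitely many exponents and therefore leave the union of the
  branches.\<close>

lemma elliptic_displaces:
  assumes a: "a \<in> carrier G" and x: "x \<in> Z" "act a x = x" and S: "finite S" "S \<subseteq> Z" and K: "0 \<le> K"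
    and nofix: "\<And>z s n. z \<in> Z \<Longrightarrow> s \<in> S \<Longrightarrow> n \<ge> 1 \<Longrightarrow> act (a [^] (n::nat)) z = z \<Longrightarrow> gp z s x < 2 * K"
  shows "\<exists>M::nat. M \<ge> 1 \<and> (\<forall>i::int. i \<noteq> 0 \<longrightarrow> (\<forall>y\<in>Z. \<forall>s\<in>S. \<forall>s'\<in>S.
    gp y s x \<ge> 2 * K \<longrightarrow> \<not> gp (act (a [^] (int M * i)) y) s' x \<ge> 2 * K))"
proof -
  define S' where "S' = {s \<in> S. K \<le> d x s}"
  have "\<forall>s\<in>S'. \<exists>p\<in>Z. d x p = K \<and> d p s = d x s - K"
    using interpolation x S K by (auto simp: S'_def)
  then obtain p where p: "\<And>s. s \<in> S' \<Longrightarrow> p s \<in> Z \<and> d x (p s) = K \<and> d (p s) s = d x s - K" by metis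
  define bad where "bad s s' = {i::int. act (a [^] i) (p s) = p s'}" for s s'
  have fixx: "act (a [^] (i::int)) x = x" for i
  proof -
    have n: "act (a [^] (n::nat)) x = x" for n
      by (induction n) (simp_all add: a x act_mult)
    show ?thesis
    proof (cases i rule: int_cases2)
      case (nonneg n)
      then show ?thesis using n by (simp add: int_pow_int)
    next
      case (nonpos n)
      then show ?thesis using n[of n] act_int_pow_neg[of a x "- int n"] a x by (simp add: int_pow_int)
    qed
  qed
  \<comment> \<open>Two exponents carrying \<open>p s\<close> to the same point would differ by a
    power that fixes \<open>p s\<close>; that point lies in the branch of \<open>s\<close>, which
    \<open>nofix\<close> excludes.\<close>
  have le: "i' \<le> i" if "s \<in> S'" "i \<in> bad s s'" "i' \<in> bad s s'" for s s' i i'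
  proof (rule ccontr)
    assume "\<not> i' \<le> i"
    then obtain n where n: "i' = i + int n" "n \<ge> 1" by (metis nle_le zle_iff_zadd not_one_le_zero add.right_neutral of_nat_0 less_one linorder_not_le)
    have ps: "p s \<in> Z" using p that by blast
    have "act (a [^] i) (act (a [^] int n) (p s)) = act (a [^] i) (p s)"
      using that n act_int_pow_add[of a "p s" i "int n"] a ps by (simp add: bad_def)
    then have "act (a [^] int n) (p s) = p s"
      using a ps by (metis act_closed act_inv_act int_pow_closed)
    then have "gp (p s) s x < 2 * K" using nofix[OF ps, of s n] n that by (simp add: int_pow_int S'_def)
    then show False using gp_between[of x "p s" K s] p that by auto
  qed
  have "finite (bad s s')" if "s \<in> S'" for s s'
  proof (cases "bad s s' = {}")
    case False
    then obtain i where "i \<in> bad s s'" by blast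
    then have "bad s s' \<subseteq> {i}" using le[OF that, of _ s'] by (intro subsetI) (simp add: order_antisym)
    then show ?thesis by (rule finite_subset) simp
  qed simp
  then have fin: "finite (\<Union>s\<in>S'. \<Union>s'\<in>S'. bad s s')" using S by (auto simp: S'_def)
  \<comment> \<open>Larger than the absolute value of every bad exponent, so a nonzero multiple of
    \<open>M\<close> is never bad.\<close>
  define M where "M = nat (Max (insert 0 (abs ` (\<Union>s\<in>S'. \<Union>s'\<in>S'. bad s s')))) + 1"
  have bound: "\<bar>i\<bar> < int M" if "s \<in> S'" "s' \<in> S'" "i \<in> bad s s'" for s s' i
  proof -
    have "\<bar>i\<bar> \<le> Max (insert 0 (abs ` (\<Union>s\<in>S'. \<Union>s'\<in>S'. bad s s')))"
      using fin that by (intro Max_ge) auto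
    then show ?thesis unfolding M_def of_nat_add by linarith
  qed
  have "\<not> gp (act (a [^] (int M * i)) y) s' x \<ge> 2 * K"
    if i: "i \<noteq> 0" and y: "y \<in> Z" and s: "s \<in> S" "s' \<in> S" and g: "gp y s x \<ge> 2 * K" for i :: int and y s s'
  proof
    let ?g = "a [^] (int M * i)"
    assume g': "gp (act ?g y) s' x \<ge> 2 * K"
    have gc: "?g \<in> carrier G" using a by simp
    have sZ: "s \<in> Z" "s' \<in> Z" using s S by auto
    have S's: "s \<in> S'" "s' \<in> S'" "K \<le> d x y"
      using gp_le[OF y sZ(1) x(1)] gp_le[OF act_closed[OF gc y] sZ(2) x(1)] g g' s by (auto simp: S'_def)
    obtain q where q: "q \<in> Z" "d x q = K" "d q y = d x y - K" using interpolation x y K S's by blast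
    have "q = p s" using q p[OF S's(1)] g x y sZ by (intro point_unique[of x y s _ _ K]) auto
    moreover have "act ?g q = p s'"
    proof (rule point_unique[of x "act ?g y" s' _ _ K])
      show "d x (act ?g q) = K" using d_act[OF gc x(1) q(1)] q fixx by simp
      have "d x (act ?g y) = d x y" using d_act[OF gc x(1) y] fixx by simp
      then show "d (act ?g q) (act ?g y) = d x (act ?g y) - K" using d_act[OF gc q(1) y] q by simp
    qed (use p[OF S's(2)] g' x y sZ q gc in auto)
    ultimately have "int M * i \<in> bad s s'" by (simp add: bad_def)
    then have "\<bar>int M * i\<bar> < int M" using bound S's by blast
    moreover have "int M * 1 \<le> int M * \<bar>i\<bar>" using i by (intro mult_left_mono) auto
    ultimately show False by (simp add: abs_mult)
  qed
  then show ?thesis by (intro exI[of _ M]) (auto simp: M_def)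
qed

lemma int_pow_nat_pow: "a \<in> carrier G \<Longrightarrow> (a [^] (n::nat)) [^] (i::int) = a [^] (int n * i)"
  by (simp add: int_pow_pow flip: int_pow_int)

lemma ping_pong_set:
  assumes c: "x \<in> carrier G" "y \<in> carrier G" and D: "D \<subseteq> Z" "D \<noteq> {}" "D \<noteq> Z"
    and 1: "\<And>(i::int) z. i \<noteq> 0 \<Longrightarrow> z \<in> D \<Longrightarrow> act (x [^] i) z \<notin> D"
    and 2: "\<And>(i::int) z. i \<noteq> 0 \<Longrightarrow> z \<in> Z \<Longrightarrow> z \<notin> D \<Longrightarrow> act (y [^] i) z \<in> D"
  shows "free_pair G x y"
proof (rule ping_pong[OF c, where S = "\<lambda>p. if p then D else Z - D"])
  fix p :: bool and n :: int and z assume n: "n \<noteq> 0" and z: "z \<in> (if p then D else Z - D)"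
  show "act (pr x y p [^] n) z \<in> (if \<not> p then D else Z - D)"
  proof (cases p)
    case True
    have "act (x [^] n) z \<in> Z" using c z True D by (intro act_closed) auto
    then show ?thesis using 1[OF n] z True by simp
  next
    case False
    then show ?thesis using 2[OF n] z by simp
  qed
qed (use D in auto)

text \<open>Since the alternative allows passing to powers, the fixed points of all positive powers
  are considered at once; the exponent may depend on the point.\<close>

definition Fix_power :: "'a \<Rightarrow> 'c set" where
  "Fix_power a = {z \<in> Z. \<exists>n::nat. n \<ge> 1 \<and> act (a [^] n) z = z}"

lemma fix_pow_mult:
  assumes "a \<in> carrier G" "z \<in> Z" "act (a [^] (n::nat)) z = z"
  shows "act (a [^] (n * k)) z = z"
proof (induction k)
  case (Suc k)
  have "a [^] (n * Suc k) = a [^] n \<otimes> a [^] (n * k)" using assms by (simp add: nat_pow_mult)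
  then show ?case using Suc assms by (simp add: act_mult)
qed (use assms in simp)

text \<open>Take \<open>u\<close> and \<open>v\<close> realising the distance between the two sets.
  The branch at \<open>u\<close> towards \<open>v\<close> then contains no point fixed by a power of
  \<open>a\<close>, and symmetrically at \<open>v\<close>, so suitable powers of \<open>a\<close>
  and \<open>b\<close> play ping-pong with this branch and its complement.\<close>

lemma elliptic_elliptic:
  assumes c: "a \<in> carrier G" "b \<in> carrier G" and ne: "Fix_power a \<noteq> {}" "Fix_power b \<noteq> {}"
    and disj: "Fix_power a \<inter> Fix_power b = {}"
  shows "pair_alternative G a b"
proof -
  define Q where "Q n \<longleftrightarrow> (\<exists>u\<in>Fix_power a. \<exists>v\<in>Fix_power b. nat (d u v) = n)" for n
  have "\<exists>n. Q n" using ne by (auto simp: Q_def)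
  then have "Q (LEAST n. Q n)" by (rule LeastI_ex)
  then obtain u v where uv: "u \<in> Fix_power a" "v \<in> Fix_power b" "nat (d u v) = (LEAST n. Q n)" by (auto simp: Q_def)
  have FZ: "Fix_power g \<subseteq> Z" for g by (auto simp: Fix_power_def)
  have uvZ: "u \<in> Z" "v \<in> Z" using uv FZ by auto
  have min: "d u v \<le> d u' v'" if "u' \<in> Fix_power a" "v' \<in> Fix_power b" for u' v'
  proof -
    have "(LEAST n. Q n) \<le> nat (d u' v')" using that by (intro Least_le) (auto simp: Q_def)
    then show ?thesis using uv(3) d_nonneg[of u' v'] that FZ by force
  qed
  have duv: "d u v \<ge> 1" using disj uv d_zero[OF uvZ] d_nonneg[OF uvZ] by (metis Int_iff empty_iff int_one_le_iff_zero_less order_le_less)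
  obtain na nb :: nat where nab: "na \<ge> 1" "act (a [^] na) u = u" "nb \<ge> 1" "act (b [^] nb) v = v"
    using uv by (auto simp: Fix_power_def)
  define n where "n = na * nb"
  have fixu: "act (a [^] n) u = u" using fix_pow_mult[OF c(1) uvZ(1) nab(2), of nb] by (simp add: n_def)
  have fixv: "act (b [^] n) v = v" using fix_pow_mult[OF c(2) uvZ(2) nab(4), of na] by (simp add: n_def mult.commute)
  have n1: "n \<ge> 1" using nab by (simp add: n_def Suc_leI)
  \<comment> \<open>If a power fixes \<open>p\<close> and a point \<open>z\<close> in the branch of
    \<open>q\<close>, it also fixes the first vertex of the common path, which is closer to
    \<open>q\<close> than \<open>p\<close> is.\<close>
  have near: "gp z q p < 2 * 1"
    if H: "g \<in> carrier G" "p \<in> Z" "q \<in> Z" "act (g [^] n) p = p" "z \<in> Z" "k \<ge> 1" "act ((g [^] n) [^] (k::nat)) z = z"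
      and dpq: "d p q \<ge> 1" and minq: "\<And>p'. p' \<in> Fix_power g \<Longrightarrow> d p q \<le> d p' q" for g p q z k
  proof (rule ccontr)
    assume "\<not> gp z q p < 2 * 1"
    then have g2: "gp z q p \<ge> 2 * 1" by simp
    have gk: "(g [^] n) [^] k = g [^] (n * k)" using H by (simp add: nat_pow_pow)
    have "1 \<le> d p z" using gp_le[of z q p] g2 H by simp
    then obtain r where r: "r \<in> Z" "d p r = 1" "d r z = d p z - 1" using interpolation[of p z 1] H by auto
    obtain r' where r': "r' \<in> Z" "d p r' = 1" "d r' q = d p q - 1" using interpolation[of p q 1] H dpq by auto
    have rr: "r = r'" using r r' g2 H by (intro point_unique[of p z q r r' 1]) auto
    have "act (g [^] (n * k)) r = r"
      using H r fix_pow_mult[of g p n k] by (intro fix_between[of _ p z r 1]) (auto simp: gk)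
    then have "r \<in> Fix_power g" using r n1 H by (auto simp: Fix_power_def intro!: exI[of _ "n * k"])
    then show False using minq r' rr by fastforce
  qed
  have "\<exists>M::nat. M \<ge> 1 \<and> (\<forall>i::int. i \<noteq> 0 \<longrightarrow> (\<forall>y\<in>Z. \<forall>s\<in>{v}. \<forall>s'\<in>{v}.
    gp y s u \<ge> 2 * 1 \<longrightarrow> \<not> gp (act ((a [^] n) [^] (int M * i)) y) s' u \<ge> 2 * 1))"
    using c uvZ fixu near[OF c(1) uvZ fixu] duv min uv(2) by (intro elliptic_displaces) auto
  then obtain M1 :: nat where M1: "M1 \<ge> 1" "\<And>i y. i \<noteq> 0 \<Longrightarrow> y \<in> Z \<Longrightarrow> gp y v u \<ge> 2 \<Longrightarrow>
      \<not> gp (act ((a [^] n) [^] (int M1 * i)) y) v u \<ge> 2" by auto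
  have min': "d v u \<le> d p' u" if "p' \<in> Fix_power b" for p'
    using min[OF uv(1) that] d_sym[of v u] d_sym[of p' u] by simp
  have dvu: "d v u \<ge> 1" using duv d_sym[of v u] by simp
  have "\<exists>M::nat. M \<ge> 1 \<and> (\<forall>i::int. i \<noteq> 0 \<longrightarrow> (\<forall>y\<in>Z. \<forall>s\<in>{u}. \<forall>s'\<in>{u}.
    gp y s v \<ge> 2 * 1 \<longrightarrow> \<not> gp (act ((b [^] n) [^] (int M * i)) y) s' v \<ge> 2 * 1))"
    using c uvZ fixv near[OF c(2) uvZ(2,1) fixv _ _ _ dvu min'] by (intro elliptic_displaces) auto
  then obtain M2 :: nat where M2: "M2 \<ge> 1" "\<And>i y. i \<noteq> 0 \<Longrightarrow> y \<in> Z \<Longrightarrow> gp y u v \<ge> 2 \<Longrightarrow>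
      \<not> gp (act ((b [^] n) [^] (int M2 * i)) y) u v \<ge> 2" by auto
  \<comment> \<open>The products \<open>gp y v u\<close> and \<open>gp y u v\<close> add up to
    \<open>2 * d u v\<close>, which is at least 2. As both are even, one that is below 2 is at most
    0, so the other reaches 2.\<close>
  have compl: "gp y u v \<ge> 2" if "y \<in> Z" "\<not> gp y v u \<ge> 2" for y
  proof -
    have "gp y v u \<le> 0" using gp_even[OF that(1) uvZ(2,1)] that by presburger
    then show ?thesis using duv d_sym[of u v] by (simp add: gp_def)
  qed
  have compl': "gp y v u \<ge> 2" if "y \<in> Z" "\<not> gp y u v \<ge> 2" for y
    using compl that by blast
  define N where "N = n * M1 * M2"
  define D where "D = {y \<in> Z. gp y v u \<ge> 2}"
  have "free_pair G (a [^] N) (b [^] N)"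
  proof (rule ping_pong_set[where D = D])
    show "D \<noteq> {}" using duv uvZ d_sym[of u v] by (auto simp: D_def gp_def intro!: exI[of _ v])
    have "u \<notin> D" using uvZ d_sym[of u v] by (simp add: D_def gp_def)
    then show "D \<noteq> Z" using uvZ by auto
    fix i :: int and z assume i: "i \<noteq> 0"
    have e: "(a [^] N) [^] i = (a [^] n) [^] (int M1 * (int M2 * i))"
      "(b [^] N) [^] i = (b [^] n) [^] (int M2 * (int M1 * i))"
      using c by (simp_all add: int_pow_nat_pow N_def algebra_simps)
    show "act ((a [^] N) [^] i) z \<notin> D" if "z \<in> D" unfolding e using that M1(2)[of "int M2 * i" z] i M2(1) by (auto simp: D_def)
    assume z: "z \<in> Z" "z \<notin> D"
    have "\<not> gp (act ((b [^] n) [^] (int M2 * (int M1 * i))) z) u v \<ge> 2"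
      using M2(2)[of "int M1 * i" z] i M1(1) z compl[of z] by (auto simp: D_def)
    moreover have "act ((b [^] n) [^] (int M2 * (int M1 * i))) z \<in> Z" using c z by simp
    ultimately show "act ((b [^] N) [^] i) z \<in> D" unfolding e D_def using compl' by auto
  qed (use c in \<open>auto simp: D_def\<close>)
  then show ?thesis using c n1 M1(1) M2(1) by (intro free_pair_imp_alternative[of a b N]) (auto simp: N_def Suc_leI)
qed

end

section \<open>Hyperbolic elements and their axes\<close>

context tree_action begin

text \<open>Choose \<open>c\<close> with minimal displacement \<open>l\<close>. If the path from
  \<open>c\<close> through \<open>act h c\<close> to its next translate turned back, the midpoint of
  the first piece would be displaced by less than \<open>l\<close>. So the path is straight at every
  translate of \<open>c\<close>, and straight pieces with overlap add up.\<close>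

lemma translation_length:
  assumes h: "h \<in> carrier G" and nofix: "\<And>z. z \<in> Z \<Longrightarrow> act h z \<noteq> z" and ne: "Z \<noteq> {}"
  obtains c l where "c \<in> Z" "l \<ge> 1" "\<And>n::nat. d c (act (h [^] n) c) = int n * l"
proof -
  define Q where "Q n \<longleftrightarrow> (\<exists>c\<in>Z. nat (d c (act h c)) = n)" for n
  have "\<exists>n. Q n" using ne by (auto simp: Q_def)
  then have "Q (LEAST n. Q n)" by (rule LeastI_ex)
  then obtain c where c: "c \<in> Z" "nat (d c (act h c)) = (LEAST n. Q n)" by (auto simp: Q_def)
  define l where "l = d c (act h c)"
  have min: "l \<le> d x (act h x)" if "x \<in> Z" for x
  proof -
    have "(LEAST n. Q n) \<le> nat (d x (act h x))" using that by (intro Least_le) (auto simp: Q_def)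
    then show ?thesis using c d_nonneg[of x "act h x"] that h by (simp add: l_def)
  qed
  have hc: "act h c \<in> Z" "act h (act h c) \<in> Z" using c h by auto
  have l1: "l \<ge> 1" using d_zero[OF c(1) hc(1)] nofix[OF c(1)] d_nonneg[OF c(1) hc(1)] by (auto simp: l_def)
  \<comment> \<open>Displacements are even by \<open>d_even\<close>, so the midpoint is a
    vertex.\<close>
  obtain k where k: "l = 2 * k" using d_even[OF h c(1)] by (auto simp: l_def)
  obtain p where p: "p \<in> Z" "d c p = k" "d p (act h c) = k"
    using interpolation[OF c(1) hc(1), of k] k l1 by (auto simp: l_def)
  have hp: "act h p \<in> Z" "d (act h c) (act h p) = k" "d (act h p) (act h (act h c)) = k"
    using p c hc h by (auto simp: d_act)
  have dh: "d (act h c) (act h (act h c)) = l" using d_act[OF h c(1) hc(1)] by (simp add: l_def)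
  have d2: "d c (act h (act h c)) = 2 * l"
  proof (rule ccontr)
    assume "d c (act h (act h c)) \<noteq> 2 * l"
    moreover have "d c (act h (act h c)) \<le> 2 * l" using triangle[OF c(1) hc] dh by (simp add: l_def)
    ultimately have g1: "gp c (act h (act h c)) (act h c) \<ge> 1"
      using dh d_sym[of "act h (act h c)" "act h c"] by (simp add: gp_def l_def)
    have "gp p c (act h c) \<ge> 1" using p d_sym[of p c] l1 by (simp add: gp_def flip: l_def)
    then have "gp p (act h (act h c)) (act h c) \<ge> 1" using gp_ultra[OF p(1) c(1) hc(2) hc(1)] g1 by simp
    moreover have "gp (act h (act h c)) (act h p) (act h c) \<ge> 1"
      using hp dh d_sym[of "act h p" "act h c"] d_sym[of "act h (act h c)" "act h c"]
        d_sym[of "act h p" "act h (act h c)"] l1 k by (simp add: gp_def)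
    ultimately have "gp p (act h p) (act h c) \<ge> 1" using gp_ultra[OF p(1) hc(2) hp(1) hc(1)] by simp
    then have "d p (act h p) < l" using p hp k d_sym[of "act h p" "act h c"] by (simp add: gp_def)
    then show False using min[OF p(1)] by simp
  qed
  have pw: "act (h [^] n) c \<in> Z" for n :: nat using h c by simp
  have S: "act (h [^] Suc n) c = act (h [^] n) (act h c)" for n :: nat using h c by (simp add: act_mult)
  have step: "d (act (h [^] n) c) (act (h [^] Suc n) c) = l" for n :: nat
    unfolding S using h c hc d_act[of "h [^] n" c "act h c"] by (simp add: l_def)
  have step2: "d (act (h [^] n) c) (act (h [^] Suc (Suc n)) c) = 2 * l" for n :: nat
  proof -
    have "act (h [^] Suc (Suc n)) c = act (h [^] n) (act h (act h c))" using h c by (simp add: act_mult)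
    then show ?thesis using h c hc d2 d_act[of "h [^] n" c "act h (act h c)"] by simp
  qed
  \<comment> \<open>Two consecutive distances are carried along because the four-point condition
    compares four vertices of the orbit; the known distance \<open>2 * l\<close> across two steps
    forces the remaining one to be maximal.\<close>
  have "d c (act (h [^] n) c) = int n * l \<and> d c (act (h [^] Suc n) c) = int (Suc n) * l" for n :: nat
  proof (induction n)
    case 0
    then show ?case using h c by (simp add: l_def)
  next
    case (Suc n)
    have "d c (act (h [^] Suc n) c) + d (act (h [^] n) c) (act (h [^] Suc (Suc n)) c)
      \<le> max (d c (act (h [^] n) c) + d (act (h [^] Suc n) c) (act (h [^] Suc (Suc n)) c))
          (d c (act (h [^] Suc (Suc n)) c) + d (act (h [^] Suc n) c) (act (h [^] n) c))"
      by (rule four_point[OF c(1) pw pw pw])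
    then have "int (Suc n) * l + 2 * l \<le> max (int n * l + l) (d c (act (h [^] Suc (Suc n)) c) + l)"
      using Suc step step2 d_sym[of "act (h [^] Suc n) c" "act (h [^] n) c"] by metis
    then have "int (Suc (Suc n)) * l \<le> d c (act (h [^] Suc (Suc n)) c)" using l1 by (auto simp: algebra_simps)
    moreover have "d c (act (h [^] Suc (Suc n)) c) \<le> int (Suc (Suc n)) * l"
      using triangle[OF c(1) pw[of "Suc n"] pw[of "Suc (Suc n)"]] Suc step[of "Suc n"] by (simp add: algebra_simps)
    ultimately show ?case using Suc by simp
  qed
  then show ?thesis using that[OF c(1) l1] by blast
qed

definition axis :: "'a \<Rightarrow> (int \<Rightarrow> 'c) \<Rightarrow> int \<Rightarrow> bool" where
  "axis h \<beta> l \<longleftrightarrow> l \<ge> 1 \<and> (\<forall>i. \<beta> i \<in> Z) \<and> (\<forall>i j. d (\<beta> i) (\<beta> j) = \<bar>i - j\<bar>) \<and> (\<forall>i. act h (\<beta> i) = \<beta> (i + l))"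

text \<open>Translates of a geodesic from \<open>c\<close> to \<open>act h c\<close> are
  concatenated. The curve moves by at most one per step, and far orbit points have the largest
  distance compatible with this, so every part of the curve is geodesic.\<close>

lemma axis_exists:
  assumes h: "h \<in> carrier G" and nofix: "\<And>z. z \<in> Z \<Longrightarrow> act h z \<noteq> z" and ne: "Z \<noteq> {}"
  obtains \<beta> l where "axis h \<beta> l"
proof -
  obtain c l where c: "c \<in> Z" "l \<ge> 1" and dn: "\<And>n::nat. d c (act (h [^] n) c) = int n * l"
    using translation_length[OF assms] by blast
  have hc: "act h c \<in> Z" "d c (act h c) = l" using dn[of 1] h c by auto
  have "\<exists>z\<in>Z. d c z = k \<and> d z (act h c) = l - k" if "0 \<le> k" "k \<le> l" for k
    using interpolation[OF c(1) hc(1)] hc that by auto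
  then obtain p where p: "\<And>k. 0 \<le> k \<Longrightarrow> k \<le> l \<Longrightarrow> p k \<in> Z \<and> d c (p k) = k \<and> d (p k) (act h c) = l - k" by metis
  have p0: "p 0 = c" using p[of 0] c d_zero[of c "p 0"] by simp
  have pl: "p l = act h c" using p[of l] c hc d_zero[of "p l" "act h c"] by simp
  have pp: "d (p k) (p (k + 1)) \<le> 1" if k: "0 \<le> k" "k + 1 \<le> l" for k
  proof -
    have a: "gp (p k) (act h c) c = 2 * k" "gp (p (k + 1)) (act h c) c = 2 * (k + 1)"
      using p[of k] p[of "k + 1"] k hc gp_between[of c "p k" k "act h c"]
        gp_between[of c "p (k + 1)" "k + 1" "act h c"] by simp_all
    have pk: "p k \<in> Z" "p (k + 1) \<in> Z" using p[of k] p[of "k + 1"] k by auto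
    have "gp (p k) (p (k + 1)) c \<ge> 2 * k"
      by (rule gp_ultra[OF pk(1) hc(1) pk(2) c(1)]) (simp_all add: a gp_sym[of "act h c" "p (k + 1)" c])
    then show ?thesis using p[of k] p[of "k + 1"] k d_sym[of c "p k"] d_sym[of c "p (k + 1)"] by (simp add: gp_def)
  qed
  define \<beta> where "\<beta> i = act (h [^] (i div l)) (p (i mod l))" for i
  have m: "0 \<le> i mod l" "i mod l \<le> l" "i mod l < l" for i :: int using c by (simp_all add: less_imp_le)
  have \<beta>Z: "\<beta> i \<in> Z" for i using p[OF m(1,2)] h by (simp add: \<beta>_def)
  have shift: "act h (\<beta> i) = \<beta> (i + l)" for i
  proof -
    have "(i + l) div l = 1 + i div l" "(i + l) mod l = i mod l"
      using div_add_self2[of l i] mod_add_self2[of i l] c(2) by linarith+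
    then show ?thesis using p[OF m(1,2), of i] h act_int_pow_add[of h "p (i mod l)" 1 "i div l"] by (simp add: \<beta>_def)
  qed
  have one: "d (\<beta> i) (\<beta> (i + 1)) \<le> 1" for i
  proof (cases "i mod l + 1 < l")
    case True
    moreover have "i + 1 = l * (i div l) + (i mod l + 1)" by simp
    ultimately have "(i + 1) mod l = i mod l + 1" "(i + 1) div l = i div l"
      using m(1)[of i] int_mod_pos_eq[of "i + 1" l "i div l" "i mod l + 1"]
        int_div_pos_eq[of "i + 1" l "i div l" "i mod l + 1"] by simp_all
    then show ?thesis unfolding \<beta>_def
      using pp[of "i mod l"] p[of "i mod l"] p[of "i mod l + 1"] m[of i] True h by (simp add: d_act)
  next
    case False
    then have e: "i mod l = l - 1" using m(3)[of i] by simp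
    have "l * (i div l) + i mod l = i" by simp
    then have "i + 1 = l * (i div l) + l * 1" using e by linarith
    then have "i + 1 = l * (i div l + 1) + 0" by (simp only: distrib_left add_0_right)
    then have "(i + 1) mod l = 0" "(i + 1) div l = i div l + 1"
      using c(2) int_mod_pos_eq[of "i + 1" l "i div l + 1" 0] int_div_pos_eq[of "i + 1" l "i div l + 1" 0] by simp_all
    then have "\<beta> (i + 1) = act (h [^] (i div l)) (act h c)"
      using p0 h c act_int_pow_add[of h c "i div l" 1] by (simp add: \<beta>_def)
    moreover have "\<beta> i = act (h [^] (i div l)) (p (l - 1))" by (simp add: \<beta>_def e)
    ultimately show ?thesis using p[of "l - 1"] h hc c by (simp add: d_act)
  qed
  have upper: "d (\<beta> i) (\<beta> (i + int n)) \<le> int n" for i n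
  proof (induction n)
    case (Suc n)
    then show ?case using triangle[OF \<beta>Z \<beta>Z \<beta>Z, of i "i + int (Suc n)" "i + int n"] one[of "i + int n"]
      by (simp add: algebra_simps)
  qed (simp add: \<beta>Z)
  have upper': "d (\<beta> i) (\<beta> j) \<le> j - i" if "i \<le> j" for i j
    using upper[of i "nat (j - i)"] that by simp
  have \<beta>m: "\<beta> (n * l) = act (h [^] n) c" for n using c p0 by (simp add: \<beta>_def)
  \<comment> \<open>\<open>n\<close> is chosen so large that \<open>i\<close> and \<open>j\<close>
    lie between the orbit points with parameters \<open>- n * l\<close> and \<open>n * l\<close>,
    whose distance is known; the outer pieces are bounded from above.\<close>
  have lower: "d (\<beta> i) (\<beta> j) \<ge> j - i" if "i \<le> j" for i j
  proof -
    define n where "n = nat (\<bar>i\<bar> + \<bar>j\<bar>)"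
    have "int n * 1 \<le> int n * l" using c by (intro mult_left_mono) auto
    then have n: "- (int n * l) \<le> i" "j \<le> int n * l" by (auto simp: n_def)
    have "d (\<beta> (- int n * l)) (\<beta> (int n * l)) = d c (act (h [^] (int n + int n)) c)"
      unfolding \<beta>m using d_int_pow[OF h c(1) c(1), of "- int n" "int n"] by simp
    also have "\<dots> = 2 * (int n * l)" using dn[of "n + n"] by (simp add: int_pow_int algebra_simps flip: of_nat_add)
    finally have "2 * (int n * l) \<le> d (\<beta> (- int n * l)) (\<beta> i) + d (\<beta> i) (\<beta> j) + d (\<beta> j) (\<beta> (int n * l))"
      using triangle[OF \<beta>Z \<beta>Z \<beta>Z, of "- int n * l" "int n * l" i] triangle[OF \<beta>Z \<beta>Z \<beta>Z, of i "int n * l" j] by simp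
    then show ?thesis using upper'[of "- int n * l" i] upper'[of j "int n * l"] n by simp
  qed
  have "d (\<beta> i) (\<beta> j) = \<bar>i - j\<bar>" for i j
    using upper'[of i j] lower[of i j] upper'[of j i] lower[of j i] d_sym[of "\<beta> i" "\<beta> j"] by linarith
  then have "axis h \<beta> l" using c \<beta>Z shift by (simp add: axis_def)
  then show ?thesis using that by blast
qed

lemma axis_pow:
  assumes h: "h \<in> carrier G" and ax: "axis h \<beta> l"
  shows "act (h [^] (n::int)) (\<beta> i) = \<beta> (i + n * l)"
proof -
  have Z: "\<beta> i \<in> Z" for i using ax by (simp add: axis_def)
  have nat: "act (h [^] (n::nat)) (\<beta> i) = \<beta> (i + int n * l)" for n i
  proof (induction n arbitrary: i)
    case (Suc n)
    then show ?case using h Z ax by (simp add: act_mult axis_def algebra_simps)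
  qed (use Z in simp)
  show ?thesis
  proof (cases n rule: int_cases2)
    case (nonneg k)
    then show ?thesis using nat by (simp add: int_pow_int)
  next
    case (nonpos k)
    have "act (h [^] n) (act (h [^] (- n)) (\<beta> (i + n * l))) = \<beta> (i + n * l)"
      using act_int_pow_neg h Z by blast
    moreover have "act (h [^] (- n)) (\<beta> (i + n * l)) = \<beta> i"
      using nat[of k "i + n * l"] nonpos by (simp add: int_pow_int)
    ultimately show ?thesis by simp
  qed
qed

lemma axis_inv:
  assumes h: "h \<in> carrier G" and ax: "axis h \<beta> l"
  shows "axis (inv h) (\<lambda>i. \<beta> (- i)) l"
proof -
  have "act (inv h) (\<beta> (- i)) = \<beta> (- (i + l))" for i
    using axis_pow[OF h ax, of "- 1" "- i"] h by (simp add: int_pow_neg)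
  then show ?thesis using ax by (auto simp: axis_def)
qed

lemma axis_growth:
  assumes h: "h \<in> carrier G" and ax: "axis h \<beta> l" and x: "x \<in> Z"
  shows "\<bar>n\<bar> * l - 2 * d x (\<beta> 0) \<le> d x (act (h [^] (n::int)) x)"
    and "d x (act (h [^] n) x) \<le> \<bar>n\<bar> * l + 2 * d x (\<beta> 0)"
proof -
  have Z: "\<beta> i \<in> Z" for i using ax by (simp add: axis_def)
  have hx: "act (h [^] n) x \<in> Z" using h x by simp
  have e: "d (\<beta> 0) (\<beta> (n * l)) = \<bar>n\<bar> * l" using ax by (simp add: axis_def abs_mult)
  have f: "d (act (h [^] n) x) (\<beta> (n * l)) = d x (\<beta> 0)"
    using d_act[of "h [^] n" x "\<beta> 0"] axis_pow[OF h ax, of n 0] h x Z by simp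
  show "\<bar>n\<bar> * l - 2 * d x (\<beta> 0) \<le> d x (act (h [^] n) x)"
    using triangle[OF Z x Z, of 0 "n * l"] triangle[OF x hx Z, of "n * l"] e f d_sym[of "\<beta> 0" x] by simp
  show "d x (act (h [^] n) x) \<le> \<bar>n\<bar> * l + 2 * d x (\<beta> 0)"
    using triangle[OF x Z hx, of 0] triangle[OF Z Z hx, of 0 "n * l"] e f d_sym[of "\<beta> (n * l)" "act (h [^] n) x"] by simp
qed

text \<open>The difference \<open>d x (\<beta> n) - n\<close> is bounded below, so it has a least
  value; from there on the triangle inequality keeps it constant. The ray beyond that point prolongs
  the geodesic from \<open>x\<close>.\<close>

lemma axis_tail:
  assumes ax: "axis h \<beta> l" and x: "x \<in> Z"
  obtains i0 where "\<And>i. i \<ge> i0 \<Longrightarrow> d x (\<beta> i) = d x (\<beta> i0) + (i - i0)"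
proof -
  have Z: "\<beta> i \<in> Z" for i using ax by (simp add: axis_def)
  have dd: "d (\<beta> i) (\<beta> j) = \<bar>i - j\<bar>" for i j using ax by (simp add: axis_def)
  define f where "f n = nat (d x (\<beta> (int n)) - int n + d x (\<beta> 0))" for n
  have pos: "d x (\<beta> (int n)) - int n + d x (\<beta> 0) \<ge> 0" for n
    using triangle[OF Z x Z, of 0 "int n"] dd[of 0 "int n"] d_sym[of "\<beta> 0" x] by simp
  obtain n0 where n0: "\<And>n. f n0 \<le> f n" using ex_has_least_nat[of "\<lambda>_. True" 0 f] by auto
  have "d x (\<beta> i) = d x (\<beta> (int n0)) + (i - int n0)" if ii: "i \<ge> int n0" for i
  proof -
    define n where "n = nat i"
    have n: "i = int n" using ii by (simp add: n_def)
    have "d x (\<beta> (int n0)) - int n0 \<le> d x (\<beta> (int n)) - int n"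
      using n0[of n] pos[of n] pos[of n0] by (simp add: f_def)
    moreover have "d x (\<beta> i) \<le> d x (\<beta> (int n0)) + (i - int n0)"
      using triangle[OF x Z Z, of i "int n0"] dd[of "int n0" i] ii by simp
    ultimately show ?thesis using n by simp
  qed
  then show ?thesis using that by blast
qed

text \<open>A point \<open>z\<close> with a large Gromov product against the forward orbit of
  \<open>h\<close> is reached from \<open>x\<close> along the axis, so the path passes through the
  prescribed \<open>\<beta> i\<close>.\<close>

lemma axis_reach:
  assumes h: "h \<in> carrier G" and ax: "axis h \<beta> l" and x: "x \<in> Z"
    and tail: "\<And>i. i \<ge> i0 \<Longrightarrow> d x (\<beta> i) = d x (\<beta> i0) + (i - i0)"
    and far: "\<And>K. \<exists>z\<in>Z. P z \<and> (\<exists>j\<ge>0. gp z (act (h [^] (j::int)) x) x \<ge> 2 * K)"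
    and i: "i \<ge> i0"
  shows "\<exists>z\<in>Z. P z \<and> d (\<beta> i) z = d x z - d x (\<beta> i)"
proof -
  have Z: "\<beta> i \<in> Z" for i using ax by (simp add: axis_def)
  have dd: "d (\<beta> i) (\<beta> j) = \<bar>i - j\<bar>" for i j using ax by (simp add: axis_def)
  define k C where "k = d x (\<beta> i)" and "C = d x (\<beta> 0)"
  have nn: "k \<ge> 0" "C \<ge> 0" using d_nonneg x Z by (auto simp: k_def C_def)
  \<comment> \<open>The summand \<open>\<bar>i\<bar>\<close> ensures \<open>i \<le> j * l\<close>;
    the summand \<open>2 * C\<close> pays for replacing the orbit point by the axis point
    \<open>\<beta> (j * l)\<close> at distance \<open>C\<close>.\<close>
  obtain z j where z: "z \<in> Z" "P z" "j \<ge> 0" "gp z (act (h [^] (j::int)) x) x \<ge> 2 * (k + \<bar>i\<bar> + 2 * C)"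
    using far by blast
  have hx: "act (h [^] j) x \<in> Z" using h x by simp
  have f: "d (act (h [^] j) x) (\<beta> (j * l)) = C"
    using d_act[of "h [^] j" x "\<beta> 0"] axis_pow[OF h ax, of j 0] h x Z by (simp add: C_def)
  have "gp z (act (h [^] j) x) x \<le> 2 * (j * l + 2 * C)"
    using gp_le[OF z(1) hx x] axis_growth(2)[OF h ax x, of j] z(3) by (simp add: C_def)
  then have ij: "i \<le> j * l" using z(4) nn by simp
  have "gp z (act (h [^] j) x) x \<le> gp z (\<beta> (j * l)) x + 2 * C"
    using triangle[OF z(1) hx Z, of "j * l"] triangle[OF hx Z x, of "j * l"] f by (simp add: gp_def)
  then have g: "gp z (\<beta> (j * l)) x \<ge> 2 * k" using z(4) nn by simp
  have "k \<le> d x z" using gp_le[OF z(1) Z x, of "j * l"] g by simp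
  then obtain q where q: "q \<in> Z" "d x q = k" "d q z = d x z - k" using interpolation[OF x z(1) nn(1)] by blast
  have "\<beta> i = q"
  proof (rule point_unique[of x "\<beta> (j * l)" z _ _ k])
    show "d (\<beta> i) (\<beta> (j * l)) = d x (\<beta> (j * l)) - k"
      using tail[OF i] tail[of "j * l"] ij i dd by (simp add: k_def)
  qed (use x Z z q g gp_sym in \<open>auto simp: k_def\<close>)
  then show ?thesis using q z by (auto simp: k_def)
qed

text \<open>If \<open>y\<close> stays away from the direction of \<open>h^(-j) x\<close>, its image
  under \<open>h^j\<close> must follow the direction of \<open>h^j x\<close>. This yields the moves
  of a hyperbolic element in ping-pong.\<close>

lemma gp_translate:
  fixes j :: int
  assumes h: "h \<in> carrier G" and Z: "x \<in> Z" "y \<in> Z"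
  shows "gp (act (h [^] j) y) (act (h [^] j) x) x + gp y (act (h [^] (- j)) x) x = 2 * d x (act (h [^] j) x)"
proof -
  have "d (act (h [^] j) y) x = d y (act (h [^] (- j)) x)"
    using d_int_pow[OF h Z(2,1), of j 0] Z by simp
  moreover have "d (act (h [^] j) x) x = d x (act (h [^] (- j)) x)"
    using d_int_pow[OF h Z(1,1), of j 0] Z by simp
  moreover have "d (act (h [^] j) y) (act (h [^] j) x) = d y x" using h Z by (simp add: d_act)
  ultimately show ?thesis
    using d_sym[of x "act (h [^] j) x"] d_sym[of "act (h [^] (- j)) x" x] by (simp add: gp_def)
qed

text \<open>Let \<open>D\<close> consist of the points whose path from \<open>x\<close> follows a
  far orbit point of \<open>h\<close> up to distance \<open>K\<close>. By \<open>bd\<close> no point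
  fixed by a power of \<open>a\<close> is among them, so suitable powers of \<open>a\<close> throw
  \<open>D\<close> off itself, while large powers of \<open>h\<close> throw the complement into
  \<open>D\<close>.\<close>

lemma elliptic_hyperbolic_free:
  assumes c: "a \<in> carrier G" "h \<in> carrier G" and x: "x \<in> Z" "act a x = x" and ax: "axis h \<beta> l" and K: "K \<ge> 1"
    and bd: "\<And>z n j. z \<in> Z \<Longrightarrow> n \<ge> 1 \<Longrightarrow> act (a [^] (n::nat)) z = z \<Longrightarrow> gp z (act (h [^] (j::int)) x) x < 2 * K"
  shows "pair_alternative G a h"
proof -
  define C where "C = d x (\<beta> 0)"
  have C0: "C \<ge> 0" using ax d_nonneg x by (auto simp: C_def axis_def)
  have l1: "l \<ge> 1" using ax by (simp add: axis_def)
  \<comment> \<open>Comparing two orbit points of one end involves three estimates with error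
    \<open>2 * C\<close>; the sum \<open>6 * C\<close> is absorbed by twice \<open>3 * C\<close>,
    and \<open>4 * K\<close> is left.\<close>
  define N where "N = nat (2 * K + 3 * C)"
  have N: "int N = 2 * K + 3 * C" "N \<ge> 1" using K C0 by (auto simp: N_def)
  have hx: "act (h [^] (j::int)) x \<in> Z" for j using c x by simp
  have big: "d x (act (h [^] j) x) \<ge> 2 * K" if "\<bar>j\<bar> \<ge> int N" for j :: int
  proof -
    have "\<bar>j\<bar> * 1 \<le> \<bar>j\<bar> * l" using l1 by (intro mult_left_mono) auto
    then show ?thesis using axis_growth(1)[OF c(2) ax x(1), of j] that N C0 by (simp add: C_def)
  qed
  have same: "gp (act (h [^] (e * int N)) x) (act (h [^] (e * j)) x) x \<ge> 2 * K"
    if "j \<ge> int N" "e = 1 \<or> e = - 1" for e j :: int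
  proof -
    have "d (act (h [^] (e * int N)) x) (act (h [^] (e * j)) x) = d x (act (h [^] (e * (j - int N))) x)"
      using d_int_pow[OF c(2) x(1) x(1), of "e * int N" "e * j"] by (simp add: algebra_simps)
    moreover have "int N * 1 \<le> int N * l" using l1 by (intro mult_left_mono) auto
    moreover have "\<bar>e * n\<bar> = n" if "n \<ge> 0" for n using that \<open>e = 1 \<or> e = - 1\<close> by auto
    then have "d x (act (h [^] (e * int N)) x) \<ge> int N * l - 2 * C" "d x (act (h [^] (e * j)) x) \<ge> j * l - 2 * C"
      "d x (act (h [^] (e * (j - int N))) x) \<le> (j - int N) * l + 2 * C"
      using axis_growth[OF c(2) ax x(1)] that(1) unfolding C_def
      by (smt (verit, best) of_nat_0_le_iff)+
    ultimately show ?thesis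
      using d_sym[of "act (h [^] (e * int N)) x" x] d_sym[of "act (h [^] (e * j)) x" x] N(1) C0 K
      unfolding gp_def left_diff_distrib by linarith
  qed
  \<comment> \<open>Two points suffice, one for each end: by \<open>same\<close>, every further
    orbit point lies in the branch of one of them. This supplies the finite set for
    \<open>elliptic_displaces\<close>.\<close>
  define S where "S = {act (h [^] int N) x, act (h [^] (- int N)) x}"
  have near: "\<exists>s\<in>S. gp s (act (h [^] j) x) x \<ge> 2 * K" if "\<bar>j\<bar> \<ge> int N" for j :: int
  proof (cases "j \<ge> 0")
    case True
    then show ?thesis using same[of j 1] that by (simp add: S_def)
  next
    case False
    then show ?thesis using same[of "- j" "- 1"] that by (simp add: S_def)
  qed
  have SZ: "S \<subseteq> Z" using hx by (auto simp: S_def)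
  have "\<exists>M::nat. M \<ge> 1 \<and> (\<forall>i::int. i \<noteq> 0 \<longrightarrow> (\<forall>y\<in>Z. \<forall>s\<in>S. \<forall>s'\<in>S.
    gp y s x \<ge> 2 * K \<longrightarrow> \<not> gp (act (a [^] (int M * i)) y) s' x \<ge> 2 * K))"
    using c x SZ K bd by (intro elliptic_displaces) (auto simp: S_def)
  then obtain M :: nat where M: "M \<ge> 1" "\<And>i y s s'. i \<noteq> 0 \<Longrightarrow> y \<in> Z \<Longrightarrow> s \<in> S \<Longrightarrow> s' \<in> S \<Longrightarrow> gp y s x \<ge> 2 * K \<Longrightarrow>
      \<not> gp (act (a [^] (int M * i)) y) s' x \<ge> 2 * K" by blast
  define D where "D = {y \<in> Z. \<exists>s\<in>S. gp y s x \<ge> 2 * K}"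
  have DI: "y \<in> D" if yj: "y \<in> Z" "\<bar>j\<bar> \<ge> int N" "gp y (act (h [^] j) x) x \<ge> 2 * K" for y and j :: int
  proof -
    obtain s where s: "s \<in> S" "gp s (act (h [^] j) x) x \<ge> 2 * K" using near[OF yj(2)] by blast
    then have "gp y s x \<ge> 2 * K" using yj gp_ultra[of y "act (h [^] j) x" s x] gp_sym[of s] hx x SZ by auto
    then show ?thesis using s yj by (auto simp: D_def)
  qed
  have "free_pair G (a [^] (M * N)) (h [^] (M * N))"
  proof (rule ping_pong_set[where D = D])
    have "act (h [^] int N) x \<in> D" using big[of "int N"] hx K x d_sym[of x]
      by (intro DI[of _ "int N"]) (auto simp: gp_def)
    then show "D \<noteq> {}" by auto
    have "gp x s x < 2 * K" if "s \<in> S" for s using that SZ x K d_sym[of x s] by (auto simp: gp_def)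
    then have "x \<notin> D" by (auto simp: D_def linorder_not_le[symmetric])
    then show "D \<noteq> Z" using x by auto
    fix i :: int and z assume i: "i \<noteq> 0"
    have e: "(a [^] (M * N)) [^] i = a [^] (int M * (int N * i))" "(h [^] (M * N)) [^] i = h [^] (int N * int M * i)"
      using c by (simp_all add: int_pow_nat_pow algebra_simps)
    show "act ((a [^] (M * N)) [^] i) z \<notin> D" if "z \<in> D"
      unfolding e using that M(2)[of "int N * i" z] i N(2) by (auto simp: D_def)
    assume z: "z \<in> Z" "z \<notin> D"
    let ?j = "int N * int M * i"
    have "int M * i \<noteq> 0" using i M(1) by simp
    then have "\<bar>int M * i\<bar> \<ge> 1" by linarith
    then have "int N * 1 \<le> int N * \<bar>int M * i\<bar>" by (intro mult_left_mono) auto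
    then have j: "\<bar>?j\<bar> \<ge> int N" by (simp add: abs_mult mult.assoc)
    have "\<not> gp z (act (h [^] (- ?j)) x) x \<ge> 2 * K" using DI[OF z(1), of "- ?j"] j z(2) by auto
    then have "gp (act (h [^] ?j) z) (act (h [^] ?j) x) x \<ge> 2 * K"
      using gp_translate[OF c(2) x(1) z(1), of ?j] big[OF j] by linarith
    then show "act ((h [^] (M * N)) [^] i) z \<in> D" unfolding e using DI[OF _ j] c z by simp
  qed (use c in \<open>auto simp: D_def\<close>)
  then show ?thesis using c M(1) N(2) by (intro free_pair_imp_alternative[of a h "M * N"]) (auto simp: Suc_leI)
qed

text \<open>The sets \<open>U p\<close> of points following an orbit point of one element up to
  distance \<open>K\<close> are disjoint by the bound. A large power of one element carries
  everything outside its own set into it, in particular the set of the other element.\<close>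

lemma hyperbolic_hyperbolic_free:
  assumes c: "g \<in> carrier G" "h \<in> carrier G" and x: "x \<in> Z" and ax: "axis g \<alpha> l" "axis h \<beta> l'" and K: "K \<ge> 1"
    and bd: "\<And>i j. gp (act (g [^] (i::int)) x) (act (h [^] (j::int)) x) x < 2 * K"
  shows "pair_alternative G g h"
proof -
  define f where "f p = (if p then g else h)" for p
  have fc: "f p \<in> carrier G" for p using c by (simp add: f_def)
  have fx: "act (f p [^] (j::int)) x \<in> Z" for p j using fc x by simp
  have ex: "\<exists>N::nat. \<forall>j::int. \<bar>j\<bar> \<ge> int N \<longrightarrow> d x (act (f p [^] j) x) \<ge> 2 * K" for p
  proof -
    obtain \<gamma> m where ga: "axis (f p) \<gamma> m" using ax by (cases p) (auto simp: f_def)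
    have C0: "d x (\<gamma> 0) \<ge> 0" using ga d_nonneg x by (auto simp: axis_def)
    have m1: "m \<ge> 1" using ga by (simp add: axis_def)
    have "d x (act (f p [^] j) x) \<ge> 2 * K" if "\<bar>j\<bar> \<ge> int (nat (2 * K + 2 * d x (\<gamma> 0)))" for j :: int
    proof -
      have "\<bar>j\<bar> * 1 \<le> \<bar>j\<bar> * m" using m1 by (intro mult_left_mono) auto
      then show ?thesis using axis_growth(1)[OF fc ga x, of j] that C0 K by simp
    qed
    then show ?thesis by blast
  qed
  then obtain N :: "bool \<Rightarrow> nat" where N: "\<And>p j. \<bar>j\<bar> \<ge> int (N p) \<Longrightarrow> d x (act (f p [^] (j::int)) x) \<ge> 2 * K" by metis
  define n where "n = N True + N False + 1"
  define U where "U p = {y \<in> Z. \<exists>j::int. gp y (act (f p [^] j) x) x \<ge> 2 * K}" for p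
  have disj: "U True \<inter> U False = {}"
  proof -
    have False if "y \<in> Z" "gp y (act (g [^] i) x) x \<ge> 2 * K" "gp y (act (h [^] j) x) x \<ge> 2 * K" for y and i j :: int
      using that bd[of i j] gp_ultra[of "act (g [^] i) x" y "act (h [^] j) x" x "2 * K"] gp_sym[of y "act (g [^] i) x" x] x fx[of True i] fx[of False j]
      by (simp add: f_def)
    then show ?thesis by (auto simp: U_def f_def)
  qed
  have "free_pair G (g [^] n) (h [^] n)"
  proof (rule ping_pong[where S = "\<lambda>p. U (\<not> p)"])
    show "U (\<not> True) \<inter> U (\<not> False) = {}" using disj by auto
    show "U (\<not> p) \<noteq> {}" for p
    proof -
      have "act (f (\<not> p) [^] int (N (\<not> p))) x \<in> U (\<not> p)"
        unfolding U_def using N[of "\<not> p" "int (N (\<not> p))"] fx[of "\<not> p" "int (N (\<not> p))"] K d_sym[of x]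
        by (auto simp: gp_def intro!: exI[of _ "int (N (\<not> p))"])
      then show ?thesis by auto
    qed
    show "U (\<not> p) \<subseteq> Z" for p by (auto simp: U_def)
    fix p and i :: int and z assume i: "i \<noteq> 0" and z: "z \<in> U (\<not> p)"
    have zZ: "z \<in> Z" using z by (auto simp: U_def)
    let ?j = "int n * i"
    have e: "(if p then g [^] n else h [^] n) [^] i = f p [^] ?j"
      using c by (auto simp: int_pow_nat_pow f_def)
    have "int n * 1 \<le> int n * \<bar>i\<bar>" using i by (intro mult_left_mono) auto
    moreover have "int (N p) \<le> int n" by (cases p) (simp_all add: n_def)
    ultimately have j: "\<bar>?j\<bar> \<ge> int (N p)" by (simp add: abs_mult)
    have "z \<notin> U p" using disj z by (cases p) auto
    then have "gp z (act (f p [^] (- ?j)) x) x < 2 * K" using zZ by (auto simp: U_def linorder_not_le[symmetric])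
    then have "gp (act (f p [^] ?j) z) (act (f p [^] ?j) x) x \<ge> 2 * K"
      using gp_translate[OF fc x zZ, of p ?j] N[OF j] by linarith
    then show "act ((if p then g [^] n else h [^] n) [^] i) z \<in> U (\<not> \<not> p)"
      unfolding e using fc zZ by (auto simp: U_def)
  qed (use c in auto)
  then show ?thesis using c by (intro free_pair_imp_alternative[of g h n]) (auto simp: n_def)
qed

text \<open>\<open>axis_reach\<close> is used twice: far points of \<open>\<beta>\<close> lie on
  paths from \<open>x\<close> to the orbit of \<open>g\<close>, and therefore far points of
  \<open>\<alpha>\<close> lie on paths from \<open>x\<close> to points of \<open>\<beta>\<close>.
  Points of one geodesic from \<open>x\<close> are determined by their distance from
  \<open>x\<close>.\<close>

lemma hyperbolic_hyperbolic_common_ray: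
  assumes c: "g \<in> carrier G" "h \<in> carrier G" and x: "x \<in> Z" and ax: "axis g \<alpha> l" "axis h \<beta> l'"
    and unb: "\<And>K. \<exists>i\<ge>0. \<exists>j\<ge>0. gp (act (g [^] (i::int)) x) (act (h [^] (j::int)) x) x \<ge> 2 * K"
  obtains r k where "\<And>i. i \<ge> r \<Longrightarrow> \<alpha> i = \<beta> (i + k)"
proof -
  have Z: "\<alpha> i \<in> Z" "\<beta> i \<in> Z" for i using ax by (auto simp: axis_def)
  have dd: "d (\<beta> i) (\<beta> j) = \<bar>i - j\<bar>" for i j using ax by (simp add: axis_def)
  obtain r0 where r0: "\<And>i. i \<ge> r0 \<Longrightarrow> d x (\<alpha> i) = d x (\<alpha> r0) + (i - r0)" using axis_tail[OF ax(1) x] by blast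
  obtain i0 where i0: "\<And>i. i \<ge> i0 \<Longrightarrow> d x (\<beta> i) = d x (\<beta> i0) + (i - i0)" using axis_tail[OF ax(2) x] by blast
  have 1: "\<exists>z\<in>Z. (\<exists>i\<ge>0. z = act (g [^] (i::int)) x) \<and> d (\<beta> i') z = d x z - d x (\<beta> i')" if "i' \<ge> i0" for i'
    using unb c x by (intro axis_reach[OF c(2) ax(2) x i0 _ that]) (auto, metis act_closed int_pow_closed)
  have 2: "\<exists>z\<in>Z. (\<exists>i\<ge>i0. z = \<beta> i) \<and> d (\<alpha> i') z = d x z - d x (\<alpha> i')" if "i' \<ge> r0" for i'
  proof (rule axis_reach[OF c(1) ax(1) x r0 _ that])
    fix K
    define i where "i = max i0 (i0 + K)"
    have i: "i \<ge> i0" by (simp add: i_def)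
    obtain z j where z: "j \<ge> 0" "z \<in> Z" "z = act (g [^] (j::int)) x" "d (\<beta> i) z = d x z - d x (\<beta> i)" using 1[OF i] by blast
    have "gp (\<beta> i) z x = 2 * d x (\<beta> i)" using gp_between z by blast
    moreover have "d x (\<beta> i) \<ge> K" using i0[OF i] d_nonneg[OF x Z(2), of i0] by (simp add: i_def)
    ultimately show "\<exists>z\<in>Z. (\<exists>i\<ge>i0. z = \<beta> i) \<and> (\<exists>j\<ge>0. gp z (act (g [^] (j::int)) x) x \<ge> 2 * K)"
      using Z i z by (intro bexI[of _ "\<beta> i"]) auto
  qed
  \<comment> \<open>The shift for which \<open>\<alpha> i\<close> and \<open>\<beta> (i + k)\<close>
    are equally far from \<open>x\<close>.\<close>
  define k where "k = i0 - d x (\<beta> i0) + d x (\<alpha> r0) - r0"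
  define r where "r = max r0 (i0 - k)"
  have "\<alpha> i = \<beta> (i + k)" if i: "i \<ge> r" for i
  proof -
    have ir: "i \<ge> r0" "i + k \<ge> i0" using i by (auto simp: r_def)
    obtain i' where i': "i' \<ge> i0" "d (\<alpha> i) (\<beta> i') = d x (\<beta> i') - d x (\<alpha> i)" using 2[OF ir(1)] by blast
    have eq: "d x (\<beta> (i + k)) = d x (\<alpha> i)" using i0[OF ir(2)] r0[OF ir(1)] by (simp add: k_def)
    moreover have "d x (\<alpha> i) \<le> d x (\<beta> i')" using i'(2) d_nonneg[OF Z(1,2), of i i'] by simp
    ultimately have "i + k \<le> i'" using i0[OF ir(2)] i0[OF i'(1)] by simp
    then have "d (\<beta> (i + k)) (\<beta> i') = d x (\<beta> i') - d x (\<alpha> i)"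
      using dd i0[OF ir(2)] i0[OF i'(1)] eq by simp
    then show ?thesis using i' eq x Z d_nonneg[OF Z(1,2), of i i'] d_sym[of x "\<beta> i'"]
      by (intro point_unique[of x "\<beta> i'" "\<beta> i'" _ _ "d x (\<alpha> i)"]) (auto simp: gp_def)
  qed
  then show ?thesis using that by blast
qed

end

section \<open>Elements that move along a common ray\<close>

lemma all_ge_shift: "(\<forall>i\<ge>K + b. Q i) \<longleftrightarrow> (\<forall>i\<ge>K. Q (i + b))" for K b :: nat
proof (intro iffI allI impI)
  fix i assume "\<forall>i\<ge>K. Q (i + b)" "K + b \<le> i"
  then have "Q (i - b + b)" using le_diff_conv2[of b i K] by (metis add_leD2)
  then show "Q i" using \<open>K + b \<le> i\<close> by simp
qed simp

text \<open>The facts about parabolic subgroups which the tree argument consumes.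
  \<open>par_normaliser\<close> combines the normaliser structure with the finiteness of the
  generating set: in a power of a normalising element, the factor that permutes generators may be
  taken to centralise \<open>P\<close>.\<close>

locale parabolic_tree_action = tree_action +
  fixes Par :: "'a set \<Rightarrow> bool"
  assumes par_subgroup: "Par P \<Longrightarrow> subgroup P G"
    and par_stab: "x \<in> Z \<Longrightarrow> Par {g \<in> carrier G. act g x = x}"
    and par_Int: "Par P \<Longrightarrow> Par Q \<Longrightarrow> Par (P \<inter> Q)"
    and par_descending: "(\<And>n::nat. Par (R n)) \<Longrightarrow> (\<And>n. R (Suc n) \<subseteq> R n) \<Longrightarrow> \<exists>N. \<forall>n\<ge>N. R n = R N"
    and par_ascending: "(\<And>n::nat. Par (R n)) \<Longrightarrow> (\<And>n. R n \<subseteq> R (Suc n)) \<Longrightarrow> \<exists>N. \<forall>n\<ge>N. R n = R N"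
    and par_normaliser: "Par P \<Longrightarrow> h \<in> carrier G \<Longrightarrow> (\<And>x. x \<in> carrier G \<Longrightarrow> x \<in> P \<longleftrightarrow> h \<otimes> x \<otimes> inv h \<in> P) \<Longrightarrow>
      \<exists>M::nat. \<exists>p\<in>P. \<exists>z\<in>carrier G. M \<ge> 1 \<and> h [^] M = p \<otimes> z \<and> (\<forall>x\<in>P. z \<otimes> x = x \<otimes> z)"
    and stab_alternative: "x \<in> Z \<Longrightarrow> g \<in> carrier G \<Longrightarrow> h \<in> carrier G \<Longrightarrow> act g x = x \<Longrightarrow> act h x = x \<Longrightarrow>
      pair_alternative G g h"
begin

text \<open>The stabilisers of longer and longer initial segments are finite intersections of vertex
  stabilisers, hence a descending chain of parabolic subgroups. Where it becomes constant, fixing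
  the segment means fixing the ray.\<close>

lemma ray_stabiliser_reached:
  fixes \<xi> :: "nat \<Rightarrow> 'c"
  assumes \<xi>: "\<And>i. \<xi> i \<in> Z"
  shows "\<exists>N. \<forall>g\<in>carrier G. (\<forall>i. K \<le> i \<longrightarrow> i \<le> N \<longrightarrow> act g (\<xi> i) = \<xi> i) \<longrightarrow> (\<forall>i\<ge>K. act g (\<xi> i) = \<xi> i)"
    and "Par {g \<in> carrier G. \<forall>i\<ge>K. act g (\<xi> i) = \<xi> i}"
proof -
  define Q where "Q n = {g \<in> carrier G. \<forall>i. K \<le> i \<longrightarrow> i \<le> K + n \<longrightarrow> act g (\<xi> i) = \<xi> i}" for n
  have QS: "Q (Suc n) = Q n \<inter> {g \<in> carrier G. act g (\<xi> (K + Suc n)) = \<xi> (K + Suc n)}" for n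
  proof -
    have "K \<le> i \<and> i \<le> K + Suc n \<longleftrightarrow> (K \<le> i \<and> i \<le> K + n) \<or> i = K + Suc n" for i by auto
    then show ?thesis unfolding Q_def by blast
  qed
  have Q0: "Q 0 = {g \<in> carrier G. act g (\<xi> K) = \<xi> K}" unfolding Q_def by (auto dest: order_antisym)
  have par: "Par (Q n)" for n
  proof (induction n)
    case (Suc n)
    show ?case unfolding QS by (rule par_Int[OF Suc par_stab[OF \<xi>]])
  qed (simp add: Q0 \<xi> par_stab)
  have desc: "Q (Suc n) \<subseteq> Q n" for n by (subst QS) blast
  obtain N where N: "\<And>n. n \<ge> N \<Longrightarrow> Q n = Q N" using par_descending[of Q, OF par desc] by blast
  have all: "act g (\<xi> i) = \<xi> i" if "g \<in> Q N" "i \<ge> K" for g i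
  proof -
    have "Q (max N i) = Q N" by (rule N) simp
    then have "g \<in> Q (max N i)" using that by simp
    then show ?thesis using that by (auto simp: Q_def)
  qed
  then show "\<exists>N. \<forall>g\<in>carrier G. (\<forall>i. K \<le> i \<longrightarrow> i \<le> N \<longrightarrow> act g (\<xi> i) = \<xi> i) \<longrightarrow> (\<forall>i\<ge>K. act g (\<xi> i) = \<xi> i)"
    by (intro exI[of _ "K + N"]) (auto simp: Q_def)
  have "{g \<in> carrier G. \<forall>i\<ge>K. act g (\<xi> i) = \<xi> i} = Q N" using all by (auto simp: Q_def)
  then show "Par {g \<in> carrier G. \<forall>i\<ge>K. act g (\<xi> i) = \<xi> i}" using par by simp
qed

lemma pow_shift:
  fixes \<xi> :: "nat \<Rightarrow> 'c"
  assumes "g \<in> carrier G" "\<And>i. \<xi> i \<in> Z" "\<And>i. act g (\<xi> i) = \<xi> (i + a)"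
  shows "act (g [^] (n::nat)) (\<xi> i) = \<xi> (i + n * a)"
  by (induction n arbitrary: i) (simp_all add: assms act_mult algebra_simps)

text \<open>Let \<open>g\<close> and \<open>h\<close> shift the ray by \<open>a\<close> and
  \<open>b\<close>. Then \<open>g^(b M)\<close> and \<open>h^(a M)\<close> shift equally and differ
  by an element \<open>x1\<close> of the tail stabiliser, so \<open>g^(b M) = (x1 p^a) z^a\<close>
  and \<open>h^(b M) = p^b z^b\<close>. The value \<open>a = 0\<close> is allowed and covers an
  element fixing the ray.\<close>

lemma common_ray_alternative:
  fixes \<xi> :: "nat \<Rightarrow> 'c"
  assumes c: "g \<in> carrier G" "h \<in> carrier G" and \<xi>: "\<And>i. \<xi> i \<in> Z"
    and sg: "\<And>i. act g (\<xi> i) = \<xi> (i + a)" and sh: "\<And>i. act h (\<xi> i) = \<xi> (i + b)" and b: "b \<ge> 1"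
  shows "pair_alternative G g h"
proof -
  define P where "P K = {g \<in> carrier G. \<forall>i\<ge>K. act g (\<xi> i) = \<xi> i}" for K
  have parP: "Par (P K)" for K unfolding P_def by (rule ray_stabiliser_reached(2)[of \<xi>, OF \<xi>])
  have mono: "P K \<subseteq> P (Suc K)" for K by (auto simp: P_def)
  obtain K where K: "\<And>n. n \<ge> K \<Longrightarrow> P n = P K" using par_ascending[of P, OF parP mono] by blast
  interpret PK: subgroup "P K" G using par_subgroup parP by blast
  \<comment> \<open>\<open>h\<close> conjugates the stabiliser of the tail from \<open>K\<close>
    onto that of the tail from \<open>K + b\<close>, and the two are equal because the ascending
    chain is constant from \<open>K\<close> on.\<close>
  have conj: "x \<in> P K \<longleftrightarrow> h \<otimes> x \<otimes> inv h \<in> P K" if x: "x \<in> carrier G" for x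
  proof -
    have inv: "act (inv h) (\<xi> (i + b)) = \<xi> i" for i using act_inv_act[OF c(2) \<xi>] sh by metis
    have eq: "act (h \<otimes> x \<otimes> inv h) (\<xi> (i + b)) = act h (act x (\<xi> i))" for i
      using c x \<xi> by (simp add: act_mult inv)
    have iff: "act (h \<otimes> x \<otimes> inv h) (\<xi> (i + b)) = \<xi> (i + b) \<longleftrightarrow> act x (\<xi> i) = \<xi> i" for i
    proof -
      have "act x (\<xi> i) \<in> Z" using x \<xi> by simp
      then have "act h (act x (\<xi> i)) = act h (\<xi> i) \<longleftrightarrow> act x (\<xi> i) = \<xi> i"
        using act_inv_act[OF c(2), of "act x (\<xi> i)"] act_inv_act[OF c(2) \<xi>, of i] by metis
      then show ?thesis by (simp only: eq sh)
    qed
    have carr: "h \<otimes> x \<otimes> inv h \<in> carrier G" using c x by simp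
    have "h \<otimes> x \<otimes> inv h \<in> P K \<longleftrightarrow> h \<otimes> x \<otimes> inv h \<in> P (K + b)" using K[of "K + b"] by simp
    also have "\<dots> \<longleftrightarrow> (\<forall>i\<ge>K. act (h \<otimes> x \<otimes> inv h) (\<xi> (i + b)) = \<xi> (i + b))"
      using carr by (simp only: P_def mem_Collect_eq all_ge_shift simp_thms)
    also have "\<dots> \<longleftrightarrow> x \<in> P K" using x by (simp only: iff P_def mem_Collect_eq simp_thms)
    finally show ?thesis ..
  qed
  obtain M :: nat and p z where M: "M \<ge> 1" "p \<in> P K" "z \<in> carrier G" "h [^] M = p \<otimes> z" "\<And>x. x \<in> P K \<Longrightarrow> z \<otimes> x = x \<otimes> z"
    using par_normaliser[OF parP c(2) conj] by blast
  have pc: "p \<in> carrier G" using M(2) by auto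
  define x1 where "x1 = g [^] (b * M) \<otimes> inv (h [^] (a * M))"
  have x1c: "x1 \<in> carrier G" using c by (simp add: x1_def)
  have "act x1 (\<xi> (i + a * M * b)) = \<xi> (i + a * M * b)" for i
  proof -
    have "act (inv (h [^] (a * M))) (\<xi> (i + a * M * b)) = \<xi> i"
      using act_inv_act[of "h [^] (a * M)" "\<xi> i"] c \<xi> pow_shift[of h \<xi> b "a * M" i, OF c(2) \<xi> sh] by simp
    then show ?thesis using c \<xi> pow_shift[of g \<xi> a "b * M" i, OF c(1) \<xi> sg] by (simp add: x1_def act_mult algebra_simps)
  qed
  then have "x1 \<in> P (K + a * M * b)" using x1c by (simp only: P_def mem_Collect_eq all_ge_shift simp_thms)
  then have x1: "x1 \<in> P K" using K[of "K + a * M * b"] by simp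
  have pz: "(p \<otimes> z) [^] n = p [^] n \<otimes> z [^] n" for n :: nat
    using M pc by (intro pow_mult_distrib) auto
  have hM: "h [^] (n * M) = p [^] n \<otimes> z [^] n" for n :: nat
    using M(4) pz[of n] c by (metis mult.commute nat_pow_pow)
  have g: "g [^] (b * M) = (x1 \<otimes> p [^] a) \<otimes> z [^] a"
  proof -
    have "g [^] (b * M) = x1 \<otimes> h [^] (a * M)" using c by (simp add: x1_def m_assoc)
    then show ?thesis using x1c pc M(3) by (simp add: hM m_assoc)
  qed
  have pn: "p [^] n \<in> P K" for n :: nat using M(2) by (induction n) auto
  have in1: "x1 \<otimes> p [^] a \<in> P K" "p [^] b \<in> P K" using x1 pn by auto
  have fixK: "act x (\<xi> K) = \<xi> K" if "x \<in> P K" for x using that unfolding P_def by blast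
  have mc: "x1 \<otimes> p [^] a \<in> carrier G" "p [^] b \<in> carrier G"
    using in1[THEN PK.mem_carrier] by blast+
  have alt: "pair_alternative G (x1 \<otimes> p [^] a) (p [^] b)"
    by (rule stab_alternative[OF \<xi>[of K] mc fixK[OF in1(1)] fixK[OF in1(2)]])
  have zc: "z [^] n \<otimes> x = x \<otimes> z [^] n" if "x \<in> P K" for x and n :: nat
    by (rule commute_pow_nat[OF M(3) PK.mem_carrier[OF that] M(5)[OF that, symmetric], symmetric])
  have zn: "z [^] n \<in> carrier G" for n :: nat using M(3) by simp
  have zz: "z [^] a \<otimes> z [^] b = z [^] b \<otimes> z [^] a" using M(3) by (simp add: nat_pow_mult add.commute)
  have "pair_alternative G ((x1 \<otimes> p [^] a) \<otimes> z [^] a) (p [^] b \<otimes> z [^] b)"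
    by (rule pair_alternative_twist[OF mc zn zn zc[OF in1(1)] zc[OF in1(2)] zc[OF in1(1)] zc[OF in1(2)] zz alt])
  then have "pair_alternative G (g [^] (b * M)) (h [^] (b * M))" by (simp add: g hM)
  then show ?thesis using c b M(1) by (intro pair_alternative_pow[of g h "b * M"]) (auto simp: Suc_leI)
qed

text \<open>The exponent \<open>n\<close> of a power fixing a far point \<open>z\<close> is not
  under control. The index \<open>N\<close> is therefore chosen before it, from the descending
  chain: a power that fixes \<open>x\<close> and such a \<open>z\<close> fixes the segment up to
  \<open>N\<close>, hence the whole ray, and counts as a shift by \<open>0\<close>.\<close>

lemma elliptic_hyperbolic_positive:
  assumes c: "a \<in> carrier G" "h \<in> carrier G" and x: "x \<in> Z" "act a x = x" and ax: "axis h \<beta> l"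
    and unb: "\<And>K. \<exists>z\<in>Z. (\<exists>n::nat. n \<ge> 1 \<and> act (a [^] n) z = z) \<and> (\<exists>j\<ge>0. gp z (act (h [^] (j::int)) x) x \<ge> 2 * K)"
  shows "pair_alternative G a h"
proof -
  obtain i0 where i0: "\<And>i. i \<ge> i0 \<Longrightarrow> d x (\<beta> i) = d x (\<beta> i0) + (i - i0)" using axis_tail[OF ax x(1)] by blast
  have Z: "\<beta> i \<in> Z" for i using ax by (simp add: axis_def)
  have dd: "d (\<beta> i) (\<beta> j) = \<bar>i - j\<bar>" for i j using ax by (simp add: axis_def)
  have l1: "l \<ge> 1" using ax by (simp add: axis_def)
  define \<xi> where "\<xi> n = \<beta> (i0 + int n)" for n
  obtain N where N: "\<And>g. g \<in> carrier G \<Longrightarrow> (\<And>i. i \<le> N \<Longrightarrow> act g (\<xi> i) = \<xi> i) \<Longrightarrow> (\<forall>i. act g (\<xi> i) = \<xi> i)"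
  proof -
    have "\<xi> i \<in> Z" for i by (simp add: \<xi>_def Z)
    from ray_stabiliser_reached(1)[of \<xi> 0, OF this]
    obtain N where "\<forall>g\<in>carrier G. (\<forall>i. 0 \<le> i \<longrightarrow> i \<le> N \<longrightarrow> act g (\<xi> i) = \<xi> i) \<longrightarrow> (\<forall>i\<ge>0. act g (\<xi> i) = \<xi> i)" ..
    then show ?thesis using that[of N] by blast
  qed
  obtain z n where z: "z \<in> Z" "n \<ge> 1" "act (a [^] (n::nat)) z = z" "d (\<beta> (i0 + int N)) z = d x z - d x (\<beta> (i0 + int N))"
    using axis_reach[OF c(2) ax x(1) i0 unb, of "i0 + int N"] by auto
  have an: "a [^] n \<in> carrier G" "act (a [^] n) x = x"
    using c fix_pow_mult[of a x 1 n] x by auto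
  have fN: "act (a [^] n) (\<beta> (i0 + int N)) = \<beta> (i0 + int N)"
    by (rule fix_between[OF an(1) x(1) z(1) Z an(2) z(3) HOL.refl z(4)])
  have "act (a [^] n) (\<xi> i) = \<xi> i" if "i \<le> N" for i
    unfolding \<xi>_def
  proof (rule fix_between[OF an(1) x(1) Z Z an(2) fN HOL.refl])
    show "d (\<beta> (i0 + int i)) (\<beta> (i0 + int N)) = d x (\<beta> (i0 + int N)) - d x (\<beta> (i0 + int i))"
      using that i0[of "i0 + int i"] i0[of "i0 + int N"] dd by simp
  qed
  then have fx: "act (a [^] n) (\<xi> i) = \<xi> (i + 0)" for i using N[OF an(1)] by simp
  have sh: "act (h [^] n) (\<xi> i) = \<xi> (i + nat (int n * l))" for i
    using axis_pow[OF c(2) ax, of "int n" "i0 + int i"] l1 by (simp add: \<xi>_def int_pow_int algebra_simps)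
  have "pair_alternative G (a [^] n) (h [^] n)"
    using c fx sh Z z(2) l1 by (intro common_ray_alternative[of _ _ \<xi> 0 "nat (int n * l)"]) (auto simp: \<xi>_def Suc_le_eq)
  then show ?thesis using pair_alternative_pow c z(2) by blast
qed

text \<open>Points fixed by powers of \<open>a\<close> follow the axis of \<open>h\<close>
  arbitrarily far forwards or backwards, or one bound serves both directions. Backwards along
  \<open>h\<close> is forwards along \<open>inv h\<close>.\<close>

lemma elliptic_hyperbolic:
  assumes c: "a \<in> carrier G" "h \<in> carrier G" and x: "x \<in> Z" "act a x = x" and ax: "axis h \<beta> l"
  shows "pair_alternative G a h"
proof -
  define Q where "Q K j \<longleftrightarrow> (\<exists>z\<in>Z. (\<exists>n::nat. n \<ge> 1 \<and> act (a [^] n) z = z) \<and> gp z (act (h [^] (j::int)) x) x \<ge> 2 * K)" for K j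
  have mono: "Q K j" if "Q K' j" "K \<le> K'" for K K' j using that by (force simp: Q_def)
  consider (pos) "\<forall>K. \<exists>j\<ge>0. Q K j" | (neg) "\<forall>K. \<exists>j\<ge>0. Q K (- j)" | (bd) K where "K \<ge> 1" "\<And>j. \<not> Q K j"
  proof -
    have ?thesis if unb: "\<not> (\<forall>K. \<exists>j\<ge>0. Q K j)" "\<not> (\<forall>K. \<exists>j\<ge>0. Q K (- j))"
    proof -
      obtain K1 K2 where K: "\<And>j. j \<ge> 0 \<Longrightarrow> \<not> Q K1 j" "\<And>j. j \<ge> 0 \<Longrightarrow> \<not> Q K2 (- j)" using unb by blast
      define B where "B = max 1 (max K1 K2)"
      have B: "1 \<le> B" "K1 \<le> B" "K2 \<le> B" unfolding B_def by linarith+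
      have "\<not> Q B j" for j
        using K(1)[of j] K(2)[of "- j"] mono[of B j K1] mono[of B j K2] B by (cases "j \<ge> 0") auto
      then show ?thesis using bd[of B] B by blast
    qed
    then show ?thesis using pos neg by blast
  qed
  then show ?thesis
  proof cases
    case pos
    then show ?thesis using elliptic_hyperbolic_positive[OF c x ax] unfolding Q_def by meson
  next
    case neg
    have "inv h [^] j = h [^] (- j)" for j :: int using c by (simp add: int_pow_inv int_pow_neg)
    then have "pair_alternative G a (inv h)"
      using neg elliptic_hyperbolic_positive[OF c(1) _ x axis_inv[OF c(2) ax]] c unfolding Q_def
      by (simp only: inv_closed) meson
    then show ?thesis using pair_alternative_inv[OF c(2,1)] pair_alternative_swap by blast
  next
    case (bd K)
    then show ?thesis using elliptic_hyperbolic_free[OF c x ax bd(1)] unfolding Q_def by (meson linorder_not_le)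
  qed
qed

lemma hyperbolic_hyperbolic_positive:
  assumes c: "g \<in> carrier G" "h \<in> carrier G" and x: "x \<in> Z" and ax: "axis g \<alpha> l" "axis h \<beta> l'"
    and unb: "\<And>K. \<exists>i\<ge>0. \<exists>j\<ge>0. gp (act (g [^] (i::int)) x) (act (h [^] (j::int)) x) x \<ge> 2 * K"
  shows "pair_alternative G g h"
proof -
  obtain r k where rk: "\<And>i. i \<ge> r \<Longrightarrow> \<alpha> i = \<beta> (i + k)" using hyperbolic_hyperbolic_common_ray[OF assms] by blast
  have Z: "\<alpha> i \<in> Z" for i using ax by (simp add: axis_def)
  have l: "l \<ge> 1" "l' \<ge> 1" using ax by (auto simp: axis_def)
  define \<xi> where "\<xi> n = \<alpha> (r + int n)" for n
  have sg: "act g (\<xi> i) = \<xi> (i + nat l)" for i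
    using ax(1) l by (simp add: \<xi>_def axis_def algebra_simps)
  have sh: "act h (\<xi> i) = \<xi> (i + nat l')" for i
  proof -
    have "act h (\<xi> i) = \<beta> (r + int i + k + l')" using ax(2) rk[of "r + int i"] by (simp add: \<xi>_def axis_def)
    also have "\<dots> = \<alpha> (r + int i + l')" using rk[of "r + int i + l'"] l by (simp add: algebra_simps)
    finally show ?thesis using l by (simp add: \<xi>_def algebra_simps)
  qed
  show ?thesis using c sg sh Z l by (intro common_ray_alternative[of _ _ \<xi> "nat l" "nat l'"]) (auto simp: \<xi>_def)
qed

text \<open>The four choices of signs turn every pair of ends into a pair of forward ends. If the
  Gromov products are unbounded for none of them, the largest of the four bounds serves all
  exponents.\<close>

lemma hyperbolic_hyperbolic:
  assumes c: "g \<in> carrier G" "h \<in> carrier G" and x: "x \<in> Z" and ax: "axis g \<alpha> l" "axis h \<beta> l'"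
  shows "pair_alternative G g h"
proof -
  define Q where "Q K i j \<longleftrightarrow> gp (act (g [^] (i::int)) x) (act (h [^] (j::int)) x) x \<ge> 2 * K" for K i j
  have mono: "Q K i j" if "Q K' i j" "K \<le> K'" for K K' i j using that by (force simp: Q_def)
  define sgn where "sgn e = (if e then 1 else - 1 :: int)" for e
  show ?thesis
  proof (cases "\<exists>e e'. \<forall>K. \<exists>i\<ge>0. \<exists>j\<ge>0. Q K (sgn e * i) (sgn e' * j)")
    case True
    then obtain e e' where unb: "\<forall>K. \<exists>i\<ge>0. \<exists>j\<ge>0. Q K (sgn e * i) (sgn e' * j)" by blast
    define g' h' where "g' = (if e then g else inv g)" and "h' = (if e' then h else inv h)"
    have c': "g' \<in> carrier G" "h' \<in> carrier G" using c by (auto simp: g'_def h'_def)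
    obtain \<alpha>' where \<alpha>': "axis g' \<alpha>' l" using ax(1) axis_inv[OF c(1) ax(1)] by (cases e) (auto simp: g'_def)
    obtain \<beta>' where \<beta>': "axis h' \<beta>' l'" using ax(2) axis_inv[OF c(2) ax(2)] by (cases e') (auto simp: h'_def)
    have "g' [^] i = g [^] (sgn e * i)" "h' [^] i = h [^] (sgn e' * i)" for i :: int
      using c by (auto simp: g'_def h'_def sgn_def int_pow_inv int_pow_neg)
    then have "pair_alternative G g' h'"
      using unb by (intro hyperbolic_hyperbolic_positive[OF c' x \<alpha>' \<beta>']) (simp add: Q_def)
    then have "pair_alternative G g h'" using pair_alternative_inv[OF c(1) c'(2)] by (auto simp: g'_def split: if_splits)
    then have "pair_alternative G h' g" by (rule pair_alternative_swap)
    then have "pair_alternative G h g" using pair_alternative_inv[OF c(2,1)] by (auto simp: h'_def split: if_splits)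
    then show ?thesis by (rule pair_alternative_swap)
  next
    case False
    then obtain K where K: "\<And>e e' i j. i \<ge> 0 \<Longrightarrow> j \<ge> 0 \<Longrightarrow> \<not> Q (K e e') (sgn e * i) (sgn e' * j)" by metis
    define B where "B = max 1 (Max (range (\<lambda>(e, e'). K e e')))"
    have B: "K e e' \<le> B" for e e'
    proof -
      have "K e e' \<le> Max (range (\<lambda>(e, e'). K e e'))" by (rule Max_ge) (auto intro!: image_eqI[of _ _ "(e, e')"])
      then show ?thesis by (simp add: B_def)
    qed
    have "\<not> Q B i j" for i j
    proof
      assume q: "Q B i j"
      have "sgn (i \<ge> 0) * \<bar>i\<bar> = i" "sgn (j \<ge> 0) * \<bar>j\<bar> = j" by (auto simp: sgn_def)
      then show False using K[of "\<bar>i\<bar>" "\<bar>j\<bar>" "i \<ge> 0" "j \<ge> 0"] mono[OF q B] by (metis abs_ge_zero)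
    qed
    then show ?thesis using hyperbolic_hyperbolic_free[OF c x ax, of B]
      unfolding Q_def by (simp add: B_def linorder_not_le)
  qed
qed

lemma Fix_power_pow: "a \<in> carrier G \<Longrightarrow> n \<ge> 1 \<Longrightarrow> Fix_power (a [^] (n::nat)) \<subseteq> Fix_power a"
proof
  assume a: "a \<in> carrier G" "n \<ge> 1"
  fix z assume "z \<in> Fix_power (a [^] n)"
  then obtain k :: nat where "z \<in> Z" "k \<ge> 1" "act (a [^] (n * k)) z = z"
    using a by (auto simp: Fix_power_def nat_pow_pow)
  moreover have "n * k \<ge> 1" using a calculation by (simp add: Suc_leI)
  ultimately show "z \<in> Fix_power a" unfolding Fix_power_def by blast
qed

lemma hyperbolic_axis:
  assumes "h \<in> carrier G" "Fix_power h = {}" "Z \<noteq> {}"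
  obtains \<beta> l where "axis h \<beta> l"
proof -
  have "act h z \<noteq> z" if "z \<in> Z" for z
    using assms that by (auto simp: Fix_power_def dest!: spec[of _ 1])
  then show ?thesis using axis_exists[OF assms(1) _ assms(3)] that by blast
qed

lemma elliptic_hyperbolic_power:
  assumes c: "a \<in> carrier G" "h \<in> carrier G" and ne: "Fix_power a \<noteq> {}" "Fix_power h = {}"
  shows "pair_alternative G a h"
proof -
  obtain x n where x: "x \<in> Z" "n \<ge> 1" "act (a [^] (n::nat)) x = x" using ne by (auto simp: Fix_power_def)
  have "Fix_power (h [^] n) = {}" using Fix_power_pow[OF c(2) x(2)] ne by blast
  then obtain \<beta> l where "axis (h [^] n) \<beta> l" using hyperbolic_axis[of "h [^] n"] c x by auto
  then have "pair_alternative G (a [^] n) (h [^] n)" using elliptic_hyperbolic x c by blast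
  then show ?thesis using pair_alternative_pow c x by blast
qed

text \<open>A common point of the two \<open>Fix_power\<close> sets moves suitable powers into one
  vertex stabiliser. An empty \<open>Fix_power\<close> set means that no positive power fixes a
  vertex, so the element and its powers have axes.\<close>

theorem tree_power_alternative:
  assumes ne: "Z \<noteq> {}"
  shows "power_alternative G"
  unfolding power_alternative_iff
proof (intro ballI)
  fix g h assume c: "g \<in> carrier G" "h \<in> carrier G"
  consider (common) z where "z \<in> Fix_power g" "z \<in> Fix_power h"
    | (ee) "Fix_power g \<noteq> {}" "Fix_power h \<noteq> {}" "Fix_power g \<inter> Fix_power h = {}"
    | (eh) "Fix_power g \<noteq> {}" "Fix_power h = {}" | (he) "Fix_power g = {}" "Fix_power h \<noteq> {}"
    | (hh) "Fix_power g = {}" "Fix_power h = {}" by blast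
  then show "pair_alternative G g h"
  proof cases
    case common
    obtain m n :: nat where mn: "m \<ge> 1" "n \<ge> 1" "act (g [^] m) z = z" "act (h [^] n) z = z" "z \<in> Z"
      using common by (auto simp: Fix_power_def)
    have "act (g [^] (m * n)) z = z" "act (h [^] (m * n)) z = z"
      using fix_pow_mult[OF c(1) mn(5,3), of n] fix_pow_mult[OF c(2) mn(5,4), of m] by (simp_all add: mult.commute)
    then have "pair_alternative G (g [^] (m * n)) (h [^] (m * n))" using stab_alternative[OF mn(5)] c by simp
    then show ?thesis using c mn by (intro pair_alternative_pow[of g h "m * n"]) (auto simp: Suc_leI)
  next
    case ee
    then show ?thesis using elliptic_elliptic c by blast
  next
    case eh
    then show ?thesis using elliptic_hyperbolic_power c by blast
  next
    case he
    then show ?thesis using elliptic_hyperbolic_power c pair_alternative_swap by blast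
  next
    case hh
    obtain \<alpha> l where 1: "axis g \<alpha> l" using hyperbolic_axis c hh ne by blast
    obtain \<beta> l' where 2: "axis h \<beta> l'" using hyperbolic_axis c hh ne by blast
    obtain x where "x \<in> Z" using ne by blast
    then show ?thesis using hyperbolic_hyperbolic c 1 2 by blast
  qed
qed

end

section \<open>The tree of an amalgam\<close>

fun lcp :: "'x list \<Rightarrow> 'x list \<Rightarrow> nat" where
  "lcp (x # xs) (y # ys) = (if x = y then Suc (lcp xs ys) else 0)"
| "lcp _ _ = 0"

lemma lcp_sym: "lcp u v = lcp v u"
  by (induction u v rule: lcp.induct) auto

lemma lcp_le: "lcp u v \<le> length u" "lcp u v \<le> length v"
  by (induction u v rule: lcp.induct) auto

lemma lcp_self [simp]: "lcp u u = length u"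
  by (induction u) auto

lemma lcp_eq: "lcp u v = length u \<Longrightarrow> lcp u v = length v \<Longrightarrow> u = v"
  by (induction u v rule: lcp.induct) (auto split: if_splits)

lemma lcp_ultra: "min (lcp u v) (lcp v w) \<le> lcp u w"
proof (induction u v arbitrary: w rule: lcp.induct)
  case (1 x xs y ys)
  show ?case
  proof (cases w)
    case (Cons z zs)
    then show ?thesis using 1[of zs] by auto
  qed simp
qed auto

lemma lcp_take: "lcp (take n u) v = min n (lcp u v)"
proof (induction u v arbitrary: n rule: lcp.induct)
  case (1 x xs y ys)
  then show ?case by (cases n) auto
qed (auto simp: take_Cons')

text \<open>Distance in the rooted tree in which the parent of a list arises by dropping its last
  entry.\<close>

definition dl :: "'x list \<Rightarrow> 'x list \<Rightarrow> int" where
  "dl u v = int (length u) + int (length v) - 2 * int (lcp u v)"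

lemma dl_zero: "dl u v = 0 \<longleftrightarrow> u = v"
proof
  assume "dl u v = 0"
  then have "lcp u v = length u" "lcp u v = length v" using lcp_le[of u v] by (auto simp: dl_def)
  then show "u = v" using lcp_eq by blast
qed (simp add: dl_def)

lemma dl_sym: "dl u v = dl v u" by (simp add: dl_def lcp_sym)

lemma dl_four_point: "dl x y + dl z w \<le> max (dl x z + dl y w) (dl x w + dl y z)"
proof -
  define a b c d e f where "a = lcp x y" and "b = lcp z w" and "c = lcp x z" and "d = lcp y w" and "e = lcp x w" and "f = lcp y z"
  note defs = a_def b_def c_def d_def e_def f_def
  have "min c f \<le> a" "min e d \<le> a" "min c e \<le> b" "min f d \<le> b"
    using lcp_ultra[of x z y] lcp_ultra[of x w y] lcp_ultra[of z x w] lcp_ultra[of z y w] unfolding defs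
    by (simp_all add: lcp_sym)
  then have "min (c + d) (e + f) \<le> a + b" by linarith
  then show ?thesis unfolding dl_def defs by linarith
qed

lemma dl_take: "k \<le> length u \<Longrightarrow> lcp u v \<le> k \<Longrightarrow> dl u (take k u) = int (length u) - int k \<and> dl (take k u) v = dl u v - (int (length u) - int k)"
  using lcp_take[of k u u] lcp_take[of k u v] lcp_sym[of "take k u" u] by (simp add: dl_def min_def)

text \<open>The path climbs through prefixes of \<open>u\<close> to the longest common prefix and
  then descends through prefixes of \<open>v\<close>; \<open>k\<close> decides on which leg the
  point lies.\<close>

lemma dl_interpolation:
  assumes "0 \<le> k" "k \<le> dl u v"
  shows "\<exists>n. (dl u (take n u) = k \<and> dl (take n u) v = dl u v - k) \<or> (dl u (take n v) = k \<and> dl (take n v) v = dl u v - k)"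
proof (cases "k \<le> int (length u) - int (lcp u v)")
  case True
  define n where "n = nat (int (length u) - k)"
  have "n \<le> length u" "lcp u v \<le> n" using True assms lcp_le[of u v] by (auto simp: n_def)
  moreover have "int (length u) - int n = k" using True assms by (simp add: n_def)
  ultimately show ?thesis using dl_take[of n u v] by (intro exI[of _ n]) auto
next
  case False
  define n where "n = nat (2 * int (lcp u v) + k - int (length u))"
  have n: "n \<le> length v" "lcp v u \<le> n" using False assms lcp_le[of u v] lcp_sym[of u v] by (auto simp: n_def dl_def)
  have "int (length v) - int n = dl u v - k" using False assms lcp_le[of u v] by (simp add: n_def dl_def)
  then show ?thesis using dl_take[OF n] dl_sym[of v u] dl_sym[of v "take n v"] dl_sym[of "take n v" u]
    by (intro exI[of _ n] disjI2) simp
qed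

lemma dl_parity: "even (dl x y + dl y z + dl x z)" by (simp add: dl_def)

section \<open>Lists of coset representatives and the actions of the two factors\<close>

locale amalgam = group G for G (structure) +
  fixes Bs :: "bool \<Rightarrow> 'a set" and C :: "'a set"
  assumes Bs: "subgroup (Bs i) G" and C: "subgroup C G" and CB: "C \<subseteq> Bs i"
begin

text \<open>One representative for each left coset of \<open>C\<close>. The coset \<open>C\<close>
  itself gets \<open>\<one>\<close>, so that a trivial entry of a list can be recognised.\<close>

definition rep :: "'a \<Rightarrow> 'a" where
  "rep g = (if g \<in> C then \<one> else SOME r. r \<in> g <# C)"

lemma C_carr: "c \<in> C \<Longrightarrow> c \<in> carrier G" using subgroup.mem_carrier[OF C] .

lemma Bs_carr: "b \<in> Bs i \<Longrightarrow> b \<in> carrier G" using subgroup.mem_carrier[OF Bs] .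

lemma rep_ex:
  assumes g: "g \<in> carrier G"
  obtains c where "c \<in> C" "rep g = g \<otimes> c"
proof (cases "g \<in> C")
  case True
  have "inv g \<in> C" "rep g = g \<otimes> inv g" using True g subgroup.m_inv_closed[OF C] by (auto simp: rep_def)
  then show ?thesis using that by blast
next
  case False
  have "g \<in> g <# C" using subgroup.one_closed[OF C] g unfolding l_coset_def by force
  then have "(SOME r. r \<in> g <# C) \<in> g <# C" by (rule someI)
  then show ?thesis using False that by (auto simp: rep_def l_coset_def)
qed

lemma rep_carr [simp]: "g \<in> carrier G \<Longrightarrow> rep g \<in> carrier G"
  using rep_ex C_carr by (metis m_closed)

lemma rep_C: "g \<in> carrier G \<Longrightarrow> inv (rep g) \<otimes> g \<in> C"
proof -
  assume g: "g \<in> carrier G"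
  obtain c where c: "c \<in> C" "rep g = g \<otimes> c" using rep_ex[OF g] .
  have "inv (rep g) \<otimes> g = inv c" using c g C_carr by (simp add: inv_mult_group m_assoc)
  then show ?thesis using c subgroup.m_inv_closed[OF C] by simp
qed

lemma l_coset_C: "g \<in> carrier G \<Longrightarrow> c \<in> C \<Longrightarrow> (g \<otimes> c) <# C = g <# C"
  by (metis C C_carr coset_join3 lcos_m_assoc subgroup.subset)

lemma rep_mult_C: "g \<in> carrier G \<Longrightarrow> c \<in> C \<Longrightarrow> rep (g \<otimes> c) = rep g"
proof -
  assume g: "g \<in> carrier G" and c: "c \<in> C"
  have "g \<otimes> c \<in> C \<longleftrightarrow> g \<in> C"
  proof
    assume "g \<otimes> c \<in> C"
    then have "g \<otimes> c \<otimes> inv c \<in> C" using c subgroup.m_closed[OF C] subgroup.m_inv_closed[OF C] by blast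
    then show "g \<in> C" using g c C_carr by (simp add: m_assoc)
  qed (use c subgroup.m_closed[OF C] in blast)
  then show ?thesis by (simp add: rep_def l_coset_C[OF g c])
qed

lemma rep_eqI: "g \<in> carrier G \<Longrightarrow> h \<in> carrier G \<Longrightarrow> inv g \<otimes> h \<in> C \<Longrightarrow> rep g = rep h"
  using rep_mult_C[of g "inv g \<otimes> h"] by (simp flip: m_assoc)

lemma rep_eqD: "g \<in> carrier G \<Longrightarrow> h \<in> carrier G \<Longrightarrow> rep g = rep h \<Longrightarrow> inv g \<otimes> h \<in> C"
proof -
  assume gh: "g \<in> carrier G" "h \<in> carrier G" "rep g = rep h"
  have "inv (inv (rep g) \<otimes> g) \<otimes> (inv (rep h) \<otimes> h) \<in> C"
    using rep_C[OF gh(1)] rep_C[OF gh(2)] subgroup.m_closed[OF C] subgroup.m_inv_closed[OF C] by blast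
  moreover have "inv (inv (rep g) \<otimes> g) \<otimes> (inv (rep h) \<otimes> h) = inv g \<otimes> h"
  proof -
    have "rep g \<otimes> (inv (rep g) \<otimes> h) = h" using gh(1,2) by (simp flip: m_assoc)
    then show ?thesis using gh(1,2) unfolding gh(3)[symmetric] by (simp add: inv_mult_group m_assoc)
  qed
  ultimately show ?thesis by simp
qed

lemma rep_rep [simp]: "g \<in> carrier G \<Longrightarrow> rep (rep g) = rep g"
  using rep_eqI[of "rep g" g] rep_C by simp

lemma rep_one [simp]: "rep \<one> = \<one>" using subgroup.one_closed[OF C] by (simp add: rep_def)

lemma rep_in_C: "c \<in> C \<Longrightarrow> rep c = \<one>" by (simp add: rep_def)

lemma rep_eq_one: "g \<in> carrier G \<Longrightarrow> rep g = \<one> \<Longrightarrow> g \<in> C"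
  using rep_C[of g] by simp

lemma rep_Bs: "b \<in> Bs i \<Longrightarrow> rep b \<in> Bs i"
proof -
  assume b: "b \<in> Bs i"
  obtain c where "c \<in> C" "rep b = b \<otimes> c" using rep_ex[OF Bs_carr[OF b]] .
  then show ?thesis using b CB subgroup.m_closed[OF Bs] by (metis subsetD)
qed

text \<open>Left multiplication of a product of representatives: \<open>g r\<close> is its
  representative times an element of \<open>C\<close>, and this remainder is passed on to the next
  entry.\<close>

fun tr :: "'a \<Rightarrow> 'a list \<Rightarrow> 'a list" where
  "tr g [] = []"
| "tr g (r # l) = rep (g \<otimes> r) # tr (inv (rep (g \<otimes> r)) \<otimes> (g \<otimes> r)) l"

fun nontriv :: "bool \<Rightarrow> 'a list \<Rightarrow> bool" where
  "nontriv i [] \<longleftrightarrow> True"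
| "nontriv i (r # l) \<longleftrightarrow> r \<in> Bs i \<and> rep r = r \<and> r \<noteq> \<one> \<and> nontriv (\<not> i) l"

text \<open>The list \<open>r\<^sub>1 \<dots> r\<^sub>n\<close> of coset representatives stands for the coset \<open>r\<^sub>1 \<dots> r\<^sub>n B\<close>, where
  \<open>B\<close> is one of the two factors depending on the parity of \<open>n\<close>; the empty list is the coset
  \<open>Bs i\<close>. Only the first representative may be trivial.\<close>

definition verts :: "bool \<Rightarrow> 'a list set" where
  "verts i = {l. l = [] \<or> (\<exists>r l'. l = r # l' \<and> r \<in> Bs i \<and> rep r = r \<and> nontriv (\<not> i) l')}"

lemma verts_Cons: "r # l \<in> verts i \<longleftrightarrow> r \<in> Bs i \<and> rep r = r \<and> nontriv (\<not> i) l"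
  by (auto simp: verts_def)

lemma verts_Nil [simp]: "[] \<in> verts i" by (simp add: verts_def)

lemma nontriv_verts: "nontriv i l \<Longrightarrow> l \<in> verts i" by (cases l) (auto simp: verts_def)

lemma nontriv_rep: "nontriv i l \<Longrightarrow> \<forall>r\<in>set l. r \<in> carrier G \<and> rep r = r"
  by (induction i l rule: nontriv.induct) (auto simp: Bs_carr)

lemma verts_rep: "l \<in> verts i \<Longrightarrow> \<forall>r\<in>set l. r \<in> carrier G \<and> rep r = r"
  using nontriv_rep by (cases l) (auto simp: verts_Cons Bs_carr)

lemma nontriv_take: "nontriv i l \<Longrightarrow> nontriv i (take n l)"
  by (induction i l arbitrary: n rule: nontriv.induct) (auto simp: take_Cons')

lemma verts_take: "l \<in> verts i \<Longrightarrow> take n l \<in> verts i"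
  by (cases l; cases n) (auto simp: verts_Cons nontriv_take)

lemma length_tr [simp]: "length (tr g l) = length l"
  by (induction l arbitrary: g) auto

lemma tr_mult: "g \<in> carrier G \<Longrightarrow> h \<in> carrier G \<Longrightarrow> \<forall>r\<in>set l. r \<in> carrier G \<Longrightarrow> tr (g \<otimes> h) l = tr g (tr h l)"
proof (induction l arbitrary: g h)
  case (Cons r l)
  let ?s = "rep (h \<otimes> r)" and ?t = "rep (g \<otimes> h \<otimes> r)"
  have c: "r \<in> carrier G" "?s \<in> carrier G" "?t \<in> carrier G" using Cons.prems by auto
  have s: "rep (g \<otimes> ?s) = ?t"
  proof (rule rep_eqI)
    have "inv (g \<otimes> ?s) \<otimes> (g \<otimes> h \<otimes> r) = inv ?s \<otimes> (h \<otimes> r)"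
    proof -
      have "inv g \<otimes> (g \<otimes> (h \<otimes> r)) = h \<otimes> r" using c Cons.prems by (simp flip: m_assoc)
      then show ?thesis using c Cons.prems by (simp add: inv_mult_group m_assoc)
    qed
    then show "inv (g \<otimes> ?s) \<otimes> (g \<otimes> h \<otimes> r) \<in> C" using rep_C[of "h \<otimes> r"] Cons.prems c by simp
  qed (use c Cons.prems in auto)
  have "inv ?t \<otimes> (g \<otimes> h \<otimes> r) = (inv ?t \<otimes> (g \<otimes> ?s)) \<otimes> (inv ?s \<otimes> (h \<otimes> r))"
  proof -
    have "?s \<otimes> (inv ?s \<otimes> (h \<otimes> r)) = h \<otimes> r" using c Cons.prems by (simp flip: m_assoc)
    then show ?thesis using c Cons.prems by (simp add: m_assoc)
  qed
  then show ?case using Cons c by (simp add: s)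
qed simp

lemma tr_one: "\<forall>r\<in>set l. r \<in> carrier G \<and> rep r = r \<Longrightarrow> tr \<one> l = l"
  by (induction l) auto

text \<open>Multiplying by an element of \<open>C\<close> cannot bring a representative outside
  \<open>C\<close> into \<open>C\<close>, and the remainder that is passed on lies in
  \<open>C\<close> again.\<close>

lemma tr_nontriv: "c \<in> C \<Longrightarrow> nontriv i l \<Longrightarrow> nontriv i (tr c l)"
proof (induction l arbitrary: c i)
  case (Cons r l)
  have r: "r \<in> Bs i" "r \<in> carrier G" "rep r = r" "r \<noteq> \<one>" "nontriv (\<not> i) l" using Cons.prems Bs_carr by auto
  have c: "c \<in> carrier G" "c \<in> Bs i" using Cons.prems C_carr CB by auto
  have "c \<otimes> r \<in> Bs i" using c r subgroup.m_closed[OF Bs] by blast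
  moreover have "rep (c \<otimes> r) \<noteq> \<one>"
  proof
    assume "rep (c \<otimes> r) = \<one>"
    then have "c \<otimes> r \<in> C" using rep_eq_one c r by simp
    then have "inv c \<otimes> (c \<otimes> r) \<in> C" using Cons.prems(1) subgroup.m_closed[OF C] subgroup.m_inv_closed[OF C] by blast
    then have "r \<in> C" using c r by (simp flip: m_assoc)
    then show False using r rep_in_C by simp
  qed
  moreover have "inv (rep (c \<otimes> r)) \<otimes> (c \<otimes> r) \<in> C" using rep_C c r by simp
  ultimately show ?case using Cons.IH[OF _ r(5)] c r by (simp add: rep_Bs)
qed simp

lemma tr_verts: "g \<in> Bs i \<Longrightarrow> l \<in> verts i \<Longrightarrow> tr g l \<in> verts i"
proof (cases l)
  case (Cons r l')
  assume g: "g \<in> Bs i" and l: "l \<in> verts i"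
  have r: "r \<in> Bs i" "nontriv (\<not> i) l'" using l Cons by (auto simp: verts_Cons)
  have gr: "g \<otimes> r \<in> Bs i" "g \<otimes> r \<in> carrier G" using g r subgroup.m_closed[OF Bs] Bs_carr by auto
  then show ?thesis using Cons r tr_nontriv[OF rep_C[OF gr(2)] r(2)] by (simp add: verts_Cons rep_Bs)
qed simp

lemma lcp_tr:
  assumes "g \<in> carrier G" "\<forall>r\<in>set u. r \<in> carrier G \<and> rep r = r" "\<forall>r\<in>set v. r \<in> carrier G \<and> rep r = r"
  shows "lcp (tr g u) (tr g v) = lcp u v"
  using assms
proof (induction u v arbitrary: g rule: lcp.induct)
  case (1 x xs y ys)
  have c: "x \<in> carrier G" "y \<in> carrier G" "rep x = x" "rep y = y" using 1 by auto
  have "rep (g \<otimes> x) = rep (g \<otimes> y) \<Longrightarrow> x = y"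
  proof -
    assume "rep (g \<otimes> x) = rep (g \<otimes> y)"
    then have "inv (g \<otimes> x) \<otimes> (g \<otimes> y) \<in> C" using rep_eqD 1(2) c by simp
    moreover have "inv (g \<otimes> x) \<otimes> (g \<otimes> y) = inv x \<otimes> y"
    proof -
      have "inv g \<otimes> (g \<otimes> y) = y" using 1(2) c by (simp flip: m_assoc)
      then show ?thesis using 1(2) c by (simp add: inv_mult_group m_assoc)
    qed
    ultimately have "rep x = rep y" using rep_eqI[OF c(1,2)] by (simp only:)
    then show ?thesis by (simp only: c(3,4))
  qed
  moreover have "lcp (tr (inv (rep (g \<otimes> x)) \<otimes> (g \<otimes> x)) xs) (tr (inv (rep (g \<otimes> x)) \<otimes> (g \<otimes> x)) ys) = lcp xs ys" if "x = y"
    using 1(1)[OF that, of "inv (rep (g \<otimes> x)) \<otimes> (g \<otimes> x)"] 1(2-4) c(1) by simp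
  ultimately show ?case unfolding tr.simps lcp.simps by (cases "x = y"; cases "rep (g \<otimes> x) = rep (g \<otimes> y)") simp_all
qed auto

text \<open>Re-rooting at the other end of the base edge. Seen from the root \<open>Bs i\<close>,
  the vertex \<open>Bs (\<not> i)\<close> is the list \<open>[\<one>]\<close>, so passing to the
  other root inserts or removes a leading \<open>\<one>\<close>.\<close>

fun flip :: "'a list \<Rightarrow> 'a list" where
  "flip [] = [\<one>]"
| "flip (r # l) = (if r = \<one> then l else \<one> # r # l)"

lemma flip_verts: "l \<in> verts i \<Longrightarrow> flip l \<in> verts (\<not> i)"
  using subgroup.one_closed[OF Bs] nontriv_verts by (cases l) (auto simp: verts_Cons)

lemma flip_flip [simp]: "l \<in> verts i \<Longrightarrow> flip (flip l) = l"
proof (cases l)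
  case (Cons r l')
  assume "l \<in> verts i"
  then show ?thesis using Cons by (cases l') (auto simp: verts_Cons)
qed simp

lemma length_flip: "l \<in> verts i \<Longrightarrow> even (length (flip l)) \<longleftrightarrow> odd (length l)"
  by (cases l) auto

lemma dl_flip: "u \<in> verts i \<Longrightarrow> v \<in> verts i \<Longrightarrow> dl (flip u) (flip v) = dl u v"
proof (cases u; cases v)
  fix r u' s v' assume uv: "u \<in> verts i" "v \<in> verts i" "u = r # u'" "v = s # v'"
  then show ?thesis by (cases u'; cases v') (auto simp: dl_def verts_Cons)
next
  fix s v' assume uv: "u \<in> verts i" "v \<in> verts i" "u = []" "v = s # v'"
  then show ?thesis by (cases v') (auto simp: dl_def verts_Cons)
next
  fix r u' assume uv: "u \<in> verts i" "v \<in> verts i" "u = r # u'" "v = []"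
  then show ?thesis by (cases u') (auto simp: dl_def verts_Cons)
qed (simp add: dl_def)

text \<open>An element of \<open>C\<close> fixes both ends of the base edge, so a leading
  \<open>\<one>\<close> stays in place and the action is the same from either root. This is the
  compatibility by which the two factor actions fit together.\<close>

lemma flip_tr_C: "c \<in> C \<Longrightarrow> l \<in> verts i \<Longrightarrow> flip (tr c (flip l)) = tr c l"
proof -
  assume c: "c \<in> C" and l: "l \<in> verts i"
  have cc: "c \<in> carrier G" using c C_carr by simp
  have tr1: "tr c (\<one> # l') = \<one> # tr c l'" for l' using c cc by (simp add: rep_in_C)
  show ?thesis
  proof (cases l)
    case Nil
    then show ?thesis using c cc by (simp add: rep_in_C)
  next
    case (Cons r l')
    show ?thesis
    proof (cases "r = \<one>")
      case True
      then have n: "nontriv (\<not> i) (tr c l')" using tr_nontriv c l Cons by (auto simp: verts_Cons)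
      have "flip (tr c l') = \<one> # tr c l'" using n by (cases "tr c l'") auto
      then show ?thesis using True Cons by (simp add: tr1 del: tr.simps)
    next
      case False
      then show ?thesis using Cons by (simp add: tr1 del: tr.simps)
    qed
  qed
qed

text \<open>Each factor acts by \<open>tr\<close> in the tree rooted at its own vertex; all vertices
  are written with respect to the root \<open>Bs True\<close>.\<close>

definition factor_act :: "bool \<Rightarrow> 'a \<Rightarrow> 'a list \<Rightarrow> 'a list" where
  "factor_act i g l = (if i then tr g l else flip (tr g (flip l)))"

lemma verts_carr: "l \<in> verts i \<Longrightarrow> \<forall>r\<in>set l. r \<in> carrier G" using verts_rep by blast

lemma factor_act_closed: "g \<in> Bs i \<Longrightarrow> l \<in> verts True \<Longrightarrow> factor_act i g l \<in> verts True"
  using flip_verts[of l True] tr_verts[of g False "flip l"] flip_verts[of "tr g (flip l)" False] tr_verts[of g True l]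
  by (cases i) (auto simp: factor_act_def)

lemma factor_act_mult:
  assumes "g \<in> Bs i" "h \<in> Bs i" "l \<in> verts True"
  shows "factor_act i (g \<otimes> h) l = factor_act i g (factor_act i h l)"
proof -
  have gh: "g \<in> carrier G" "h \<in> carrier G" using assms Bs_carr by auto
  show ?thesis
  proof (cases i)
    case True
    then show ?thesis using tr_mult[OF gh verts_carr[OF assms(3)]] by (simp add: factor_act_def)
  next
    case False
    have f: "flip l \<in> verts False" using flip_verts[of l True] assms by simp
    then have "tr h (flip l) \<in> verts False" using tr_verts assms False by simp
    then show ?thesis using tr_mult[OF gh verts_carr[OF f]] False by (simp add: factor_act_def)
  qed
qed

lemma factor_act_one: "l \<in> verts True \<Longrightarrow> factor_act i \<one> l = l"
  using tr_one[OF verts_rep] flip_verts[of l True] by (cases i) (auto simp: factor_act_def)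

lemma factor_act_C: "c \<in> C \<Longrightarrow> l \<in> verts True \<Longrightarrow> factor_act i c l = factor_act j c l"
  using flip_tr_C by (cases i; cases j) (auto simp: factor_act_def)

lemma dl_tr: "g \<in> carrier G \<Longrightarrow> u \<in> verts i \<Longrightarrow> v \<in> verts i \<Longrightarrow> dl (tr g u) (tr g v) = dl u v"
  using lcp_tr[of g u v] verts_rep by (simp add: dl_def)

lemma dl_factor_act:
  assumes "g \<in> Bs i" "u \<in> verts True" "v \<in> verts True"
  shows "dl (factor_act i g u) (factor_act i g v) = dl u v"
proof (cases i)
  case True
  then show ?thesis using dl_tr assms Bs_carr by (simp add: factor_act_def)
next
  case False
  have f: "flip u \<in> verts False" "flip v \<in> verts False" using flip_verts[of _ True] assms by auto
  then have "tr g (flip u) \<in> verts False" "tr g (flip v) \<in> verts False" using tr_verts assms False by auto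
  then have "dl (factor_act i g u) (factor_act i g v) = dl (tr g (flip u)) (tr g (flip v))"
    using False dl_flip by (simp add: factor_act_def)
  also have "\<dots> = dl (flip u) (flip v)" using dl_tr[OF Bs_carr[OF assms(1)]] f by simp
  finally show ?thesis using dl_flip assms by simp
qed

lemma even_length_factor_act:
  assumes "g \<in> Bs i" "l \<in> verts True"
  shows "even (length (factor_act i g l)) \<longleftrightarrow> even (length l)"
proof (cases i)
  case False
  have f: "flip l \<in> verts False" using flip_verts[of _ True] assms by auto
  then have "tr g (flip l) \<in> verts False" using tr_verts assms False by auto
  then show ?thesis using False length_flip[OF assms(2)] length_flip[of "tr g (flip l)" False] by (auto simp: factor_act_def)
qed (simp add: factor_act_def)

text \<open>The subset of the group that a vertex stands for. It depends equivariantly on the vertex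
  and bounds stabilisers from above.\<close>

definition coset :: "bool \<Rightarrow> 'a list \<Rightarrow> 'a set" where
  "coset i l = foldr (\<otimes>) l \<one> <# Bs (if even (length l) then i else \<not> i)"

lemma prod_carr: "\<forall>r\<in>set l. r \<in> carrier G \<Longrightarrow> foldr (\<otimes>) l \<one> \<in> carrier G"
  by (induction l) auto

lemma tr_carr: "g \<in> carrier G \<Longrightarrow> \<forall>r\<in>set l. r \<in> carrier G \<Longrightarrow> \<forall>r\<in>set (tr g l). r \<in> carrier G"
proof (induction l arbitrary: g)
  case (Cons r l)
  have "inv (rep (g \<otimes> r)) \<otimes> (g \<otimes> r) \<in> carrier G" using Cons.prems by simp
  from Cons.IH[OF this] show ?case using Cons.prems unfolding tr.simps list.set by simp
qed simp

text \<open>The remainders of \<open>tr\<close> telescope. For a nonempty list the final one lies in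
  \<open>C\<close>, hence in both factors; for the empty list it is \<open>g\<close> itself.\<close>

lemma tr_prod:
  assumes "g \<in> carrier G" "\<forall>r\<in>set l. r \<in> carrier G"
  shows "\<exists>c. (if l = [] then c = g else c \<in> C) \<and> g \<otimes> foldr (\<otimes>) l \<one> = foldr (\<otimes>) (tr g l) \<one> \<otimes> c"
  using assms
proof (induction l arbitrary: g)
  case (Cons r l)
  let ?s = "rep (g \<otimes> r)"
  let ?c = "inv ?s \<otimes> (g \<otimes> r)"
  have c: "r \<in> carrier G" "?s \<in> carrier G" "?c \<in> carrier G" "?c \<in> C" using Cons.prems rep_C by auto
  obtain c' where c': "if l = [] then c' = ?c else c' \<in> C" "?c \<otimes> foldr (\<otimes>) l \<one> = foldr (\<otimes>) (tr ?c l) \<one> \<otimes> c'"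
    using Cons.IH[of ?c] Cons.prems c by auto
  have lc: "\<forall>r\<in>set l. r \<in> carrier G" using Cons.prems by simp
  have c'C: "c' \<in> C" using c' c by (auto split: if_splits)
  have p: "foldr (\<otimes>) l \<one> \<in> carrier G" "foldr (\<otimes>) (tr ?c l) \<one> \<in> carrier G" "c' \<in> carrier G"
    using prod_carr[OF lc] prod_carr[OF tr_carr[OF c(3) lc]] C_carr[OF c'C] by blast+
  have "g \<otimes> (r \<otimes> foldr (\<otimes>) l \<one>) = ?s \<otimes> (?c \<otimes> foldr (\<otimes>) l \<one>)"
  proof -
    have "?s \<otimes> (inv ?s \<otimes> (g \<otimes> (r \<otimes> foldr (\<otimes>) l \<one>))) = g \<otimes> (r \<otimes> foldr (\<otimes>) l \<one>)"
      using c p Cons.prems by (simp flip: m_assoc)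
    then show ?thesis using c p Cons.prems by (simp add: m_assoc)
  qed
  also have "\<dots> = ?s \<otimes> foldr (\<otimes>) (tr ?c l) \<one> \<otimes> c'"
    unfolding c'(2) by (rule m_assoc[symmetric, OF c(2) p(2,3)])
  finally have "g \<otimes> foldr (\<otimes>) (r # l) \<one> = foldr (\<otimes>) (tr g (r # l)) \<one> \<otimes> c'" by simp
  then show ?case using c'C by (intro exI[of _ c']) (simp del: foldr.simps tr.simps)
qed simp

lemma Bs_l_coset: "x \<in> carrier G \<Longrightarrow> b \<in> Bs i \<Longrightarrow> (x \<otimes> b) <# Bs i = x <# Bs i"
  by (metis Bs Bs_carr coset_join3 lcos_m_assoc subgroup.subset)

lemma coset_tr:
  assumes "g \<in> Bs i" "l \<in> verts i"
  shows "coset i (tr g l) = g <# coset i l"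
proof -
  have g: "g \<in> carrier G" "\<forall>r\<in>set l. r \<in> carrier G" using assms Bs_carr verts_carr by auto
  obtain c where c: "if l = [] then c = g else c \<in> C" "g \<otimes> foldr (\<otimes>) l \<one> = foldr (\<otimes>) (tr g l) \<one> \<otimes> c"
    using tr_prod[OF g] by blast
  let ?B = "Bs (if even (length l) then i else \<not> i)"
  have cB: "c \<in> ?B" using c(1) CB assms(1) by (auto split: if_splits)
  have p: "foldr (\<otimes>) l \<one> \<in> carrier G" "foldr (\<otimes>) (tr g l) \<one> \<in> carrier G"
    using prod_carr[OF g(2)] prod_carr[OF tr_carr[OF g]] by blast+
  have sub: "?B \<subseteq> carrier G" using Bs_carr by blast
  have "g <# coset i l = (g \<otimes> foldr (\<otimes>) l \<one>) <# ?B"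
    unfolding coset_def using lcos_m_assoc[OF sub g(1) p(1)] by simp
  also have "\<dots> = foldr (\<otimes>) (tr g l) \<one> <# ?B" unfolding c(2) using Bs_l_coset p(2) cB by blast
  finally show ?thesis by (simp add: coset_def)
qed

lemma coset_flip: "l \<in> verts i \<Longrightarrow> coset (\<not> i) (flip l) = coset i l"
proof -
  assume l: "l \<in> verts i"
  have "foldr (\<otimes>) (flip l) \<one> = foldr (\<otimes>) l \<one>"
  proof (cases l)
    case (Cons r l')
    have "r \<in> carrier G" "foldr (\<otimes>) l' \<one> \<in> carrier G"
      using verts_carr[OF l] prod_carr[of l'] Cons by auto
    then show ?thesis using Cons by simp
  qed simp
  then show ?thesis unfolding coset_def using length_flip[OF l] by simp
qed

lemma coset_factor_act:
  assumes "g \<in> Bs i" "l \<in> verts True"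
  shows "coset True (factor_act i g l) = g <# coset True l"
proof (cases i)
  case True
  then show ?thesis using coset_tr assms by (simp add: factor_act_def)
next
  case False
  have f: "flip l \<in> verts False" using flip_verts[of _ True] assms by auto
  then have t: "tr g (flip l) \<in> verts False" using tr_verts assms False by auto
  have "coset True (factor_act i g l) = coset False (tr g (flip l))"
    using coset_flip[OF t] False by (simp add: factor_act_def)
  also have "\<dots> = g <# coset False (flip l)" using coset_tr f assms False by simp
  also have "coset False (flip l) = coset True l" using coset_flip[OF assms(2)] by simp
  finally show ?thesis .
qed

end

section \<open>Orbits and stabilisers of the vertices\<close>

locale amalgam_action = amalgam + set_action G "verts True" act for act +
  assumes act_factor: "g \<in> Bs i \<Longrightarrow> l \<in> verts True \<Longrightarrow> act g l = factor_act i g l"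
    and generated: "generate G (Bs True \<union> Bs False) = carrier G"
begin

lemma group_element_induct [consumes 1, case_names factor mult]:
  assumes "g \<in> carrier G" "\<And>i g. g \<in> Bs i \<Longrightarrow> P g"
    and mult: "\<And>g h. g \<in> carrier G \<Longrightarrow> h \<in> carrier G \<Longrightarrow> P g \<Longrightarrow> P h \<Longrightarrow> P (g \<otimes> h)"
  shows "P g"
proof -
  have g: "g \<in> generate G (Bs True \<union> Bs False)" using assms generated by simp
  have sub: "Bs True \<union> Bs False \<subseteq> carrier G" using Bs_carr by auto
  from g show ?thesis
  proof (induction rule: generate.induct)
    case one
    then show ?case using assms(2) subgroup.one_closed[OF Bs] by blast
  next
    case (incl h)
    then show ?case using assms(2) by blast
  next
    case (inv h)
    then show ?case using assms(2) subgroup.m_inv_closed[OF Bs] by blast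
  next
    case (eng h1 h2)
    then show ?case using mult generate_in_carrier[OF sub] by blast
  qed
qed

lemma dl_act: "g \<in> carrier G \<Longrightarrow> u \<in> verts True \<Longrightarrow> v \<in> verts True \<Longrightarrow> dl (act g u) (act g v) = dl u v"
proof (induction g arbitrary: u v rule: group_element_induct)
  case (factor i g)
  then show ?case using dl_factor_act act_factor by simp
next
  case (mult g h)
  then show ?case by (simp add: act_mult)
qed

lemma even_length_act: "g \<in> carrier G \<Longrightarrow> l \<in> verts True \<Longrightarrow> even (length (act g l)) \<longleftrightarrow> even (length l)"
proof (induction g arbitrary: l rule: group_element_induct)
  case (factor i g)
  then show ?case using even_length_factor_act act_factor by simp
next
  case (mult g h)
  then show ?case by (simp add: act_mult)
qed

lemma coset_carr: "l \<in> verts True \<Longrightarrow> coset True l \<subseteq> carrier G"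
  unfolding coset_def using prod_carr[OF verts_carr] Bs_carr by (intro l_coset_subset_G) auto

lemma coset_act: "g \<in> carrier G \<Longrightarrow> l \<in> verts True \<Longrightarrow> coset True (act g l) = g <# coset True l"
proof (induction g arbitrary: l rule: group_element_induct)
  case (factor i g)
  then show ?case using coset_factor_act act_factor by simp
next
  case (mult g h)
  then show ?case using lcos_m_assoc[OF coset_carr] by (simp add: act_mult)
qed

text \<open>An element fixing a base vertex preserves the corresponding coset, which is the factor
  itself, and so it lies in the factor. Conversely each factor fixes its own root by
  construction.\<close>

lemma base_stabiliser:
  assumes "g \<in> carrier G"
  shows "act g [] = [] \<longleftrightarrow> g \<in> Bs True" "act g [\<one>] = [\<one>] \<longleftrightarrow> g \<in> Bs False"
proof -
  have v: "[] \<in> verts True" "[\<one>] \<in> verts True" using subgroup.one_closed[OF Bs] by (auto simp: verts_Cons)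
  have cos: "g <# Bs i = Bs i \<Longrightarrow> g \<in> Bs i" for i
  proof -
    assume e: "g <# Bs i = Bs i"
    have "g \<otimes> \<one> \<in> g <# Bs i" using subgroup.one_closed[OF Bs, of i] unfolding l_coset_def by blast
    then show "g \<in> Bs i" using assms e by simp
  qed
  have one: "\<one> <# Bs i = Bs i" for i using Bs_carr by (intro lcos_mult_one) auto
  show "act g [] = [] \<longleftrightarrow> g \<in> Bs True"
  proof
    assume "act g [] = []"
    then have "g <# coset True [] = coset True []" using coset_act[OF assms v(1)] by simp
    then show "g \<in> Bs True" using cos one by (simp add: coset_def)
  next
    assume "g \<in> Bs True"
    then show "act g [] = []" using act_factor v by (simp add: factor_act_def)
  qed
  show "act g [\<one>] = [\<one>] \<longleftrightarrow> g \<in> Bs False"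
  proof
    assume "act g [\<one>] = [\<one>]"
    then have "g <# coset True [\<one>] = coset True [\<one>]" using coset_act[OF assms v(2)] by simp
    then show "g \<in> Bs False" using cos one by (simp add: coset_def)
  next
    assume "g \<in> Bs False"
    then show "act g [\<one>] = [\<one>]" using act_factor[of g False] v by (simp add: factor_act_def)
  qed
qed

text \<open>The inverse of the first entry turns this entry into \<open>\<one>\<close>; the inverse
  of the second one, acting from the other root, then removes both. So the length drops by
  two.\<close>

lemma two_orbits:
  assumes "l \<in> verts True"
  shows "\<exists>g\<in>carrier G. act g l = [] \<or> act g l = [\<one>]"
  using assms
proof (induction "length l" arbitrary: l rule: less_induct)
  case less
  show ?case
  proof (cases l)
    case Nil
    then show ?thesis using less.prems by (intro bexI[of _ \<one>]) auto
  next
    case (Cons r l1)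
    have r: "r \<in> Bs True" "r \<in> carrier G" "rep r = r" "nontriv False l1" using less.prems Cons Bs_carr by (auto simp: verts_Cons)
    have ir: "inv r \<in> Bs True" using r subgroup.m_inv_closed[OF Bs] by blast
    have 1: "act (inv r) l = \<one> # l1"
      using act_factor[OF ir less.prems] Cons r tr_one[OF nontriv_rep[OF r(4)]] by (simp add: factor_act_def)
    have v1: "\<one> # l1 \<in> verts True" using 1 act_closed[of "inv r" l] less.prems r by simp
    show ?thesis
    proof (cases l1)
      case Nil
      then show ?thesis using 1 r by (intro bexI[of _ "inv r"]) auto
    next
      case (Cons s l2)
      have s: "s \<in> Bs False" "s \<in> carrier G" "rep s = s" "s \<noteq> \<one>" "nontriv True l2" using r Cons Bs_carr by auto
      have si: "inv s \<in> Bs False" using s subgroup.m_inv_closed[OF Bs] by blast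
      have "act (inv s) (\<one> # l1) = l2"
        using act_factor[OF si v1] Cons s tr_one[OF nontriv_rep[OF s(5)]] by (simp add: factor_act_def)
      then have 2: "act (inv s \<otimes> inv r) l = l2" using 1 r s less.prems by (simp add: act_mult)
      obtain g where g: "g \<in> carrier G" "act g l2 = [] \<or> act g l2 = [\<one>]"
        using less.hyps[of l2] nontriv_verts[OF s(5)] Cons \<open>l = r # l1\<close> by auto
      have "act (g \<otimes> (inv s \<otimes> inv r)) l = act g l2" using 2 g r s less.prems act_mult[of g "inv s \<otimes> inv r" l] by simp
      then show ?thesis using g r s by (intro bexI[of _ "g \<otimes> (inv s \<otimes> inv r)"]) auto
    qed
  qed
qed

lemma stabiliser_conjugate:
  assumes "l \<in> verts True"
  shows "\<exists>i. \<exists>k\<in>carrier G. \<forall>g\<in>carrier G. act g l = l \<longleftrightarrow> inv k \<otimes> g \<otimes> k \<in> Bs i"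
proof -
  obtain g0 where g0: "g0 \<in> carrier G" "act g0 l = [] \<or> act g0 l = [\<one>]" using two_orbits[OF assms] by blast
  have eq: "act g l = l \<longleftrightarrow> act (g0 \<otimes> g \<otimes> inv g0) (act g0 l) = act g0 l" if g: "g \<in> carrier G" for g
  proof -
    have "act (g0 \<otimes> g \<otimes> inv g0) (act g0 l) = act g0 (act g l)"
      using g g0 assms by (simp add: act_mult)
    then show ?thesis using act_inv_act[OF g0(1)] assms g act_closed by metis
  qed
  have "\<exists>i. \<forall>g\<in>carrier G. act g l = l \<longleftrightarrow> g0 \<otimes> g \<otimes> inv g0 \<in> Bs i"
    using g0(2)
  proof
    assume "act g0 l = []"
    then show ?thesis using eq base_stabiliser(1) g0 by (intro exI[of _ True]) simp
  next
    assume "act g0 l = [\<one>]"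
    then show ?thesis using eq base_stabiliser(2) g0 by (intro exI[of _ False]) simp
  qed
  then show ?thesis using g0 by (metis inv_closed inv_inv)
qed

text \<open>The parity of \<open>dl\<close> is that of the sum of the lengths, and both factors
  preserve the parity of the length; this is \<open>d_even\<close>.\<close>

sublocale tree: tree_action G "verts True" act dl
proof
  fix x y z w :: "'a list" and k :: int and g
  show "dl x y = dl y x" by (rule dl_sym)
  assume x: "x \<in> verts True"
  {
    assume g: "g \<in> carrier G"
    have "even (int (length x) + int (length (act g x)))" using even_length_act[OF g x] by simp
    then show "even (dl x (act g x))" by (simp add: dl_def)
  }
  assume y: "y \<in> verts True"
  show "dl x y = 0 \<longleftrightarrow> x = y" by (rule dl_zero)
  show "dl (act g x) (act g y) = dl x y" if "g \<in> carrier G" using dl_act that x y by simp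
  show "\<exists>z\<in>verts True. dl x z = k \<and> dl z y = dl x y - k" if "0 \<le> k" "k \<le> dl x y"
    using dl_interpolation[OF that] verts_take x y by blast
  assume z: "z \<in> verts True"
  show "even (dl x y + dl y z + dl x z)" by (rule dl_parity)
  show "dl x y + dl z w \<le> max (dl x z + dl y w) (dl x w + dl y z)" by (rule dl_four_point)
qed

end

section \<open>Artin groups\<close>

lemma presented_group_hom:
  assumes "group G" "f \<in> X \<rightarrow> carrier G"
    and rel: "\<And>r r'. (r, r') \<in> R \<Longrightarrow> r \<in> gwords X \<Longrightarrow> r' \<in> gwords X \<Longrightarrow> wev G f r = wev G f r'"
  shows "\<exists>\<phi>. group_hom (presented_group X R) G \<phi> \<and> (\<forall>w\<in>gwords X. \<phi> (pres_rel X R `` {w}) = wev G f w)"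
proof -
  interpret group G by fact
  define \<phi> where "\<phi> A = wev G f (SOME w. w \<in> A)" for A
  have \<phi>: "\<phi> (pres_rel X R `` {w}) = wev G f w" if w: "w \<in> gwords X" for w
  proof -
    let ?v = "SOME v. v \<in> pres_rel X R `` {w}"
    have "?v \<in> pres_rel X R `` {w}"
      by (rule someI[of _ w]) (use w in \<open>auto simp: pres_rel_def intro: pres_eq.refl\<close>)
    then have "pres_eq X R w ?v" by (simp add: pres_rel_def)
    then show ?thesis unfolding \<phi>_def using wev_pres_eq[OF _ assms(2) rel] by metis
  qed
  have "\<phi> \<in> hom (presented_group X R) G"
    using assms(2) by (intro homI) (auto simp: carrier_presented_group pres_mult \<phi> wev_append[of f X])
  then have "group_hom (presented_group X R) G \<phi>"
    using group_presented_group is_group by (auto simp: group_hom_def group_hom_axioms_def)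
  then show ?thesis using \<phi> by blast
qed

lemma alternating_gwords: "s \<in> T \<Longrightarrow> t \<in> T \<Longrightarrow> alternating n s t \<in> gwords T"
  by (induction n arbitrary: s t) auto

text \<open>Turns an equality between two group elements into the form in which the locale for
  cosets asks for braid relations, namely as operators of left multiplication.\<close>

lemma (in group) altseq_mult_eq:
  assumes k: "k \<in> T \<rightarrow> carrier G" and t: "t \<in> T" "t' \<in> T" and g: "g \<in> carrier G"
    and eq: "wev G k (alternating n t t') = wev G k (alternating n t' t)"
  shows "altseq (\<lambda>t g. k t \<otimes> g) t t' n g = altseq (\<lambda>t g. k t \<otimes> g) t' t n g"
proof -
  define F where "F = (\<lambda>(s, b) g. (if b then k s else inv (k s)) \<otimes> g)"
  have fold: "foldr F w g = wev G k w \<otimes> g" if "w \<in> gwords T" for w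
    using that
  proof (induction w)
    case (Cons c w)
    obtain s b where c: "c = (s, b)" by force
    have s: "k s \<in> carrier G" "wev G k w \<in> carrier G" using Cons.prems c k wev_closed[OF k] by auto
    then show ?case using Cons c g by (auto simp: F_def m_assoc)
  qed (use g in simp)
  have F: "(\<lambda>t g. k t \<otimes> g) = (\<lambda>s. F (s, True))" by (auto simp: F_def)
  have "foldr F (alternating n t t') g = foldr F (alternating n t' t) g"
    using fold[OF alternating_gwords[OF t]] fold[OF alternating_gwords[OF t(2,1)]] eq by simp
  then show ?thesis unfolding F altseq_eq_foldr by (cases "odd n") simp_all
qed

lemma (in group) generate_conj_closed:
  assumes k: "k \<in> carrier G" and H: "subgroup H G" and S: "S \<subseteq> carrier G"
    and gen: "\<And>s. s \<in> S \<Longrightarrow> k \<otimes> s \<otimes> inv k \<in> H" and x: "x \<in> generate G S"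
  shows "k \<otimes> x \<otimes> inv k \<in> H"
proof -
  interpret c: group_hom G G "\<lambda>x. k \<otimes> x \<otimes> inv k" using group_hom_conj(1)[OF k] .
  from x show ?thesis
  proof (induction rule: generate.induct)
    case one
    then show ?case using k subgroup.one_closed[OF H] by simp
  next
    case (incl h)
    then show ?case using gen by blast
  next
    case (inv h)
    then show ?case using c.hom_inv[of h] gen[of h] S subgroup.m_inv_closed[OF H] by auto
  next
    case (eng h1 h2)
    have "h1 \<in> carrier G" "h2 \<in> carrier G" using eng S generate_in_carrier by auto
    then show ?case using c.hom_mult[of h1 h2] eng subgroup.m_closed[OF H] by simp
  qed
qed

lemma (in group) conjugate_set_eq:
  assumes "k \<in> carrier G" "H \<subseteq> carrier G"
  shows "conjugate_set G k H = {x \<in> carrier G. inv k \<otimes> x \<otimes> k \<in> H}"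
proof
  show "conjugate_set G k H \<subseteq> {x \<in> carrier G. inv k \<otimes> x \<otimes> k \<in> H}"
  proof
    fix x assume "x \<in> conjugate_set G k H"
    then obtain h where h: "h \<in> H" "x = k \<otimes> h \<otimes> inv k" by (auto simp: conjugate_set_def l_coset_def r_coset_def)
    have hc: "h \<in> carrier G" using h assms by auto
    have "inv k \<otimes> (k \<otimes> (h \<otimes> (inv k \<otimes> k))) = h" using assms hc by (simp flip: m_assoc)
    then show "x \<in> {x \<in> carrier G. inv k \<otimes> x \<otimes> k \<in> H}" using h hc assms by (simp add: m_assoc)
  qed
  show "{x \<in> carrier G. inv k \<otimes> x \<otimes> k \<in> H} \<subseteq> conjugate_set G k H"
  proof
    fix x assume x: "x \<in> {x \<in> carrier G. inv k \<otimes> x \<otimes> k \<in> H}"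
    have e: "k \<otimes> (inv k \<otimes> x \<otimes> k) \<otimes> inv k = x"
    proof -
      have "k \<otimes> (inv k \<otimes> (x \<otimes> (k \<otimes> inv k))) = x" using assms x by (simp flip: m_assoc)
      then show ?thesis using assms x by (simp add: m_assoc)
    qed
    have "k \<otimes> (inv k \<otimes> x \<otimes> k) \<otimes> inv k \<in> conjugate_set G k H"
      using x unfolding conjugate_set_def l_coset_def r_coset_def by blast
    then show "x \<in> conjugate_set G k H" unfolding e .
  qed
qed

lemma (in group) subgroup_conjugate:
  assumes "k \<in> carrier G" "subgroup H G"
  shows "subgroup {x \<in> carrier G. inv k \<otimes> x \<otimes> k \<in> H} G"
proof -
  interpret H: subgroup H G by fact
  interpret c: group_hom G G "\<lambda>x. inv k \<otimes> x \<otimes> inv (inv k)" using group_hom_conj(1)[of "inv k"] assms by simp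
  show ?thesis
  proof (rule subgroupI)
    show "{x \<in> carrier G. inv k \<otimes> x \<otimes> k \<in> H} \<noteq> {}" using assms by (auto intro!: exI[of _ \<one>])
    show "inv a \<in> {x \<in> carrier G. inv k \<otimes> x \<otimes> k \<in> H}" if "a \<in> {x \<in> carrier G. inv k \<otimes> x \<otimes> k \<in> H}" for a
      using that c.hom_inv[of a] assms H.m_inv_closed by simp
    show "a \<otimes> b \<in> {x \<in> carrier G. inv k \<otimes> x \<otimes> k \<in> H}"
      if "a \<in> {x \<in> carrier G. inv k \<otimes> x \<otimes> k \<in> H}" "b \<in> {x \<in> carrier G. inv k \<otimes> x \<otimes> k \<in> H}" for a b
      using that c.hom_mult[of a b] assms H.m_closed by simp
  qed auto
qed

definition edge_label :: "'v pgraph \<Rightarrow> 'v \<Rightarrow> 'v \<Rightarrow> nat" where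
  "edge_label \<Gamma> s t = (if s \<noteq> t \<and> {s, t} \<in> Edge \<Gamma> then label \<Gamma> {s, t} else 0)"

lemma artin_gen_in_carrier [simp]: "s \<in> Vert \<Gamma> \<Longrightarrow> artin_gen \<Gamma> s \<in> carrier (artin_group \<Gamma>)"
  by (simp add: artin_gen_def artin_group_def)

lemma artin_gen_Pi: "S \<subseteq> Vert \<Gamma> \<Longrightarrow> artin_gen \<Gamma> \<in> S \<rightarrow> carrier (artin_group \<Gamma>)" by auto

lemma wev_artin_gen:
  "w \<in> gwords (Vert \<Gamma>) \<Longrightarrow>
    wev (artin_group \<Gamma>) (artin_gen \<Gamma>) w = pres_rel (Vert \<Gamma>) (artin_relations \<Gamma>) `` {w}"
proof -
  have "artin_gen \<Gamma> = (\<lambda>x. pres_rel (Vert \<Gamma>) (artin_relations \<Gamma>) `` {[(x, True)]})"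
    by (rule ext) (simp add: artin_gen_def)
  then show "w \<in> gwords (Vert \<Gamma>) \<Longrightarrow> ?thesis" by (simp add: artin_group_def wev_presented_group)
qed

lemma wev_artin_eq_iff:
  "v \<in> gwords (Vert \<Gamma>) \<Longrightarrow> w \<in> gwords (Vert \<Gamma>) \<Longrightarrow>
    wev (artin_group \<Gamma>) (artin_gen \<Gamma>) v = wev (artin_group \<Gamma>) (artin_gen \<Gamma>) w \<longleftrightarrow>
    pres_eq (Vert \<Gamma>) (artin_relations \<Gamma>) v w"
  by (simp add: wev_artin_gen pres_class_eq_iff)

lemma gwords_mono: "S \<subseteq> T \<Longrightarrow> w \<in> gwords S \<Longrightarrow> w \<in> gwords T" by (auto simp: gwords_def)

lemma standard_parabolic_wev:
  "S \<subseteq> Vert \<Gamma> \<Longrightarrow> standard_parabolic \<Gamma> S = wev (artin_group \<Gamma>) (artin_gen \<Gamma>) ` gwords S"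
  unfolding standard_parabolic_def using group.generate_eq_wev[OF group_artin_group artin_gen_Pi] .

lemma carrier_artin_wev: "carrier (artin_group \<Gamma>) = wev (artin_group \<Gamma>) (artin_gen \<Gamma>) ` gwords (Vert \<Gamma>)"
  using wev_artin_gen[of _ \<Gamma>] by (auto simp: artin_group_def carrier_presented_group image_iff)

lemma subgroup_standard_parabolic: "S \<subseteq> Vert \<Gamma> \<Longrightarrow> subgroup (standard_parabolic \<Gamma> S) (artin_group \<Gamma>)"
  unfolding standard_parabolic_def
  by (rule group.generate_is_subgroup[OF group_artin_group]) auto

lemma wev_artin_braid:
  assumes "s \<in> Vert \<Gamma>" "t \<in> Vert \<Gamma>" "edge_label \<Gamma> s t \<noteq> 0"
  shows "wev (artin_group \<Gamma>) (artin_gen \<Gamma>) (alternating (edge_label \<Gamma> s t) s t) =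
    wev (artin_group \<Gamma>) (artin_gen \<Gamma>) (alternating (edge_label \<Gamma> s t) t s)"
proof -
  let ?a = "alternating (edge_label \<Gamma> s t) s t" and ?b = "alternating (edge_label \<Gamma> s t) t s"
  have w: "?a \<in> gwords (Vert \<Gamma>)" "?b \<in> gwords (Vert \<Gamma>)" using assms alternating_gwords by auto
  have "(?a, ?b) \<in> artin_relations \<Gamma>"
    using assms(3) unfolding artin_relations_def edge_label_def by (auto split: if_splits)
  then have "pres_eq (Vert \<Gamma>) (artin_relations \<Gamma>) ?a ?b"
    using pres_eq.relation[of "[]" "Vert \<Gamma>" "[]" ?a ?b] w by simp
  then show ?thesis using wev_artin_eq_iff[OF w] by blast
qed

locale artin =
  fixes \<Gamma> :: "'v pgraph"
  assumes pg: "presentation_graph \<Gamma>"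
begin

abbreviation "V \<equiv> Vert \<Gamma>"
abbreviation "G \<equiv> artin_group \<Gamma>"
abbreviation "gen \<equiv> artin_gen \<Gamma>"

sublocale G: group G by (rule group_artin_group)

lemma finite_V: "finite V" using pg by (simp add: presentation_graph_def)

sublocale coxeter V "edge_label \<Gamma>"
proof
  show "finite V" by (rule finite_V)
  fix s t
  show "edge_label \<Gamma> s t = edge_label \<Gamma> t s" by (auto simp: edge_label_def insert_commute)
  show "edge_label \<Gamma> s t \<noteq> 1" using pg by (auto simp: edge_label_def presentation_graph_def)
qed

lemma relation_form:
  assumes "(r, r') \<in> artin_relations \<Gamma>"
  shows "\<exists>s t. s \<in> V \<and> t \<in> V \<and> s \<noteq> t \<and> {s, t} \<in> Edge \<Gamma> \<and> edge_label \<Gamma> s t \<noteq> 0 \<and>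
    r = alternating (edge_label \<Gamma> s t) s t \<and> r' = alternating (edge_label \<Gamma> s t) t s"
proof -
  obtain s t where st: "{s, t} \<in> Edge \<Gamma>" "r = alternating (label \<Gamma> {s, t}) s t" "r' = alternating (label \<Gamma> {s, t}) t s"
    using assms by (auto simp: artin_relations_def)
  obtain a b where ab: "{s, t} = {a, b}" "a \<in> V" "b \<in> V" "a \<noteq> b"
    using st(1) pg unfolding presentation_graph_def by blast
  have "s \<noteq> t" "s \<in> V" "t \<in> V" using ab by (auto simp: doubleton_eq_iff)
  moreover have "label \<Gamma> {s, t} \<ge> 2" using st pg by (simp add: presentation_graph_def)
  ultimately show ?thesis using st by (intro exI[of _ s] exI[of _ t]) (simp add: edge_label_def)
qed

lemma coxeter_coset_subgraph:
  assumes "induced_subgraph \<Delta> \<Gamma>"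
  shows "coxeter_coset V (edge_label \<Gamma>) (artin_group \<Delta>) (Vert \<Delta>) (artin_gen \<Delta>)"
proof -
  interpret D: group "artin_group \<Delta>" by (rule group_artin_group)
  show ?thesis
  proof
    show "Vert \<Delta> \<subseteq> V" using assms by (simp add: induced_subgraph_def)
    fix t t' g assume t: "t \<in> Vert \<Delta>" "t' \<in> Vert \<Delta>" "t \<noteq> t'" "edge_label \<Gamma> t t' \<noteq> 0" and g: "g \<in> carrier (artin_group \<Delta>)"
    have "{t, t'} \<in> Edge \<Delta>" using assms t by (auto simp: induced_subgraph_def edge_label_def split: if_splits)
    then have "edge_label \<Delta> t t' = edge_label \<Gamma> t t'"
      using assms t by (auto simp: induced_subgraph_def edge_label_def)
    then show "altseq (\<lambda>t g. artin_gen \<Delta> t \<otimes>\<^bsub>artin_group \<Delta>\<^esub> g) t t' (edge_label \<Gamma> t t') g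
        = altseq (\<lambda>t g. artin_gen \<Delta> t \<otimes>\<^bsub>artin_group \<Delta>\<^esub> g) t' t (edge_label \<Gamma> t t') g"
      using D.altseq_mult_eq[OF artin_gen_Pi[OF order_refl] t(1,2) g] wev_artin_braid[of t \<Delta> t'] t by simp
  qed (auto)
qed

lemma coxeter_coset_parabolic:
  assumes "S \<subseteq> V"
  shows "coxeter_coset V (edge_label \<Gamma>) G S gen"
proof
  show "S \<subseteq> V" by fact
  fix t t' g assume t: "t \<in> S" "t' \<in> S" "t \<noteq> t'" "edge_label \<Gamma> t t' \<noteq> 0" and g: "g \<in> carrier G"
  show "altseq (\<lambda>t g. gen t \<otimes>\<^bsub>G\<^esub> g) t t' (edge_label \<Gamma> t t') g
      = altseq (\<lambda>t g. gen t \<otimes>\<^bsub>G\<^esub> g) t' t (edge_label \<Gamma> t t') g"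
    using G.altseq_mult_eq[OF artin_gen_Pi[OF assms] t(1,2) g] wev_artin_braid[of t \<Gamma> t'] t assms by auto
qed (use assms in auto)

text \<open>In the coset action with values in \<open>artin_group \<Delta>\<close>, a word over
  \<open>\<Delta>\<close> carries the base pair to the base coset together with its value in
  \<open>artin_group \<Delta>\<close>. A word trivial in the large group acts trivially, so this
  value is one.\<close>

lemma subgraph_injective:
  assumes ind: "induced_subgraph \<Delta> \<Gamma>" and w: "w \<in> gwords (Vert \<Delta>)"
    and triv: "pres_eq V (artin_relations \<Gamma>) w []"
  shows "pres_eq (Vert \<Delta>) (artin_relations \<Delta>) w []"
proof -
  interpret D: coxeter_coset V "edge_label \<Gamma>" "artin_group \<Delta>" "Vert \<Delta>" "artin_gen \<Delta>"
    by (rule coxeter_coset_subgraph[OF ind])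
  have z: "(id, \<one>\<^bsub>artin_group \<Delta>\<^esub>) \<in> D.X \<times> carrier (artin_group \<Delta>)" using D.id_in_X by simp
  have "foldr D.step w (id, \<one>\<^bsub>artin_group \<Delta>\<^esub>) = foldr D.step [] (id, \<one>\<^bsub>artin_group \<Delta>\<^esub>)"
    using relation_form by (intro D.foldr_step_pres_eq[OF triv z]) blast
  moreover have c: "wev (artin_group \<Delta>) (artin_gen \<Delta>) w \<in> carrier (artin_group \<Delta>)"
    using D.wev_closed[OF artin_gen_Pi[OF order_refl] w] .
  ultimately have "wev (artin_group \<Delta>) (artin_gen \<Delta>) w = \<one>\<^bsub>artin_group \<Delta>\<^esub>"
    using D.foldr_step_word[OF w D.one_closed] by simp
  then have "wev (artin_group \<Delta>) (artin_gen \<Delta>) w = wev (artin_group \<Delta>) (artin_gen \<Delta>) []" by simp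
  then show ?thesis using wev_artin_eq_iff[OF w gwords_Nil] by blast
qed

lemma parabolic_pair_alternative:
  assumes ind: "induced_subgraph \<Delta> \<Gamma>" and pa: "power_alternative (artin_group \<Delta>)"
    and gh: "g \<in> standard_parabolic \<Gamma> (Vert \<Delta>)" "h \<in> standard_parabolic \<Gamma> (Vert \<Delta>)"
  shows "pair_alternative G g h"
proof -
  have sub: "Vert \<Delta> \<subseteq> V" using ind by (simp add: induced_subgraph_def)
  let ?D = "artin_group \<Delta>" and ?c = "\<lambda>w. pres_rel (Vert \<Delta>) (artin_relations \<Delta>) `` {w}"
  have "\<exists>\<phi>. group_hom (presented_group (Vert \<Delta>) (artin_relations \<Delta>)) G \<phi> \<and> (\<forall>w\<in>gwords (Vert \<Delta>). \<phi> (?c w) = wev G gen w)"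
  proof (rule presented_group_hom[OF group_artin_group artin_gen_Pi[OF sub]])
    fix r r' assume r: "(r, r') \<in> artin_relations \<Delta>" and w: "r \<in> gwords (Vert \<Delta>)" "r' \<in> gwords (Vert \<Delta>)"
    have "(r, r') \<in> artin_relations \<Gamma>"
      using r ind by (force simp: artin_relations_def induced_subgraph_def)
    then have "pres_eq V (artin_relations \<Gamma>) r r'"
      using pres_eq.relation[of "[]" V "[]" r r'] gwords_mono[OF sub] w by simp
    then show "wev G gen r = wev G gen r'" using wev_artin_eq_iff gwords_mono[OF sub] w by blast
  qed
  then obtain \<phi> where \<phi>: "group_hom ?D G \<phi>" "\<And>w. w \<in> gwords (Vert \<Delta>) \<Longrightarrow> \<phi> (?c w) = wev G gen w"
    by (auto simp: artin_group_def)
  interpret \<phi>: group_hom ?D G \<phi> by (rule \<phi>(1))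
  have carr: "carrier ?D = ?c ` gwords (Vert \<Delta>)" by (simp add: artin_group_def carrier_presented_group)
  have inj: "inj_on \<phi> (carrier ?D)"
  proof (rule \<phi>.inj_on_one_iff[THEN iffD2], intro allI impI)
    fix A assume A: "A \<in> carrier ?D" "\<phi> A = \<one>\<^bsub>G\<^esub>"
    then obtain w where w: "w \<in> gwords (Vert \<Delta>)" "A = ?c w" using carr by auto
    have "wev G gen w = wev G gen []" using A w \<phi>(2) by simp
    then have "pres_eq V (artin_relations \<Gamma>) w []"
      using wev_artin_eq_iff[OF gwords_mono[OF sub w(1)] gwords_Nil] by (simp only:)
    then have "pres_eq (Vert \<Delta>) (artin_relations \<Delta>) w []" using subgraph_injective[OF ind w(1)] by blast
    then show "A = \<one>\<^bsub>?D\<^esub>" using w pres_class_eq_one[OF w(1)] by (simp add: artin_group_def)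
  qed
  obtain v w where vw: "v \<in> gwords (Vert \<Delta>)" "w \<in> gwords (Vert \<Delta>)" "g = \<phi> (?c v)" "h = \<phi> (?c w)"
    using gh \<phi>(2) by (auto simp: standard_parabolic_wev[OF sub])
  have c: "?c v \<in> carrier ?D" "?c w \<in> carrier ?D" using vw carr by auto
  then have "pair_alternative ?D (?c v) (?c w)" using pa by (simp add: power_alternative_iff)
  then show ?thesis using pair_alternative_inj_hom[OF \<phi>(1) inj c] vw by simp
qed

text \<open>In the action on minimal coset representatives, every \<open>s \<in> S\<close> fixes the coset of \<open>g\<inverse>\<close>, so
  one element of \<open>A\<^sub>S\<close> conjugates all \<open>g s g\<inverse>\<close> to generators, and by finiteness these
  exhaust \<open>S\<close>.\<close>

lemma standard_parabolic_conj:
  assumes S: "S \<subseteq> V" and g: "g \<in> carrier G"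
    and sub: "\<And>x. x \<in> standard_parabolic \<Gamma> S \<Longrightarrow> g \<otimes>\<^bsub>G\<^esub> x \<otimes>\<^bsub>G\<^esub> inv\<^bsub>G\<^esub> g \<in> standard_parabolic \<Gamma> S"
    and x: "x \<in> standard_parabolic \<Gamma> S"
  shows "inv\<^bsub>G\<^esub> g \<otimes>\<^bsub>G\<^esub> x \<otimes>\<^bsub>G\<^esub> g \<in> standard_parabolic \<Gamma> S"
proof -
  let ?A = "standard_parabolic \<Gamma> S"
  interpret A: subgroup ?A G by (rule subgroup_standard_parabolic[OF S])
  interpret D: coxeter_coset V "edge_label \<Gamma>" G S gen by (rule coxeter_coset_parabolic[OF S])
  have genA: "gen s \<in> ?A" if "s \<in> S" for s using that unfolding standard_parabolic_def by (auto intro: generate.incl)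
  obtain w where w: "w \<in> gwords V" "inv\<^bsub>G\<^esub> g = wev G gen w"
    using G.inv_closed[OF g] by (auto simp: carrier_artin_wev)
  obtain y b where yb: "foldr D.step w (id, \<one>\<^bsub>G\<^esub>) = (y, b)" by force
  \<comment> \<open>The values multiplied on are generators from \<open>S\<close> or their inverses,
    so the second entry never leaves the parabolic subgroup, although \<open>w\<close> is a word in
    all generators.\<close>
  have "foldr D.step w (id, \<one>\<^bsub>G\<^esub>) \<in> D.X \<times> ?A"
  proof (rule foldr_closed[OF w(1)])
    fix s c z assume "s \<in> V" "z \<in> D.X \<times> ?A"
    then show "D.step (s, c) z \<in> D.X \<times> ?A"
      using D.hitsD genA by (cases z) (auto simp: D.X_step)
  qed (simp add: D.id_in_X)
  then have y: "y \<in> D.X" and b: "b \<in> ?A" using yb by auto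
  have bc: "b \<in> carrier G" using b by simp
  have yW: "y \<in> W" using y by (simp add: D.X_def)
  have key: "D.hit y s \<in> S \<and> y (e (D.hit y s)) = e s \<and> gen (D.hit y s) \<otimes>\<^bsub>G\<^esub> b = b \<otimes>\<^bsub>G\<^esub> (g \<otimes>\<^bsub>G\<^esub> gen s \<otimes>\<^bsub>G\<^esub> inv\<^bsub>G\<^esub> g)"
    if s: "s \<in> S" for s
  proof -
    let ?a = "g \<otimes>\<^bsub>G\<^esub> gen s \<otimes>\<^bsub>G\<^esub> inv\<^bsub>G\<^esub> g"
    have sV: "s \<in> V" "gen s \<in> carrier G" using s S by auto
    have aA: "?a \<in> ?A" using sub[OF genA[OF s]] .
    then have ac: "?a \<in> carrier G" by simp
    obtain u where u: "u \<in> gwords S" "?a = wev G gen u" using aA by (auto simp: standard_parabolic_wev[OF S])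
    have uV: "u \<in> gwords V" using gwords_mono[OF S u(1)] .
    have "wev G gen ((s, True) # w) = gen s \<otimes>\<^bsub>G\<^esub> inv\<^bsub>G\<^esub> g" by (simp add: w)
    moreover have "wev G gen (w @ u) = inv\<^bsub>G\<^esub> g \<otimes>\<^bsub>G\<^esub> ?a"
      using G.wev_append[OF artin_gen_Pi[OF order_refl] w(1) uV] w(2) u(2) by simp
    moreover have "inv\<^bsub>G\<^esub> g \<otimes>\<^bsub>G\<^esub> ?a = gen s \<otimes>\<^bsub>G\<^esub> inv\<^bsub>G\<^esub> g"
    proof -
      have "inv\<^bsub>G\<^esub> g \<otimes>\<^bsub>G\<^esub> (g \<otimes>\<^bsub>G\<^esub> (gen s \<otimes>\<^bsub>G\<^esub> inv\<^bsub>G\<^esub> g)) = gen s \<otimes>\<^bsub>G\<^esub> inv\<^bsub>G\<^esub> g"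
        using g sV by (simp flip: G.m_assoc)
      then show ?thesis using g sV by (simp add: G.m_assoc)
    qed
    ultimately have "wev G gen ((s, True) # w) = wev G gen (w @ u)" by simp
    then have eq: "pres_eq V (artin_relations \<Gamma>) ((s, True) # w) (w @ u)"
      using wev_artin_eq_iff[of "(s, True) # w" \<Gamma> "w @ u"] w(1) uV sV by simp
    have z: "(id, \<one>\<^bsub>G\<^esub>) \<in> D.X \<times> carrier G" using D.id_in_X by simp
    \<comment> \<open>The words \<open>s w\<close> and \<open>w u\<close> both spell
      \<open>gen s\<close> times the inverse of \<open>g\<close>. On the base pair the second keeps
      the coset \<open>y\<close> and multiplies the value on the right by \<open>?a\<close>; so
      \<open>s\<close> must hit \<open>y\<close>, and comparing values conjugates \<open>?a\<close>
      to a generator.\<close>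
    have "foldr D.step ((s, True) # w) (id, \<one>\<^bsub>G\<^esub>) = foldr D.step (w @ u) (id, \<one>\<^bsub>G\<^esub>)"
      using relation_form by (intro D.foldr_step_pres_eq[OF eq z]) blast
    also have "\<dots> = foldr D.step w (id, \<one>\<^bsub>G\<^esub> \<otimes>\<^bsub>G\<^esub> ?a)"
      using D.foldr_step_word[OF u(1) G.one_closed] u(2) ac by simp
    also have "\<dots> = (y, b \<otimes>\<^bsub>G\<^esub> ?a)"
      using D.foldr_step_right[OF w(1) z ac] yb by simp
    finally have st: "D.step (s, True) (y, b) = (y, b \<otimes>\<^bsub>G\<^esub> ?a)" by (simp add: yb)
    have h: "D.hits y s"
    proof (rule ccontr)
      assume "\<not> D.hits y s"
      then have "\<sigma> s \<circ> y = y" using st by (simp only: D.step.simps if_False prod.inject)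
      then show False using D.\<sigma>_comp_neq[OF yW sV(1)] by simp
    qed
    then have "gen (D.hit y s) \<otimes>\<^bsub>G\<^esub> b = b \<otimes>\<^bsub>G\<^esub> ?a" using st by (simp only: D.step.simps if_True prod.inject)
    then show ?thesis using D.hitsD[OF h] by blast
  qed
  have "inj_on (D.hit y) S"
  proof (rule inj_onI)
    fix s s' assume "s \<in> S" "s' \<in> S" "D.hit y s = D.hit y s'"
    then have "e s = e s'" using key by metis
    then show "s = s'" by (rule D.e_inj)
  qed
  moreover have "D.hit y ` S \<subseteq> S" using key by blast
  ultimately have surj: "D.hit y ` S = S"
    using endo_inj_surj[of S "D.hit y"] finite_subset[OF S finite_V] by blast
  \<comment> \<open>Differs from the inverse of \<open>g\<close> only by an element of the parabolic
    subgroup, but conjugation by it sends each generator from \<open>S\<close> to such a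
    generator.\<close>
  let ?k = "inv\<^bsub>G\<^esub> g \<otimes>\<^bsub>G\<^esub> inv\<^bsub>G\<^esub> b"
  have kc: "?k \<in> carrier G" using g bc by simp
  have ik: "inv\<^bsub>G\<^esub> ?k = b \<otimes>\<^bsub>G\<^esub> g" using g bc by (simp add: G.inv_mult_group)
  have gens: "?k \<otimes>\<^bsub>G\<^esub> r \<otimes>\<^bsub>G\<^esub> inv\<^bsub>G\<^esub> ?k \<in> ?A" if rS: "r \<in> gen ` S" for r
  proof -
    obtain t where t: "t \<in> S" "r = gen t" using rS by blast
    have "t \<in> D.hit y ` S" unfolding surj by (rule t(1))
    then obtain s where s0: "s \<in> S" "t = D.hit y s" by (elim imageE)
    have s: "s \<in> S" "r = gen (D.hit y s)" using s0 t by (simp_all only:)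
    have sc: "gen s \<in> carrier G" "r \<in> carrier G" using s S key[OF s(1)] by auto
    have rb: "r \<otimes>\<^bsub>G\<^esub> b = b \<otimes>\<^bsub>G\<^esub> (g \<otimes>\<^bsub>G\<^esub> gen s \<otimes>\<^bsub>G\<^esub> inv\<^bsub>G\<^esub> g)" unfolding s(2) using key[OF s(1)] by blast
    have "?k \<otimes>\<^bsub>G\<^esub> r \<otimes>\<^bsub>G\<^esub> inv\<^bsub>G\<^esub> ?k = inv\<^bsub>G\<^esub> g \<otimes>\<^bsub>G\<^esub> (inv\<^bsub>G\<^esub> b \<otimes>\<^bsub>G\<^esub> (r \<otimes>\<^bsub>G\<^esub> b)) \<otimes>\<^bsub>G\<^esub> g"
      unfolding ik using g bc sc by (simp add: G.m_assoc)
    also have "\<dots> = inv\<^bsub>G\<^esub> g \<otimes>\<^bsub>G\<^esub> (inv\<^bsub>G\<^esub> b \<otimes>\<^bsub>G\<^esub> (b \<otimes>\<^bsub>G\<^esub> (g \<otimes>\<^bsub>G\<^esub> gen s \<otimes>\<^bsub>G\<^esub> inv\<^bsub>G\<^esub> g))) \<otimes>\<^bsub>G\<^esub> g"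
      unfolding rb ..
    also have "\<dots> = gen s"
    proof -
      have 1: "inv\<^bsub>G\<^esub> b \<otimes>\<^bsub>G\<^esub> (b \<otimes>\<^bsub>G\<^esub> (g \<otimes>\<^bsub>G\<^esub> gen s \<otimes>\<^bsub>G\<^esub> inv\<^bsub>G\<^esub> g)) = g \<otimes>\<^bsub>G\<^esub> gen s \<otimes>\<^bsub>G\<^esub> inv\<^bsub>G\<^esub> g"
        using g bc sc by (simp flip: G.m_assoc)
      have 2: "inv\<^bsub>G\<^esub> g \<otimes>\<^bsub>G\<^esub> (g \<otimes>\<^bsub>G\<^esub> gen s \<otimes>\<^bsub>G\<^esub> inv\<^bsub>G\<^esub> g) = gen s \<otimes>\<^bsub>G\<^esub> inv\<^bsub>G\<^esub> g"
        using g sc by (simp flip: G.m_assoc)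
      show ?thesis unfolding 1 2 using g sc by (simp add: G.m_assoc)
    qed
    finally show ?thesis using genA s by simp
  qed
  define x' where "x' = b \<otimes>\<^bsub>G\<^esub> x \<otimes>\<^bsub>G\<^esub> inv\<^bsub>G\<^esub> b"
  have xc: "x \<in> carrier G" using x by simp
  have x'A: "x' \<in> ?A" using x b by (simp add: x'_def)
  have genS: "gen ` S \<subseteq> carrier G" using S by auto
  have "?k \<otimes>\<^bsub>G\<^esub> x' \<otimes>\<^bsub>G\<^esub> inv\<^bsub>G\<^esub> ?k \<in> ?A"
    by (rule G.generate_conj_closed[OF kc A.subgroup_axioms genS gens x'A[unfolded standard_parabolic_def]])
  moreover have "?k \<otimes>\<^bsub>G\<^esub> x' \<otimes>\<^bsub>G\<^esub> inv\<^bsub>G\<^esub> ?k = inv\<^bsub>G\<^esub> g \<otimes>\<^bsub>G\<^esub> x \<otimes>\<^bsub>G\<^esub> g"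
  proof -
    have 1: "inv\<^bsub>G\<^esub> b \<otimes>\<^bsub>G\<^esub> (b \<otimes>\<^bsub>G\<^esub> z) = z" if "z \<in> carrier G" for z using bc that by (simp flip: G.m_assoc)
    show ?thesis unfolding ik x'_def using g bc xc by (simp add: G.m_assoc 1)
  qed
  ultimately show ?thesis by simp
qed

section \<open>Chains and normalisers of parabolic subgroups\<close>

definition cpar :: "'v set \<Rightarrow> 'v gword set \<Rightarrow> 'v gword set set" where
  "cpar S k = {x \<in> carrier G. inv\<^bsub>G\<^esub> k \<otimes>\<^bsub>G\<^esub> x \<otimes>\<^bsub>G\<^esub> k \<in> standard_parabolic \<Gamma> S}"

lemma standard_parabolic_carr: "S \<subseteq> V \<Longrightarrow> standard_parabolic \<Gamma> S \<subseteq> carrier G"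
  using subgroup.subset[OF subgroup_standard_parabolic] .

lemma parabolic_iff: "parabolic \<Gamma> P \<longleftrightarrow> (\<exists>S k. S \<subseteq> V \<and> k \<in> carrier G \<and> P = cpar S k)"
proof -
  have "conjugate_set G k (standard_parabolic \<Gamma> S) = cpar S k" if "S \<subseteq> V" "k \<in> carrier G" for S k
    unfolding cpar_def by (rule G.conjugate_set_eq[OF that(2) standard_parabolic_carr[OF that(1)]])
  then show ?thesis unfolding parabolic_def by (simp only: cong: conj_cong)
qed

text \<open>The quotient of the two conjugating elements conjugates the standard parabolic subgroup
  into itself; then its inverse does so as well.\<close>

lemma cpar_subset_eq:
  assumes S: "S \<subseteq> V" and k: "k \<in> carrier G" "k' \<in> carrier G" and sub: "cpar S k \<subseteq> cpar S k'"
  shows "cpar S k = cpar S k'"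
proof
  interpret A: subgroup "standard_parabolic \<Gamma> S" G by (rule subgroup_standard_parabolic[OF S])
  let ?g = "inv\<^bsub>G\<^esub> k' \<otimes>\<^bsub>G\<^esub> k"
  have g: "?g \<in> carrier G" "inv\<^bsub>G\<^esub> ?g = inv\<^bsub>G\<^esub> k \<otimes>\<^bsub>G\<^esub> k'" using k by (auto simp: G.inv_mult_group)
  have c1: "inv\<^bsub>G\<^esub> k \<otimes>\<^bsub>G\<^esub> (k \<otimes>\<^bsub>G\<^esub> z) = z" if "z \<in> carrier G" for z using k that by (simp flip: G.m_assoc)
  have c2: "k' \<otimes>\<^bsub>G\<^esub> (inv\<^bsub>G\<^esub> k' \<otimes>\<^bsub>G\<^esub> z) = z" if "z \<in> carrier G" for z using k that by (simp flip: G.m_assoc)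
  have conj: "?g \<otimes>\<^bsub>G\<^esub> a \<otimes>\<^bsub>G\<^esub> inv\<^bsub>G\<^esub> ?g \<in> standard_parabolic \<Gamma> S" if a: "a \<in> standard_parabolic \<Gamma> S" for a
  proof -
    have ac: "a \<in> carrier G" using a by simp
    have "k \<otimes>\<^bsub>G\<^esub> a \<otimes>\<^bsub>G\<^esub> inv\<^bsub>G\<^esub> k \<in> cpar S k" using a ac k by (simp add: cpar_def G.m_assoc c1)
    then have "inv\<^bsub>G\<^esub> k' \<otimes>\<^bsub>G\<^esub> (k \<otimes>\<^bsub>G\<^esub> a \<otimes>\<^bsub>G\<^esub> inv\<^bsub>G\<^esub> k) \<otimes>\<^bsub>G\<^esub> k' \<in> standard_parabolic \<Gamma> S" using sub by (auto simp: cpar_def)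
    then show ?thesis unfolding g(2) using k ac by (simp add: G.m_assoc)
  qed
  show "cpar S k' \<subseteq> cpar S k"
  proof
    fix x assume x: "x \<in> cpar S k'"
    then have xc: "x \<in> carrier G" "inv\<^bsub>G\<^esub> k' \<otimes>\<^bsub>G\<^esub> x \<otimes>\<^bsub>G\<^esub> k' \<in> standard_parabolic \<Gamma> S" by (auto simp: cpar_def)
    have "inv\<^bsub>G\<^esub> ?g \<otimes>\<^bsub>G\<^esub> (inv\<^bsub>G\<^esub> k' \<otimes>\<^bsub>G\<^esub> x \<otimes>\<^bsub>G\<^esub> k') \<otimes>\<^bsub>G\<^esub> ?g \<in> standard_parabolic \<Gamma> S"
      by (rule standard_parabolic_conj[OF S g(1) conj xc(2)])
    moreover have "inv\<^bsub>G\<^esub> ?g \<otimes>\<^bsub>G\<^esub> (inv\<^bsub>G\<^esub> k' \<otimes>\<^bsub>G\<^esub> x \<otimes>\<^bsub>G\<^esub> k') \<otimes>\<^bsub>G\<^esub> ?g = inv\<^bsub>G\<^esub> k \<otimes>\<^bsub>G\<^esub> x \<otimes>\<^bsub>G\<^esub> k"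
      unfolding g(2) using k xc(1) by (simp add: G.m_assoc c2)
    ultimately show "x \<in> cpar S k" using xc by (simp add: cpar_def)
  qed
qed (rule sub)

text \<open>There are finitely many types \<open>S\<close>, so one type occurs infinitely often.
  Members of the chain of equal type are comparable, hence equal, and every later member is caught
  between two of them. The argument is the same for both directions of the chain.\<close>

lemma parabolic_chain:
  assumes par: "\<And>n::nat. parabolic \<Gamma> (Q n)"
    and mono: "(\<forall>i j. i \<le> j \<longrightarrow> Q i \<subseteq> Q j) \<or> (\<forall>i j. i \<le> j \<longrightarrow> Q j \<subseteq> Q i)"
  shows "\<exists>N. \<forall>n\<ge>N. Q n = Q N"
proof -
  obtain S k where Sk: "\<And>n. S n \<subseteq> V \<and> k n \<in> carrier G \<and> Q n = cpar (S n) (k n)"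
    using par unfolding parabolic_iff by metis
  have "finite (range S)" using Sk by (intro finite_subset[OF _ finite_Pow_iff[THEN iffD2, OF finite_V]]) auto
  then obtain n0 where "infinite {n \<in> UNIV. S n = S n0}"
    using pigeonhole_infinite[of "UNIV :: nat set" S] by auto
  then have inf: "infinite {n. S n = S n0}" by simp
  have eq: "Q i = Q j" if "S i = S n0" "S j = S n0" for i j
  proof -
    have q: "Q i = cpar (S n0) (k i)" "Q j = cpar (S n0) (k j)"
      using Sk[of i] Sk[of j] that by (simp_all only: simp_thms)
    have c: "S n0 \<subseteq> V" "k i \<in> carrier G" "k j \<in> carrier G" using Sk[of n0] Sk[of i] Sk[of j] by blast+
    have "Q i \<subseteq> Q j \<or> Q j \<subseteq> Q i" using mono nle_le[of i j] by blast
    then show ?thesis unfolding q using cpar_subset_eq[OF c] cpar_subset_eq[OF c(1,3,2)] by blast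
  qed
  have "Q n = Q n0" if n: "n \<ge> n0" for n
  proof -
    obtain j where j: "j > n" "S j = S n0" using inf by (metis (mono_tags, lifting) infinite_nat_iff_unbounded mem_Collect_eq)
    have "Q j = Q n0" using eq[OF j(2)] by simp
    then show ?thesis using mono n less_imp_le[OF j(1)] by blast
  qed
  then show ?thesis by blast
qed

text \<open>Conjugation by \<open>q\<close> permutes the finite set of generators from
  \<open>S\<close>. Two of its powers act equally on this set, and their quotient centralises what
  the set generates.\<close>

lemma quasi_centralizer_power:
  assumes S: "S \<subseteq> V" and q: "q \<in> quasi_centralizer \<Gamma> S"
  shows "\<exists>M::nat. M \<ge> 1 \<and> (\<forall>x\<in>standard_parabolic \<Gamma> S. q [^]\<^bsub>G\<^esub> M \<otimes>\<^bsub>G\<^esub> x = x \<otimes>\<^bsub>G\<^esub> q [^]\<^bsub>G\<^esub> M)"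
    and "\<And>x. x \<in> standard_parabolic \<Gamma> S \<Longrightarrow> q \<otimes>\<^bsub>G\<^esub> x \<otimes>\<^bsub>G\<^esub> inv\<^bsub>G\<^esub> q \<in> standard_parabolic \<Gamma> S"
proof -
  let ?X = "gen ` S"
  interpret A: subgroup "standard_parabolic \<Gamma> S" G by (rule subgroup_standard_parabolic[OF S])
  have qc: "q \<in> carrier G" and qX: "conjugate_set G q ?X = ?X" using q by (auto simp: quasi_centralizer_def)
  have X: "?X \<subseteq> carrier G" using S by auto
  have step: "q \<otimes>\<^bsub>G\<^esub> x \<otimes>\<^bsub>G\<^esub> inv\<^bsub>G\<^esub> q \<in> ?X" if "x \<in> ?X" for x
  proof -
    have "q \<otimes>\<^bsub>G\<^esub> x \<otimes>\<^bsub>G\<^esub> inv\<^bsub>G\<^esub> q \<in> conjugate_set G q ?X"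
      using that unfolding conjugate_set_def l_coset_def r_coset_def by blast
    then show ?thesis unfolding qX .
  qed
  show "\<And>x. x \<in> standard_parabolic \<Gamma> S \<Longrightarrow> q \<otimes>\<^bsub>G\<^esub> x \<otimes>\<^bsub>G\<^esub> inv\<^bsub>G\<^esub> q \<in> standard_parabolic \<Gamma> S"
    unfolding standard_parabolic_def
    by (rule G.generate_conj_closed[OF qc A.subgroup_axioms[unfolded standard_parabolic_def] X generate.incl[OF step]])
  define c where "c n x = q [^]\<^bsub>G\<^esub> n \<otimes>\<^bsub>G\<^esub> x \<otimes>\<^bsub>G\<^esub> inv\<^bsub>G\<^esub> (q [^]\<^bsub>G\<^esub> n)" for n :: nat and x
  have cX: "c n x \<in> ?X" if "x \<in> ?X" for n x
    using that
  proof (induction n)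
    case (Suc n)
    have xc: "x \<in> carrier G" using Suc.prems X by auto
    have "q [^]\<^bsub>G\<^esub> Suc n = q \<otimes>\<^bsub>G\<^esub> q [^]\<^bsub>G\<^esub> n" by (rule G.nat_pow_Suc2[OF qc])
    then have "c (Suc n) x = (q \<otimes>\<^bsub>G\<^esub> q [^]\<^bsub>G\<^esub> n) \<otimes>\<^bsub>G\<^esub> x \<otimes>\<^bsub>G\<^esub> inv\<^bsub>G\<^esub> (q \<otimes>\<^bsub>G\<^esub> q [^]\<^bsub>G\<^esub> n)"
      by (simp only: c_def)
    then have "c (Suc n) x = q \<otimes>\<^bsub>G\<^esub> c n x \<otimes>\<^bsub>G\<^esub> inv\<^bsub>G\<^esub> q"
      using qc xc by (simp add: c_def G.inv_mult_group G.m_assoc)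
    then show ?case using step Suc by simp
  qed (use X in \<open>auto simp: c_def\<close>)
  have "finite ?X" using finite_subset[OF S finite_V] by simp
  then have "finite (?X \<rightarrow>\<^sub>E ?X)" by (intro finite_PiE) auto
  moreover have "range (\<lambda>n. restrict (c n) ?X) \<subseteq> ?X \<rightarrow>\<^sub>E ?X" using cX by auto
  ultimately have "finite (range (\<lambda>n. restrict (c n) ?X))" by (rule rev_finite_subset)
  then have "\<not> inj (\<lambda>n. restrict (c n) ?X)" using finite_imageD infinite_UNIV_nat by blast
  then obtain n0 n1 where n0: "n0 \<noteq> n1" "restrict (c n0) ?X = restrict (c n1) ?X" by (auto simp: inj_def)
  define i j where "i = min n0 n1" and "j = max n0 n1"
  have ij: "i < j" "restrict (c i) ?X = restrict (c j) ?X" using n0 by (auto simp: i_def j_def min_def max_def)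
  define M where "M = j - i"
  have M1: "M \<ge> 1" using ij by (simp add: M_def)
  have comm: "q [^]\<^bsub>G\<^esub> M \<otimes>\<^bsub>G\<^esub> x = x \<otimes>\<^bsub>G\<^esub> q [^]\<^bsub>G\<^esub> M" if x: "x \<in> ?X" for x
  proof -
    have xc: "x \<in> carrier G" using x X by auto
    let ?p = "q [^]\<^bsub>G\<^esub> i" and ?m = "q [^]\<^bsub>G\<^esub> M"
    have pm: "?p \<in> carrier G" "?m \<in> carrier G" using qc by auto
    have "q [^]\<^bsub>G\<^esub> j = ?p \<otimes>\<^bsub>G\<^esub> ?m" using qc ij(1) by (simp add: G.nat_pow_mult M_def)
    then have "c j x = ?p \<otimes>\<^bsub>G\<^esub> (?m \<otimes>\<^bsub>G\<^esub> x \<otimes>\<^bsub>G\<^esub> inv\<^bsub>G\<^esub> ?m) \<otimes>\<^bsub>G\<^esub> inv\<^bsub>G\<^esub> ?p"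
      using pm xc by (simp add: c_def G.inv_mult_group G.m_assoc)
    moreover have "c j x = ?p \<otimes>\<^bsub>G\<^esub> x \<otimes>\<^bsub>G\<^esub> inv\<^bsub>G\<^esub> ?p" using fun_cong[OF ij(2), of x] x by (simp add: c_def)
    ultimately have "?p \<otimes>\<^bsub>G\<^esub> (?m \<otimes>\<^bsub>G\<^esub> x \<otimes>\<^bsub>G\<^esub> inv\<^bsub>G\<^esub> ?m) \<otimes>\<^bsub>G\<^esub> inv\<^bsub>G\<^esub> ?p = ?p \<otimes>\<^bsub>G\<^esub> x \<otimes>\<^bsub>G\<^esub> inv\<^bsub>G\<^esub> ?p"
      by (simp only:)
    then have "?m \<otimes>\<^bsub>G\<^esub> x \<otimes>\<^bsub>G\<^esub> inv\<^bsub>G\<^esub> ?m = x"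
      by (rule inj_onD[OF G.group_hom_conj(2)[OF pm(1)]]) (use pm xc in auto)
    then have "?m \<otimes>\<^bsub>G\<^esub> x \<otimes>\<^bsub>G\<^esub> inv\<^bsub>G\<^esub> ?m \<otimes>\<^bsub>G\<^esub> ?m = x \<otimes>\<^bsub>G\<^esub> ?m" by simp
    then show ?thesis using pm xc by (simp add: G.m_assoc)
  qed
  have "q [^]\<^bsub>G\<^esub> M \<otimes>\<^bsub>G\<^esub> x = x \<otimes>\<^bsub>G\<^esub> q [^]\<^bsub>G\<^esub> M" if x: "x \<in> standard_parabolic \<Gamma> S" for x
  proof -
    obtain w where "w \<in> gwords S" "x = wev G gen w" using x by (auto simp: standard_parabolic_wev[OF S])
    then show ?thesis using G.commute_wev[OF artin_gen_Pi[OF S], of "q [^]\<^bsub>G\<^esub> M" w] comm qc by simp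
  qed
  then show "\<exists>M::nat. M \<ge> 1 \<and> (\<forall>x\<in>standard_parabolic \<Gamma> S. q [^]\<^bsub>G\<^esub> M \<otimes>\<^bsub>G\<^esub> x = x \<otimes>\<^bsub>G\<^esub> q [^]\<^bsub>G\<^esub> M)"
    using M1 by blast
qed

text \<open>After conjugation to a standard parabolic subgroup the normalising element is
  \<open>p q\<close> with \<open>q\<close> permuting the generators. A suitable power of
  \<open>q\<close> centralises, and everything is conjugated back.\<close>

lemma parabolic_normaliser:
  assumes nsp: "normaliser_structure_property \<Gamma>" and par: "parabolic \<Gamma> P" and h: "h \<in> carrier G"
    and norm: "\<And>x. x \<in> carrier G \<Longrightarrow> x \<in> P \<longleftrightarrow> h \<otimes>\<^bsub>G\<^esub> x \<otimes>\<^bsub>G\<^esub> inv\<^bsub>G\<^esub> h \<in> P"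
  shows "\<exists>M::nat. \<exists>p\<in>P. \<exists>z\<in>carrier G. M \<ge> 1 \<and> h [^]\<^bsub>G\<^esub> M = p \<otimes>\<^bsub>G\<^esub> z \<and> (\<forall>x\<in>P. z \<otimes>\<^bsub>G\<^esub> x = x \<otimes>\<^bsub>G\<^esub> z)"
proof -
  obtain S k where S: "S \<subseteq> V" and k: "k \<in> carrier G" and P: "P = cpar S k" using par by (auto simp: parabolic_iff)
  let ?A = "standard_parabolic \<Gamma> S"
  interpret A: subgroup ?A G by (rule subgroup_standard_parabolic[OF S])
  have AG: "?A \<subseteq> carrier G" by (rule standard_parabolic_carr[OF S])
  define h' where "h' = inv\<^bsub>G\<^esub> k \<otimes>\<^bsub>G\<^esub> h \<otimes>\<^bsub>G\<^esub> k"
  have h'c: "h' \<in> carrier G" using h k by (simp add: h'_def)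
  have c1: "inv\<^bsub>G\<^esub> k \<otimes>\<^bsub>G\<^esub> (k \<otimes>\<^bsub>G\<^esub> z) = z" if "z \<in> carrier G" for z using k that by (simp flip: G.m_assoc)
  have c2: "k \<otimes>\<^bsub>G\<^esub> (inv\<^bsub>G\<^esub> k \<otimes>\<^bsub>G\<^esub> z) = z" if "z \<in> carrier G" for z using k that by (simp flip: G.m_assoc)
  have ih': "inv\<^bsub>G\<^esub> h' = inv\<^bsub>G\<^esub> k \<otimes>\<^bsub>G\<^esub> inv\<^bsub>G\<^esub> h \<otimes>\<^bsub>G\<^esub> k"
    using h k by (simp add: h'_def G.inv_mult_group G.m_assoc)
  have mem: "k \<otimes>\<^bsub>G\<^esub> a \<otimes>\<^bsub>G\<^esub> inv\<^bsub>G\<^esub> k \<in> P \<longleftrightarrow> a \<in> ?A" if "a \<in> carrier G" for a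
    unfolding P cpar_def using that k by (simp add: G.m_assoc c1)
  have norm': "a \<in> ?A \<longleftrightarrow> h' \<otimes>\<^bsub>G\<^esub> a \<otimes>\<^bsub>G\<^esub> inv\<^bsub>G\<^esub> h' \<in> ?A" if a: "a \<in> carrier G" for a
  proof -
    have "a \<in> ?A \<longleftrightarrow> k \<otimes>\<^bsub>G\<^esub> a \<otimes>\<^bsub>G\<^esub> inv\<^bsub>G\<^esub> k \<in> P" using mem[OF a] by simp
    also have "\<dots> \<longleftrightarrow> h \<otimes>\<^bsub>G\<^esub> (k \<otimes>\<^bsub>G\<^esub> a \<otimes>\<^bsub>G\<^esub> inv\<^bsub>G\<^esub> k) \<otimes>\<^bsub>G\<^esub> inv\<^bsub>G\<^esub> h \<in> P" by (rule norm) (use a k in simp)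
    also have "h \<otimes>\<^bsub>G\<^esub> (k \<otimes>\<^bsub>G\<^esub> a \<otimes>\<^bsub>G\<^esub> inv\<^bsub>G\<^esub> k) \<otimes>\<^bsub>G\<^esub> inv\<^bsub>G\<^esub> h = k \<otimes>\<^bsub>G\<^esub> (h' \<otimes>\<^bsub>G\<^esub> a \<otimes>\<^bsub>G\<^esub> inv\<^bsub>G\<^esub> h') \<otimes>\<^bsub>G\<^esub> inv\<^bsub>G\<^esub> k"
      unfolding ih' unfolding h'_def using h k a by (simp add: G.m_assoc c2)
    also have "\<dots> \<in> P \<longleftrightarrow> h' \<otimes>\<^bsub>G\<^esub> a \<otimes>\<^bsub>G\<^esub> inv\<^bsub>G\<^esub> h' \<in> ?A" by (rule mem) (use h'c a in simp)
    finally show ?thesis .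
  qed
  have "conjugate_set G h' ?A = ?A"
  proof -
    have d1: "h' \<otimes>\<^bsub>G\<^esub> (inv\<^bsub>G\<^esub> h' \<otimes>\<^bsub>G\<^esub> z) = z" if "z \<in> carrier G" for z using h'c that by (simp flip: G.m_assoc)
    have "inv\<^bsub>G\<^esub> h' \<otimes>\<^bsub>G\<^esub> x \<otimes>\<^bsub>G\<^esub> h' \<in> ?A \<longleftrightarrow> x \<in> ?A" if x: "x \<in> carrier G" for x
      using norm'[of "inv\<^bsub>G\<^esub> h' \<otimes>\<^bsub>G\<^esub> x \<otimes>\<^bsub>G\<^esub> h'"] h'c x by (simp add: G.m_assoc d1)
    then show ?thesis using G.conjugate_set_eq[OF h'c AG] AG by auto
  qed
  then have "h' \<in> normalizer G ?A"
    using h'c AG unfolding normalizer_def stabilizer_def conjugate_set_def by simp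
  then have "h' \<in> ?A <#>\<^bsub>G\<^esub> quasi_centralizer \<Gamma> S" using nsp S unfolding normaliser_structure_property_def by blast
  then obtain p q where pq: "p \<in> ?A" "q \<in> quasi_centralizer \<Gamma> S" "h' = p \<otimes>\<^bsub>G\<^esub> q"
    unfolding set_mult_def by blast
  have qc: "q \<in> carrier G" using pq by (simp add: quasi_centralizer_def)
  have pc: "p \<in> carrier G" using pq by simp
  have qA: "q \<otimes>\<^bsub>G\<^esub> x \<otimes>\<^bsub>G\<^esub> inv\<^bsub>G\<^esub> q \<in> ?A" if "x \<in> ?A" for x
    using quasi_centralizer_power(2)[OF S pq(2) that] .
  obtain M :: nat where M: "M \<ge> 1" "\<And>x. x \<in> ?A \<Longrightarrow> q [^]\<^bsub>G\<^esub> M \<otimes>\<^bsub>G\<^esub> x = x \<otimes>\<^bsub>G\<^esub> q [^]\<^bsub>G\<^esub> M"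
    using quasi_centralizer_power(1)[OF S pq(2)] by blast
  \<comment> \<open>As \<open>q\<close> normalises the subgroup, each new \<open>q\<close> can be
    moved past the factors collected so far, which stay in the subgroup.\<close>
  have pow: "\<exists>p'\<in>?A. h' [^]\<^bsub>G\<^esub> n = p' \<otimes>\<^bsub>G\<^esub> q [^]\<^bsub>G\<^esub> n" for n :: nat
  proof (induction n)
    case (Suc n)
    then obtain p' where p': "p' \<in> ?A" "h' [^]\<^bsub>G\<^esub> n = p' \<otimes>\<^bsub>G\<^esub> q [^]\<^bsub>G\<^esub> n" by blast
    let ?r = "q \<otimes>\<^bsub>G\<^esub> p' \<otimes>\<^bsub>G\<^esub> inv\<^bsub>G\<^esub> q"
    have r: "?r \<in> ?A" using qA p' by blast
    have cc: "p' \<in> carrier G" "q [^]\<^bsub>G\<^esub> n \<in> carrier G" using p' qc by auto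
    have qs: "q [^]\<^bsub>G\<^esub> Suc n = q \<otimes>\<^bsub>G\<^esub> q [^]\<^bsub>G\<^esub> n" "h' [^]\<^bsub>G\<^esub> Suc n = h' \<otimes>\<^bsub>G\<^esub> h' [^]\<^bsub>G\<^esub> n"
      by (rule G.nat_pow_Suc2[OF qc], rule G.nat_pow_Suc2[OF h'c])
    have iq: "inv\<^bsub>G\<^esub> q \<otimes>\<^bsub>G\<^esub> (q \<otimes>\<^bsub>G\<^esub> z) = z" if "z \<in> carrier G" for z using qc that by (simp flip: G.m_assoc)
    have "h' [^]\<^bsub>G\<^esub> Suc n = h' \<otimes>\<^bsub>G\<^esub> (p' \<otimes>\<^bsub>G\<^esub> q [^]\<^bsub>G\<^esub> n)" unfolding qs(2) p'(2) ..
    also have "\<dots> = (p \<otimes>\<^bsub>G\<^esub> q) \<otimes>\<^bsub>G\<^esub> (p' \<otimes>\<^bsub>G\<^esub> q [^]\<^bsub>G\<^esub> n)" unfolding pq(3) ..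
    also have "\<dots> = (p \<otimes>\<^bsub>G\<^esub> ?r) \<otimes>\<^bsub>G\<^esub> q [^]\<^bsub>G\<^esub> Suc n"
      unfolding qs(1) using pc qc cc by (simp add: G.m_assoc iq)
    finally show ?case using A.m_closed[OF pq(1) r] by blast
  qed (use A.one_closed in auto)
  obtain p' where p': "p' \<in> ?A" "h' [^]\<^bsub>G\<^esub> M = p' \<otimes>\<^bsub>G\<^esub> q [^]\<^bsub>G\<^esub> M" using pow by blast
  have p'c: "p' \<in> carrier G" using p' by simp
  have zc: "q [^]\<^bsub>G\<^esub> M \<in> carrier G" using qc by simp
  interpret c: group_hom G G "\<lambda>x. k \<otimes>\<^bsub>G\<^esub> x \<otimes>\<^bsub>G\<^esub> inv\<^bsub>G\<^esub> k" using G.group_hom_conj(1)[OF k] .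
  have kh: "k \<otimes>\<^bsub>G\<^esub> h' \<otimes>\<^bsub>G\<^esub> inv\<^bsub>G\<^esub> k = h" unfolding h'_def using h k by (simp add: G.m_assoc c2)
  have "h [^]\<^bsub>G\<^esub> M = k \<otimes>\<^bsub>G\<^esub> (h' [^]\<^bsub>G\<^esub> M) \<otimes>\<^bsub>G\<^esub> inv\<^bsub>G\<^esub> k" using c.hom_nat_pow[OF h'c, of M] kh by simp
  also have "\<dots> = (k \<otimes>\<^bsub>G\<^esub> p' \<otimes>\<^bsub>G\<^esub> inv\<^bsub>G\<^esub> k) \<otimes>\<^bsub>G\<^esub> (k \<otimes>\<^bsub>G\<^esub> q [^]\<^bsub>G\<^esub> M \<otimes>\<^bsub>G\<^esub> inv\<^bsub>G\<^esub> k)"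
    unfolding p'(2) by (rule c.hom_mult[OF p'c zc])
  finally have hM: "h [^]\<^bsub>G\<^esub> M = (k \<otimes>\<^bsub>G\<^esub> p' \<otimes>\<^bsub>G\<^esub> inv\<^bsub>G\<^esub> k) \<otimes>\<^bsub>G\<^esub> (k \<otimes>\<^bsub>G\<^esub> q [^]\<^bsub>G\<^esub> M \<otimes>\<^bsub>G\<^esub> inv\<^bsub>G\<^esub> k)" .
  have "(k \<otimes>\<^bsub>G\<^esub> q [^]\<^bsub>G\<^esub> M \<otimes>\<^bsub>G\<^esub> inv\<^bsub>G\<^esub> k) \<otimes>\<^bsub>G\<^esub> x = x \<otimes>\<^bsub>G\<^esub> (k \<otimes>\<^bsub>G\<^esub> q [^]\<^bsub>G\<^esub> M \<otimes>\<^bsub>G\<^esub> inv\<^bsub>G\<^esub> k)" if x: "x \<in> P" for x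
  proof -
    let ?a = "inv\<^bsub>G\<^esub> k \<otimes>\<^bsub>G\<^esub> x \<otimes>\<^bsub>G\<^esub> k"
    have a: "?a \<in> ?A" "x \<in> carrier G" using x by (auto simp: P cpar_def)
    have ac: "?a \<in> carrier G" using a k by simp
    have xe: "k \<otimes>\<^bsub>G\<^esub> ?a \<otimes>\<^bsub>G\<^esub> inv\<^bsub>G\<^esub> k = x" using a(2) k by (simp add: G.m_assoc c2)
    show ?thesis using c.hom_mult[OF zc ac] c.hom_mult[OF ac zc] M(2)[OF a(1)] xe by simp
  qed
  then show ?thesis using hM M(1) mem[OF p'c] p'(1) k zc
    by (intro exI[of _ M] bexI[of _ "k \<otimes>\<^bsub>G\<^esub> p' \<otimes>\<^bsub>G\<^esub> inv\<^bsub>G\<^esub> k"] bexI[of _ "k \<otimes>\<^bsub>G\<^esub> q [^]\<^bsub>G\<^esub> M \<otimes>\<^bsub>G\<^esub> inv\<^bsub>G\<^esub> k"]) auto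
qed

end

section \<open>The Artin group acting on the tree of its splitting\<close>

locale artin_splitting = artin \<Gamma> for \<Gamma> :: "'v pgraph" +
  fixes \<Gamma>0 \<Gamma>1 \<Gamma>2 :: "'v pgraph"
  assumes split: "visual_splitting \<Gamma> \<Gamma>0 \<Gamma>1 \<Gamma>2"
begin

definition factor :: "bool \<Rightarrow> 'v pgraph" where "factor i = (if i then \<Gamma>1 else \<Gamma>2)"

abbreviation "Vi i \<equiv> Vert (factor i)"

lemma factor_induced: "induced_subgraph (factor i) \<Gamma>"
  using split by (simp add: factor_def visual_splitting_def)

lemma Vi_V: "Vi i \<subseteq> V" using factor_induced by (simp add: induced_subgraph_def)

lemma V0: "Vert \<Gamma>0 = Vi True \<inter> Vi False" "Vert \<Gamma>0 \<subseteq> Vi i" "Vert \<Gamma>0 \<subseteq> V"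
  using split Vi_V by (auto simp: factor_def visual_splitting_def)

lemma V_cover: "V = Vi True \<union> Vi False"
  using split by (simp add: factor_def visual_splitting_def)

lemma edge_in_factor: "{s, t} \<in> Edge \<Gamma> \<Longrightarrow> \<exists>i. s \<in> Vi i \<and> t \<in> Vi i"
proof -
  assume "{s, t} \<in> Edge \<Gamma>"
  then obtain i where i: "{s, t} \<in> Edge (factor i)"
    using split unfolding visual_splitting_def factor_def by (metis (full_types) UnE)
  have "Edge (factor i) = {e \<in> Edge \<Gamma>. e \<subseteq> Vi i}" using factor_induced by (simp add: induced_subgraph_def)
  then show ?thesis using i by blast
qed

abbreviation "BB i \<equiv> standard_parabolic \<Gamma> (Vi i)"

sublocale am: amalgam G BB "standard_parabolic \<Gamma> (Vert \<Gamma>0)"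
proof (intro amalgam.intro amalgam_axioms.intro G.is_group)
  show "subgroup (BB i) G" for i by (rule subgroup_standard_parabolic[OF Vi_V])
  show "subgroup (standard_parabolic \<Gamma> (Vert \<Gamma>0)) G" by (rule subgroup_standard_parabolic[OF V0(3)])
  show "standard_parabolic \<Gamma> (Vert \<Gamma>0) \<subseteq> BB i" for i
    unfolding standard_parabolic_def using V0(2)[of i] by (intro G.mono_generate) auto
qed

definition lt :: "'v \<times> bool \<Rightarrow> 'v gword set" where
  "lt c = (if snd c then gen (fst c) else inv\<^bsub>G\<^esub> (gen (fst c)))"

text \<open>A generator common to both factors is made to act through the first one. This is a
  convention, since the two factor actions agree on the common subgroup.\<close>

fun letter_act :: "'v \<times> bool \<Rightarrow> 'v gword set list \<Rightarrow> 'v gword set list" where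
  "letter_act (s, b) l = am.factor_act (s \<in> Vi True) (lt (s, b)) l"

lemma lt_in: "s \<in> S \<Longrightarrow> S \<subseteq> V \<Longrightarrow> lt (s, b) \<in> standard_parabolic \<Gamma> S"
  unfolding standard_parabolic_def lt_def by (auto intro: generate.incl generate.inv)

lemma letter_act_factor:
  assumes s: "s \<in> Vi i" and l: "l \<in> am.verts True"
  shows "letter_act (s, b) l = am.factor_act i (lt (s, b)) l"
proof (cases "i = (s \<in> Vi True)")
  case True
  then show ?thesis by simp
next
  case False
  then have "s \<in> Vert \<Gamma>0" using s V0(1) by (cases i) auto
  then have "lt (s, b) \<in> standard_parabolic \<Gamma> (Vert \<Gamma>0)" using lt_in V0(3) by blast
  from am.factor_act_C[OF this l, of "s \<in> Vi True" i] show ?thesis by simp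
qed

lemma letter_act_closed: "s \<in> V \<Longrightarrow> l \<in> am.verts True \<Longrightarrow> letter_act (s, b) l \<in> am.verts True"
proof -
  assume s: "s \<in> V" and l: "l \<in> am.verts True"
  obtain i where i: "s \<in> Vi i" using s V_cover by blast
  show ?thesis unfolding letter_act_factor[OF i l] by (rule am.factor_act_closed[OF lt_in[OF i Vi_V] l])
qed

lemma letter_act_cancel: "s \<in> V \<Longrightarrow> l \<in> am.verts True \<Longrightarrow> letter_act (s, b) (letter_act (s, \<not> b) l) = l"
proof -
  assume s: "s \<in> V" and l: "l \<in> am.verts True"
  obtain i where i: "s \<in> Vi i" using s V_cover by blast
  have c: "lt (s, c) \<in> BB i" for c by (rule lt_in[OF i Vi_V])
  have gs: "gen s \<in> carrier G" using s by simp
  have "lt (s, b) \<otimes>\<^bsub>G\<^esub> lt (s, \<not> b) = \<one>\<^bsub>G\<^esub>" using gs by (cases b) (simp_all add: lt_def)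
  then have "am.factor_act i (lt (s, b)) (am.factor_act i (lt (s, \<not> b)) l) = l"
    using am.factor_act_mult[OF c c l, of b "\<not> b"] am.factor_act_one[OF l] by simp
  then show ?thesis
    unfolding letter_act_factor[OF i l] letter_act_factor[OF i am.factor_act_closed[OF c l]] .
qed

lemma foldr_letter_factor:
  assumes "w \<in> gwords (Vi i)" and l: "l \<in> am.verts True"
  shows "foldr letter_act w l = am.factor_act i (wev G gen w) l"
  using assms(1)
proof (induction w)
  case Nil
  then show ?case using am.factor_act_one[OF l] by simp
next
  case (Cons c w)
  obtain s b where c: "c = (s, b)" by force
  have s: "s \<in> Vi i" "w \<in> gwords (Vi i)" using Cons.prems c by auto
  have wB: "wev G gen w \<in> BB i" using s by (simp add: standard_parabolic_wev[OF Vi_V])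
  have "foldr letter_act (c # w) l = letter_act (s, b) (am.factor_act i (wev G gen w) l)"
    using Cons.IH[OF s(2)] by (simp add: c del: letter_act.simps)
  also have "\<dots> = am.factor_act i (lt (s, b)) (am.factor_act i (wev G gen w) l)"
    by (rule letter_act_factor[OF s(1) am.factor_act_closed[OF wB l]])
  also have "\<dots> = am.factor_act i (lt (s, b) \<otimes>\<^bsub>G\<^esub> wev G gen w) l"
    by (rule am.factor_act_mult[OF lt_in[OF s(1) Vi_V] wB l, symmetric])
  also have "lt (s, b) \<otimes>\<^bsub>G\<^esub> wev G gen w = wev G gen (c # w)" by (simp add: c lt_def)
  finally show ?case .
qed

text \<open>Both ends of an edge lie in one factor, so both sides of its relation act through that
  factor, as one and the same group element.\<close>

lemma foldr_letter_pres_eq: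
  assumes "pres_eq V (artin_relations \<Gamma>) v w" "l \<in> am.verts True"
  shows "foldr letter_act v l = foldr letter_act w l"
proof (rule pres_eq_foldr[OF assms])
  fix r r' l assume r: "(r, r') \<in> artin_relations \<Gamma>" and l: "l \<in> am.verts True"
  obtain s t where st: "s \<in> V" "t \<in> V" "{s, t} \<in> Edge \<Gamma>" "edge_label \<Gamma> s t \<noteq> 0"
    "r = alternating (edge_label \<Gamma> s t) s t" "r' = alternating (edge_label \<Gamma> s t) t s" using relation_form[OF r] by blast
  obtain i where i: "s \<in> Vi i" "t \<in> Vi i" using edge_in_factor[OF st(3)] by blast
  have w: "r \<in> gwords (Vi i)" "r' \<in> gwords (Vi i)" unfolding st(5,6) by (rule alternating_gwords[OF i], rule alternating_gwords[OF i(2,1)])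
  have "wev G gen r = wev G gen r'" unfolding st(5,6) by (rule wev_artin_braid[OF st(1,2,4)])
  then show "foldr letter_act r l = foldr letter_act r' l"
    unfolding foldr_letter_factor[OF w(1) l] foldr_letter_factor[OF w(2) l] by (simp only:)
qed (use letter_act_closed letter_act_cancel in blast)+

definition act :: "'v gword set \<Rightarrow> 'v gword set list \<Rightarrow> 'v gword set list" where
  "act g l = foldr letter_act (SOME w. w \<in> gwords V \<and> wev G gen w = g) l"

lemma act_wev:
  assumes w: "w \<in> gwords V" and l: "l \<in> am.verts True"
  shows "act (wev G gen w) l = foldr letter_act w l"
proof -
  let ?v = "SOME v. v \<in> gwords V \<and> wev G gen v = wev G gen w"
  have v: "?v \<in> gwords V \<and> wev G gen ?v = wev G gen w" by (rule someI[of _ w]) (use w in simp)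
  have "pres_eq V (artin_relations \<Gamma>) ?v w"
    by (rule wev_artin_eq_iff[OF conjunct1[OF v] w, THEN iffD1, OF conjunct2[OF v]])
  then show ?thesis unfolding act_def by (rule foldr_letter_pres_eq[OF _ l])
qed

sublocale aa: amalgam_action G BB "standard_parabolic \<Gamma> (Vert \<Gamma>0)" act
proof
  fix g h l assume l: "l \<in> am.verts True"
  show "act \<one>\<^bsub>G\<^esub> l = l" using act_wev[of "[]" l] l by simp
  {
    fix i assume "g \<in> BB i"
    then obtain w where w: "w \<in> gwords (Vi i)" "g = wev G gen w" by (auto simp: standard_parabolic_wev[OF Vi_V])
    show "act g l = am.factor_act i g l"
      unfolding w(2) act_wev[OF gwords_mono[OF Vi_V w(1)] l] by (rule foldr_letter_factor[OF w(1) l])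
  }
  assume "g \<in> carrier G"
  then obtain v where v: "v \<in> gwords V" "g = wev G gen v" by (auto simp: carrier_artin_wev)
  have vl: "foldr letter_act w l \<in> am.verts True" if "w \<in> gwords V" for w
    by (rule foldr_closed[OF that l]) (rule letter_act_closed)
  show "act g l \<in> am.verts True" unfolding v(2) act_wev[OF v(1) l] by (rule vl[OF v(1)])
  assume "h \<in> carrier G"
  then obtain w where w: "w \<in> gwords V" "h = wev G gen w" by (auto simp: carrier_artin_wev)
  have "g \<otimes>\<^bsub>G\<^esub> h = wev G gen (v @ w)" using G.wev_append[OF artin_gen_Pi[OF order_refl] v(1) w(1)] v w by simp
  then show "act (g \<otimes>\<^bsub>G\<^esub> h) l = act g (act h l)"
    using act_wev[of "v @ w" l] act_wev[OF w(1) l] act_wev[OF v(1) vl[OF w(1)]] v w l by simp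
next
  have sub: "gen ` V \<subseteq> BB True \<union> BB False"
    unfolding standard_parabolic_def using V_cover by (auto intro: generate.incl)
  have carr: "BB True \<union> BB False \<subseteq> carrier G" using standard_parabolic_carr[OF Vi_V] by blast
  have "carrier G = generate G (gen ` V)"
    using carrier_artin_wev[of \<Gamma>] G.generate_eq_wev[OF artin_gen_Pi[OF order_refl, of \<Gamma>]] by simp
  also have "\<dots> \<subseteq> generate G (BB True \<union> BB False)" by (rule G.mono_generate[OF sub])
  finally show "generate G (BB True \<union> BB False) = carrier G"
    using G.generate_incl[OF carr] by blast
qed

text \<open>A vertex stabiliser is a conjugate of some \<open>BB i\<close>. It is therefore
  parabolic, and the alternative for a pair in it is obtained by conjugating the pair into the
  factor and back.\<close>

lemma power_alternative_splitting:
  assumes pa: "\<And>i. power_alternative (artin_group (factor i))"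
    and pip: "parabolic_intersection_property \<Gamma>" and nsp: "normaliser_structure_property \<Gamma>"
  shows "power_alternative G"
proof -
  interpret P: parabolic_tree_action G "am.verts True" act dl "parabolic \<Gamma>"
  proof (intro parabolic_tree_action.intro parabolic_tree_action_axioms.intro aa.tree.tree_action_axioms)
    fix P Q assume P: "parabolic \<Gamma> P"
    obtain S k where S: "S \<subseteq> V" and k: "k \<in> carrier G" and Pe: "P = cpar S k" using P by (auto simp: parabolic_iff)
    show "subgroup P G" unfolding Pe cpar_def by (rule G.subgroup_conjugate[OF k subgroup_standard_parabolic[OF S]])
    show "parabolic \<Gamma> (P \<inter> Q)" if "parabolic \<Gamma> Q" using pip P that unfolding parabolic_intersection_property_def by blast
  next
    fix x assume x: "x \<in> am.verts True"
    obtain i k where k: "k \<in> carrier G" "\<And>g. g \<in> carrier G \<Longrightarrow> act g x = x \<longleftrightarrow> inv\<^bsub>G\<^esub> k \<otimes>\<^bsub>G\<^esub> g \<otimes>\<^bsub>G\<^esub> k \<in> BB i"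
      using aa.stabiliser_conjugate[OF x] by blast
    have "{g \<in> carrier G. act g x = x} = cpar (Vi i) k" unfolding cpar_def using k(2) by blast
    then show "parabolic \<Gamma> {g \<in> carrier G. act g x = x}" unfolding parabolic_iff using k(1) Vi_V by blast
    fix g h assume gh: "g \<in> carrier G" "h \<in> carrier G" "act g x = x" "act h x = x"
    let ?g = "inv\<^bsub>G\<^esub> k \<otimes>\<^bsub>G\<^esub> g \<otimes>\<^bsub>G\<^esub> k" and ?h = "inv\<^bsub>G\<^esub> k \<otimes>\<^bsub>G\<^esub> h \<otimes>\<^bsub>G\<^esub> k"
    have B: "?g \<in> BB i" "?h \<in> BB i" using k(2)[OF gh(1)] k(2)[OF gh(2)] gh by blast+
    have c: "?g \<in> carrier G" "?h \<in> carrier G" using gh k(1) by auto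
    have "pair_alternative G ?g ?h" by (rule parabolic_pair_alternative[OF factor_induced pa B])
    then have "pair_alternative G (k \<otimes>\<^bsub>G\<^esub> ?g \<otimes>\<^bsub>G\<^esub> inv\<^bsub>G\<^esub> k) (k \<otimes>\<^bsub>G\<^esub> ?h \<otimes>\<^bsub>G\<^esub> inv\<^bsub>G\<^esub> k)"
      by (rule pair_alternative_inj_hom[OF G.group_hom_conj[OF k(1)] c])
    moreover have "k \<otimes>\<^bsub>G\<^esub> (inv\<^bsub>G\<^esub> k \<otimes>\<^bsub>G\<^esub> z \<otimes>\<^bsub>G\<^esub> k) \<otimes>\<^bsub>G\<^esub> inv\<^bsub>G\<^esub> k = z" if "z \<in> carrier G" for z
    proof -
      have "k \<otimes>\<^bsub>G\<^esub> (inv\<^bsub>G\<^esub> k \<otimes>\<^bsub>G\<^esub> z) = z" using k(1) that by (simp flip: G.m_assoc)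
      then show ?thesis using k(1) that by (simp add: G.m_assoc)
    qed
    ultimately show "pair_alternative G g h" using gh(1,2) by (simp only:)
  next
    fix R :: "nat \<Rightarrow> 'v gword set set" assume par: "\<And>n. parabolic \<Gamma> (R n)"
    show "\<exists>N. \<forall>n\<ge>N. R n = R N" if desc: "\<And>n. R (Suc n) \<subseteq> R n"
    proof (rule parabolic_chain[OF par], intro disjI2 allI impI)
      show "R j \<subseteq> R i" if "i \<le> j" for i j by (rule lift_Suc_antimono_le[of R, OF desc that])
    qed
    show "\<exists>N. \<forall>n\<ge>N. R n = R N" if asc: "\<And>n. R n \<subseteq> R (Suc n)"
    proof (rule parabolic_chain[OF par], intro disjI1 allI impI)
      show "R i \<subseteq> R j" if "i \<le> j" for i j by (rule lift_Suc_mono_le[of R, OF asc that])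
    qed
  next
    fix P h assume "parabolic \<Gamma> P" "h \<in> carrier G"
      "\<And>x. x \<in> carrier G \<Longrightarrow> x \<in> P \<longleftrightarrow> h \<otimes>\<^bsub>G\<^esub> x \<otimes>\<^bsub>G\<^esub> inv\<^bsub>G\<^esub> h \<in> P"
    then show "\<exists>M::nat. \<exists>p\<in>P. \<exists>z\<in>carrier G. M \<ge> 1 \<and> h [^]\<^bsub>G\<^esub> M = p \<otimes>\<^bsub>G\<^esub> z \<and> (\<forall>x\<in>P. z \<otimes>\<^bsub>G\<^esub> x = x \<otimes>\<^bsub>G\<^esub> z)"
      by (rule parabolic_normaliser[OF nsp])
  qed
  have "am.verts True \<noteq> {}" using am.verts_Nil[of True] by blast
  then show ?thesis by (rule P.tree_power_alternative)
qed

end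

theorem corollary2:
  fixes \<Gamma> \<Gamma>0 \<Gamma>1 \<Gamma>2 :: "'v pgraph"
  assumes "presentation_graph \<Gamma>"
    and "visual_splitting \<Gamma> \<Gamma>0 \<Gamma>1 \<Gamma>2"
    and "power_alternative (artin_group \<Gamma>1)"
    and "power_alternative (artin_group \<Gamma>2)"
    and "parabolic_intersection_property \<Gamma>"
    and "normaliser_structure_property \<Gamma>"
  shows "power_alternative (artin_group \<Gamma>)"
proof -
  interpret artin_splitting \<Gamma> \<Gamma>0 \<Gamma>1 \<Gamma>2
    using assms by unfold_locales
  show ?thesis using assms by (intro power_alternative_splitting) (auto simp: factor_def)
qed

end
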